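(* Let $F\in GL(2,\mathbb Z)$ be a hyperbolic matrix with non-negative entries, and let $\sigma$ be the sum of all entries of $F$. Let $(s_1,s_2)$ and $(u_1,u_2)$ be, respectively, a column eigenvector and a row eigenvector of $F$ with positive entries, let $e_0=(s_2,u_1)$, $f_0=(-s_1,u_2)$, let $L=\mathbb Z e_0+\mathbb Z f_0\subset\mathbb R^2$, and let $\mathcal F$ be the automorphism of the torus $\mathbb T^2=\mathbb R^2/L$ defined by the matrix $F$ in the basis $(e_0,f_0)$. Then the number of nonequivalent Berg partitions for $\mathcal F$ with connectivity matrix $F^T$ is equal to $\left[\frac{\sigma}{2}\right]$, where $[\cdot]$ denotes the integer part.
   Context: Matrix convention: $\mathcal F$ is induced by the linear map $\mathbb R^2\to\mathbb R^2$ sending $e_0\mapsto F_{11}e_0+F_{21}f_0$, $f_0\mapsto F_{12}e_0+F_{22}f_0$. With $(s_1,s_2)$ a column eigenvector of $F$ with positive entries, $(u_1,u_2)$ a row eigenvector of $F$ with positive entries, $e_0=(s_2,u_1)$ and $f_0=(-s_1,u_2)$, this linear map is diagonal in the Cartesian coordinates $(x,y)$; it contracts the horizontal direction and expands the vertical direction. Hyperbolic means that no eigenvalue has modulus $1$. Bi-partition: let $s_1',s_2',u_1',u_2'>0$ be such that $(s_2',u_1')$ and $(-s_1',u_2')$ form a basis of $L$, and let $z\in\mathbb R^2$. Put $Q_1=z+[0,s_1']\times[0,u_1']$ and $Q_2=z+[-s_2',0]\times[0,u_2']$. The $L$-translates of $Q_1$ and $Q_2$ tile the plane, so $\{Q_1,Q_2\}$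 projects to a partition of $\mathbb T^2$ into two rectangles, called a bi-partition of $\mathbb T^2$. Its horizontal spine is (the projection to $\mathbb T^2$ of) $J^s=z+[-s_2',s_1']\times\{0\}$ and its vertical spine is (the projection to $\mathbb T^2$ of) $J^u=z+\{0\}\times[0,u_1'+u_2']$; they cover, respectively, all the horizontal and all the vertical sides of the rectangles in $\mathbb T^2$. Berg partition: a bi-partition is a Berg partition for $\mathcal F$ if $\mathcal F(J^s)\subset J^s$ and $\mathcal F(J^u)\supset J^u$ in $\mathbb T^2$. Connectivity matrix of a Berg partition $\{Q_1,Q_2\}$ for $\mathcal F$: the $2\times 2$ matrix whose $(i,j)$ entry is the number of connected components of $\mathcal F(\operatorname{int}Q_i)\cap \operatorname{int}Q_j$ in $\mathbb T^2$. Equivalence: two Berg partitions $\{Q_1,Q_2\}$ and $\{S_1,S_2\}$ for $\mathcal F$ are equivalent if there is an (invertible) affine map $\mathcal U$ of $\mathbb T^2$ with $\mathcal F\circ\mathcal U=\mathcal U\circ\mathcal F$ and $\mathcal U(Q_i)=S_i$ for $i=1,2$. *)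

theory Defs
  imports "HOL-Analysis.Analysis"
begin

section \<open>Integer matrices\<close>

definition eigenpair :: "'a::comm_ring_1^'n^'n \<Rightarrow> 'a \<Rightarrow> 'a^'n \<Rightarrow> bool" where
  "eigenpair A c v \<longleftrightarrow> v \<noteq> 0 \<and> A *v v = c *s v"

definition column_eigenvector :: "int^'n^'n \<Rightarrow> real^'n \<Rightarrow> bool" where
  "column_eigenvector F s \<longleftrightarrow> (\<exists>c. eigenpair (map_matrix real_of_int F) c s)"

definition row_eigenvector :: "int^'n^'n \<Rightarrow> real^'n \<Rightarrow> bool" where
  "row_eigenvector F u \<longleftrightarrow> (\<exists>c. u \<noteq> 0 \<and> u v* map_matrix real_of_int F = c *s u)"

definition hyperbolic :: "int^'n^'n \<Rightarrow> bool" where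
  "hyperbolic F \<longleftrightarrow>
     (\<forall>(c::complex) v. eigenpair (map_matrix complex_of_int F) c v \<longrightarrow> cmod c \<noteq> 1)"

section \<open>Lattices and the torus\<close>

definition int_span :: "real \<times> real \<Rightarrow> real \<times> real \<Rightarrow> (real \<times> real) set" where
  "int_span e f = {of_int a *\<^sub>R e + of_int b *\<^sub>R f | a b :: int. True}"

definition lattice_basis :: "(real \<times> real) set \<Rightarrow> real \<times> real \<Rightarrow> real \<times> real \<Rightarrow> bool" where
  "lattice_basis L e f \<longleftrightarrow> int_span e f = L \<and>
     (\<forall>a b :: int. of_int a *\<^sub>R e + of_int b *\<^sub>R f = 0 \<longrightarrow> a = 0 \<and> b = 0)"

definition lat_rel :: "(real \<times> real) set \<Rightarrow> ((real \<times> real) \<times> (real \<times> real)) set" where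
  "lat_rel L = {(x, y). x - y \<in> L}"

definition torus :: "(real \<times> real) set \<Rightarrow> (real \<times> real) set set" where
  "torus L = UNIV // lat_rel L"

abbreviation tproj :: "(real \<times> real) set \<Rightarrow> real \<times> real \<Rightarrow> (real \<times> real) set" where
  "tproj L \<equiv> Equiv_Relations.proj (lat_rel L)"

definition torus_topology :: "(real \<times> real) set \<Rightarrow> (real \<times> real) set topology" where
  "torus_topology L = topology (\<lambda>U. U \<subseteq> torus L \<and> open (tproj L -` U))"

lemma tproj_surj: "range (tproj L) = torus L"
  by (auto simp: torus_def quotient_def Equiv_Relations.proj_def)

lemma istopology_torus: "istopology (\<lambda>U. U \<subseteq> torus L \<and> open (tproj L -` U))"
  unfolding istopology_def by (auto simp: vimage_Union intro!: open_Int)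

lemma openin_torus_topology:
  "openin (torus_topology L) U \<longleftrightarrow> U \<subseteq> torus L \<and> open (tproj L -` U)"
  unfolding torus_topology_def by (simp add: topology_inverse'[OF istopology_torus])

lemma topspace_torus_topology: "topspace (torus_topology L) = torus L"
proof -
  have "tproj L -` torus L = UNIV"
    using tproj_surj by auto
  then have "openin (torus_topology L) (torus L)"
    by (simp add: openin_torus_topology)
  then show ?thesis
    by (metis openin_subset openin_topspace openin_torus_topology subset_antisym)
qed

lemma quotient_map_tproj: "quotient_map euclidean (torus_topology L) (tproj L)"
  unfolding quotient_map_def
  by (simp add: topspace_torus_topology tproj_surj openin_torus_topology vimage_def)

text \<open>The linear map of the plane with matrix \<open>F\<close> in the basis \<open>e, f\<close>; the columns of \<open>F\<close>
  are the coordinates of the images of \<open>e\<close> and \<open>f\<close>.\<close>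

definition linear_in_basis ::
  "real \<times> real \<Rightarrow> real \<times> real \<Rightarrow> int^2^2 \<Rightarrow> real \<times> real \<Rightarrow> real \<times> real" where
  "linear_in_basis e f F = construct {e, f}
     (\<lambda>v. if v = e then of_int (F$1$1) *\<^sub>R e + of_int (F$2$1) *\<^sub>R f
          else of_int (F$1$2) *\<^sub>R e + of_int (F$2$2) *\<^sub>R f)"

lemma linear_in_basis:
  assumes "independent {e, f}" "e \<noteq> f"
  shows "linear (linear_in_basis e f F)"
    and "linear_in_basis e f F e = of_int (F$1$1) *\<^sub>R e + of_int (F$2$1) *\<^sub>R f"
    and "linear_in_basis e f F f = of_int (F$1$2) *\<^sub>R e + of_int (F$2$2) *\<^sub>R f"
  using assms unfolding linear_in_basis_def
  by (auto simp: linear_construct construct_basis)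

definition torus_map ::
  "(real \<times> real) set \<Rightarrow> (real \<times> real \<Rightarrow> real \<times> real) \<Rightarrow> (real \<times> real) set \<Rightarrow> (real \<times> real) set" where
  "torus_map L \<Phi> X = (\<Union>x\<in>X. tproj L (\<Phi> x))"

lemma int_span_diff: "x \<in> int_span e f \<Longrightarrow> y \<in> int_span e f \<Longrightarrow> x - y \<in> int_span e f"
proof -
  assume "x \<in> int_span e f" "y \<in> int_span e f"
  then obtain a b c d :: int where "x = of_int a *\<^sub>R e + of_int b *\<^sub>R f"
    "y = of_int c *\<^sub>R e + of_int d *\<^sub>R f" unfolding int_span_def by blast
  then have "x - y = of_int (a - c) *\<^sub>R e + of_int (b - d) *\<^sub>R f"
    by (simp add: algebra_simps)
  then show ?thesis unfolding int_span_def by blast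
qed

lemma equiv_lat_rel: "equiv UNIV (lat_rel (int_span e f))"
proof -
  let ?L = "int_span e f"
  have "0 = of_int 0 *\<^sub>R e + of_int 0 *\<^sub>R f" by simp
  then have z: "0 \<in> ?L" unfolding int_span_def by blast
  have m: "- x \<in> ?L" if "x \<in> ?L" for x using int_span_diff[OF z that] by simp
  have p: "x - z \<in> ?L" if "x - y \<in> ?L" "y - z \<in> ?L" for x y z
    using int_span_diff[OF that(1) m[OF that(2)]] by simp
  show ?thesis
  proof (intro equivI refl_onI symI transI)
    fix x y assume "(x, y) \<in> lat_rel ?L"
    then have "- (x - y) \<in> ?L" by (intro m) (simp add: lat_rel_def)
    then show "(y, x) \<in> lat_rel ?L" by (simp add: lat_rel_def)
  next
    fix x y z assume "(x, y) \<in> lat_rel ?L" "(y, z) \<in> lat_rel ?L"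
    then show "(x, z) \<in> lat_rel ?L" using p unfolding lat_rel_def by blast
  qed (use z in \<open>simp_all add: lat_rel_def\<close>)
qed

lemma torus_map_tproj:
  assumes "linear \<Phi>" and "\<Phi> ` int_span e f \<subseteq> int_span e f"
  shows "torus_map (int_span e f) \<Phi> (tproj (int_span e f) x) = tproj (int_span e f) (\<Phi> x)"
proof -
  have "(\<lambda>x. tproj (int_span e f) (\<Phi> x)) respects lat_rel (int_span e f)"
  proof (rule congruentI)
    fix y z assume "(y, z) \<in> lat_rel (int_span e f)"
    then have "\<Phi> y - \<Phi> z \<in> int_span e f"
      using assms by (auto simp: lat_rel_def linear_diff[symmetric])
    then show "tproj (int_span e f) (\<Phi> y) = tproj (int_span e f) (\<Phi> z)"
      by (subst Equiv_Relations.proj_iff[OF equiv_lat_rel]) (auto simp: lat_rel_def)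
  qed
  from UN_equiv_class[OF equiv_lat_rel this] show ?thesis
    by (simp add: torus_map_def Equiv_Relations.proj_def)
qed

section \<open>Bi-partitions\<close>

record bipart =
  corner :: "real \<times> real"
  width :: "real^2"
  height :: "real^2"

text \<open>A record stands for the pair of rectangles \<open>rect P 1\<close>, \<open>rect P 2\<close> in the plane (which lie
  to the right and to the left of the vertical line through the corner).\<close>

definition rect :: "bipart \<Rightarrow> 2 \<Rightarrow> (real \<times> real) set" where
  "rect P i = (if i = 1
     then cbox (corner P) (corner P + (width P $ 1, height P $ 1))
     else cbox (corner P - (width P $ 2, 0)) (corner P + (0, height P $ 2)))"

definition horizontal_spine :: "bipart \<Rightarrow> (real \<times> real) set" where
  "horizontal_spine P = cbox (corner P - (width P $ 2, 0)) (corner P + (width P $ 1, 0))"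

definition vertical_spine :: "bipart \<Rightarrow> (real \<times> real) set" where
  "vertical_spine P = cbox (corner P) (corner P + (0, height P $ 1 + height P $ 2))"

definition bipartition :: "(real \<times> real) set \<Rightarrow> bipart \<Rightarrow> bool" where
  "bipartition L P \<longleftrightarrow> (\<forall>i. 0 < width P $ i) \<and> (\<forall>i. 0 < height P $ i) \<and>
     lattice_basis L (width P $ 2, height P $ 1) (- width P $ 1, height P $ 2)"

definition berg_partition ::
  "(real \<times> real) set \<Rightarrow> ((real \<times> real) set \<Rightarrow> (real \<times> real) set) \<Rightarrow> bipart \<Rightarrow> bool" where
  "berg_partition L T P \<longleftrightarrow> bipartition L P \<and>
     T ` tproj L ` horizontal_spine P \<subseteq> tproj L ` horizontal_spine P \<and>
     tproj L ` vertical_spine P \<subseteq> T ` tproj L ` vertical_spine P"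

text \<open>The interiors are those of the plane rectangles: the projection of a closed rectangle to the
  torus may touch itself along a side, and then its interior in the torus is larger.\<close>

definition connectivity_matrix ::
  "(real \<times> real) set \<Rightarrow> ((real \<times> real) set \<Rightarrow> (real \<times> real) set) \<Rightarrow> bipart \<Rightarrow> int^2^2" where
  "connectivity_matrix L T P = (\<chi> i j. int (card (connected_components_of
     (subtopology (torus_topology L)
        (T ` tproj L ` interior (rect P i) \<inter> tproj L ` interior (rect P j))))))"

definition torus_affine ::
  "(real \<times> real) set \<Rightarrow> ((real \<times> real) set \<Rightarrow> (real \<times> real) set) \<Rightarrow> bool" where
  "torus_affine L U \<longleftrightarrow> (\<exists>A b. linear A \<and> (\<forall>x. U (tproj L x) = tproj L (A x + b)))"

definition berg_equivalent :: "(real \<times> real) set \<Rightarrow>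
    ((real \<times> real) set \<Rightarrow> (real \<times> real) set) \<Rightarrow> bipart \<Rightarrow> bipart \<Rightarrow> bool" where
  "berg_equivalent L T P P' \<longleftrightarrow>
     (\<exists>U. torus_affine L U \<and> bij_betw U (torus L) (torus L) \<and>
          (\<forall>X\<in>torus L. T (U X) = U (T X)) \<and>
          (\<forall>i. U ` tproj L ` rect P i = tproj L ` rect P' i))"

text \<open>Records with the same rectangles in the torus are equivalent (take the identity for \<open>U\<close>), so
  the classes of records correspond to the classes of partitions.\<close>

definition berg_classes :: "(real \<times> real) set \<Rightarrow>
    ((real \<times> real) set \<Rightarrow> (real \<times> real) set) \<Rightarrow> int^2^2 \<Rightarrow> bipart set set" where
  "berg_classes L T M =
     (let B = {P. berg_partition L T P \<and> connectivity_matrix L T P = M}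
      in B // {(P, P'). P \<in> B \<and> P' \<in> B \<and> berg_equivalent L T P P'})"

end

theory Submission
  imports Defs
begin

text \<open>
  Write \<open>\<mu>\<close> and \<open>\<lambda>\<close> for the contracting and the expanding eigenvalue of \<open>F\<close>, so that the lift
  of the automorphism is \<open>\<Phi> = diag(\<mu>, \<lambda>)\<close> in Cartesian coordinates. Besides \<open>\<bar>\<mu>\<bar> < 1 < \<lambda>\<close>,
  one consequence of hyperbolicity is used everywhere: the coordinate axes contain no lattice point except
  \<open>0\<close>, because \<open>\<Phi>\<close> or its inverse would shrink such a point forever (\<open>lat_horizontal\<close>,
  \<open>lat_vertical\<close>).

  \<^emph>\<open>The connectivity matrix fixes the shape.\<close> For a Berg partition, the images of the rectangles
  cross the rectangles of the tiling completely: the vertical sides of the tiles do not enter the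
  image of an open rectangle, and the horizontal sides of the image do not enter an open tile.
  Hence each component of the intersection in the torus is a rectangle with the width of the image
  and the height of the tile, and comparing areas shows that the connectivity matrix sends the
  vector of heights \<open>h\<close> to \<open>\<lambda> h\<close> (\<open>height_balance\<close>). As the heights are rationally independent, a
  partition of the same dimensions as the basis \<open>e\<^sub>0, f\<^sub>0\<close> has connectivity matrix \<open>F\<^sup>T\<close>
  (\<open>connectivity_determined\<close>). Conversely, if the matrix is \<open>F\<^sup>T\<close>, then the heights of the partition
  and then also its widths are eigenvectors of \<open>F\<close>. So the partition is the image, under a diagonal
  automorphism commuting with \<open>\<Phi>\<close>, of a partition with the original dimensions
  (\<open>berg_index_exists\<close>).

  \<^emph>\<open>Berg partitions of a given shape are lattice points.\<close> No two lattice
  points have the same height or the same abscissa, so the image of a connected spine can meet only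
  one lattice translate of that spine, and each spine condition is an inclusion of two segments.
  Together they say that for exactly one lattice point \<open>q = (\<xi>, \<eta>)\<close> of an explicit rectangle, the
  window, the point \<open>\<Phi> z - z - (\<xi>, 0)\<close> is in the lattice, where \<open>z\<close> is the corner of the partition
  (\<open>berg_partition_iff\<close>, \<open>spine_shift_unique\<close>). With \<open>q = i e\<^sub>0 + j f\<^sub>0\<close>, the number \<open>i + j\<close> is the
  index of the partition.

  \<^emph>\<open>The window has \<open>\<sigma> - 1\<close> lattice points.\<close> In a half-open vertical strip of width \<open>s\<^sub>1 + s\<^sub>2\<close> there is
  one lattice point for every value of \<open>i + j\<close>, and \<open>i\<close> and \<open>j\<close> are monotone in that value. The bottom
  of the window contains \<open>0\<close>, its top contains \<open>(\<Phi> - 1)(e\<^sub>0 + f\<^sub>0)\<close>, of index \<open>\<sigma> - 2\<close>. A point of the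
  strip at such a height but outside the window would give, after a step by \<open>e\<^sub>0\<close> or \<open>f\<^sub>0\<close> and an
  application of \<open>\<Phi>\<close> inverse, a lattice point in a rectangle that has none (\<open>no_lat_point\<close>). So the
  indices are exactly \<open>0, \<dots>, \<sigma> - 2\<close> (\<open>window_index\<close>, \<open>window_ex\<close>, \<open>window_unique\<close>).

  \<^emph>\<open>Equivalence identifies \<open>n\<close> and \<open>\<sigma> - 2 - n\<close>.\<close> An affine map commuting with \<open>\<Phi>\<close> has a diagonal
  linear part. After rescaling to the same shape it can neither expand nor contract, since long
  segments meet both kinds of tiles (\<open>no_expansion\<close>), and it is \<open>1\<close> or \<open>- 1\<close>, since other signs would
  put lattice points on an axis. A translation between the partitions preserves \<open>q\<close>, and a point
  reflection replaces \<open>q\<close> by its reflection in the centre of the window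
  (\<open>affine_image_classified\<close>, \<open>equivalent_iff_index\<close>). Therefore the classes correspond to the
  values of \<open>min n (\<sigma> - 2 - n)\<close>, and there are \<open>\<sigma> div 2\<close> of them (\<open>card_berg_classes\<close>).
\<close>

section \<open>Lattice tilings by two rectangles\<close>

text \<open>
  The two rectangles of a bi-partition with its corner at the origin, and the lattice that tiles
  the plane by them: \<open>pt i j\<close> is \<open>i e + j f\<close> for the basis \<open>e = (s2, u1)\<close>, \<open>f = (- s1, u2)\<close>.
\<close>

locale tile_pair =
  fixes s1 s2 u1 u2 :: real
  assumes pos: "0 < s1" "0 < s2" "0 < u1" "0 < u2"
begin

definition pt :: "int \<Rightarrow> int \<Rightarrow> real \<times> real" where
  "pt i j = (of_int i * s2 - of_int j * s1, of_int i * u1 + of_int j * u2)"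

definition lat :: "(real \<times> real) set" where
  "lat = int_span (s2, u1) (- s1, u2)"

definition tile :: "2 \<Rightarrow> (real \<times> real) set" where
  "tile i = (if i = 1 then cbox (0, 0) (s1, u1) else cbox (- s2, 0) (0, u2))"

definition left :: "2 \<Rightarrow> real" where "left i = (if i = 1 then 0 else - s2)"
definition right :: "2 \<Rightarrow> real" where "right i = (if i = 1 then s1 else 0)"
definition tile_height :: "2 \<Rightarrow> real" where "tile_height i = (if i = 1 then u1 else u2)"

lemma left_right: "left i < right i" and tile_height_pos: "0 < tile_height i"
  using pos by (auto simp: left_def right_def tile_height_def)

lemma lat_iff: "p \<in> lat \<longleftrightarrow> (\<exists>i j. p = pt i j)"
  by (auto simp: lat_def int_span_def pt_def)

lemma latE: "p \<in> lat \<Longrightarrow> (\<And>i j. p = pt i j \<Longrightarrow> thesis) \<Longrightarrow> thesis"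
  by (auto simp: lat_iff)

lemma pt_in_lat [simp]: "pt i j \<in> lat"
  by (auto simp: lat_iff)

lemma pt_diff: "pt i j - pt k l = pt (i - k) (j - l)"
  and pt_add: "pt i j + pt k l = pt (i + k) (j + l)"
  and pt_uminus: "- pt i j = pt (- i) (- j)"
  and pt_zero: "pt 0 0 = 0"
  by (auto simp: pt_def algebra_simps zero_prod_def)

lemma lat_zero [simp]: "0 \<in> lat"
  using pt_in_lat[of 0 0] by (simp add: pt_zero)

lemma lat_diff: "p \<in> lat \<Longrightarrow> q \<in> lat \<Longrightarrow> p - q \<in> lat"
  by (auto elim!: latE simp: pt_diff)

lemma lat_add: "p \<in> lat \<Longrightarrow> q \<in> lat \<Longrightarrow> p + q \<in> lat"
  by (auto elim!: latE simp: pt_add)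

lemma lat_uminus: "p \<in> lat \<Longrightarrow> - p \<in> lat"
  by (auto elim!: latE simp: pt_uminus)

lemma lat_uminus_iff [simp]: "- p \<in> lat \<longleftrightarrow> p \<in> lat"
  using lat_uminus[of p] lat_uminus[of "- p"] by auto

lemma det_pos: "0 < s2 * u2 + s1 * u1"
  using pos by (simp add: add_pos_pos)

lemma basis_independent:
  fixes x y :: real
  assumes "x * s2 - y * s1 = 0" "x * u1 + y * u2 = 0"
  shows "x = 0" "y = 0"
proof -
  have "x * (s2 * u2 + s1 * u1) = u2 * (x * s2 - y * s1) + s1 * (x * u1 + y * u2)"
    "y * (s2 * u2 + s1 * u1) = s2 * (x * u1 + y * u2) - u1 * (x * s2 - y * s1)"
    by (simp_all add: algebra_simps)
  then have "x * (s2 * u2 + s1 * u1) = 0" "y * (s2 * u2 + s1 * u1) = 0"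
    unfolding assms by simp_all
  with det_pos show "x = 0" "y = 0" by simp_all
qed

lemma pt_eq_zero: "pt i j = 0 \<longleftrightarrow> i = 0 \<and> j = 0"
  using basis_independent[of "of_int i" "of_int j"] by (auto simp: pt_def zero_prod_def)

lemma pt_inject: "pt i j = pt k l \<longleftrightarrow> i = k \<and> j = l"
  using pt_eq_zero[of "i - k" "j - l"] by (auto simp: pt_diff[symmetric])

lemma lattice_basis_lat: "lattice_basis lat (s2, u1) (- s1, u2)"
  using pt_eq_zero by (auto simp: lattice_basis_def lat_def pt_def zero_prod_def)

lemma tile_iff:
  "(x, y) \<in> tile i \<longleftrightarrow>
     (if i = 1 then 0 \<le> x \<and> x \<le> s1 \<and> 0 \<le> y \<and> y \<le> u1
      else - s2 \<le> x \<and> x \<le> 0 \<and> 0 \<le> y \<and> y \<le> u2)"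
  by (auto simp: tile_def)

lemma interior_tile: "interior (tile i) = (if i = 1 then box (0, 0) (s1, u1) else box (- s2, 0) (0, u2))"
  by (simp add: tile_def interior_cbox)

lemma interior_tile_iff:
  "(x, y) \<in> interior (tile i) \<longleftrightarrow>
     (if i = 1 then 0 < x \<and> x < s1 \<and> 0 < y \<and> y < u1
      else - s2 < x \<and> x < 0 \<and> 0 < y \<and> y < u2)"
  by (auto simp: interior_tile box_def Basis_prod_def)

lemma tile_Times: "tile i = {left i..right i} \<times> {0..tile_height i}"
  by (auto simp: tile_iff left_def right_def tile_height_def)

lemma interior_tile_Times: "interior (tile i) = {left i<..<right i} \<times> {0<..<tile_height i}"
  by (auto simp: interior_tile_iff left_def right_def tile_height_def)

text \<open>
  If \<open>i\<close> and \<open>j\<close> had opposite signs, the abscissa of \<open>i e + j f\<close> would be too large. So the lattice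
  points of a half-open vertical strip of width \<open>s1 + s2\<close> form a chain along which both coordinates
  in the basis grow, and with them the height.
\<close>

lemma strip_mono:
  assumes "\<bar>of_int i * s2 - of_int j * s1\<bar> < s1 + s2" "0 \<le> i + j"
  shows "0 \<le> i" "0 \<le> j"
proof -
  show "0 \<le> i"
  proof (rule ccontr)
    assume "\<not> 0 \<le> i"
    then have "of_int i * s2 \<le> (-1) * s2" "1 * s1 \<le> of_int j * s1"
      using assms(2) pos by (intro mult_right_mono; linarith)+
    with assms(1) show False by linarith
  qed
  show "0 \<le> j"
  proof (rule ccontr)
    assume "\<not> 0 \<le> j"
    then have "of_int j * s1 \<le> (-1) * s1" "1 * s2 \<le> of_int i * s2"
      using assms(2) pos by (intro mult_right_mono; linarith)+
    with assms(1) show False by linarith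
  qed
qed

text \<open>
  The chain has a point for every value of \<open>i + j\<close>: replacing \<open>f\<close> by \<open>e\<close> moves the abscissa by
  \<open>s1 + s2\<close>, the exact width of the half-open strip.
\<close>

lemma strip_point:
  obtains i j where "i + j = n" "- s2 \<le> x - fst (pt i j)" "x - fst (pt i j) < s1"
proof
  define i where "i = \<lfloor>(x + s2 + of_int n * s1) / (s1 + s2)\<rfloor>"
  have "of_int i \<le> (x + s2 + of_int n * s1) / (s1 + s2)"
    "(x + s2 + of_int n * s1) / (s1 + s2) < of_int i + 1"
    unfolding i_def by linarith+
  then have "of_int i * (s1 + s2) \<le> x + s2 + of_int n * s1"
    "x + s2 + of_int n * s1 < (of_int i + 1) * (s1 + s2)"
    using pos by (simp_all add: field_simps)
  then show "- s2 \<le> x - fst (pt i (n - i))" "x - fst (pt i (n - i)) < s1"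
    by (simp_all add: pt_def algebra_simps)
qed simp

text \<open>
  Let \<open>p\<close> be in an open tile and in the translate by \<open>l\<close> of a closed tile. Then \<open>l\<close> is a lattice
  vector in the strip of \<open>strip_mono\<close>, hence a combination of \<open>e\<close> and \<open>f\<close> with coefficients of one
  sign. If it is not \<open>0\<close>, then the lower of the two tiles ends where the upper one starts or below,
  or else the interior of one has no abscissa in common with the other.
\<close>

lemma interior_tile_disjoint:
  assumes p: "p \<in> interior (tile i)" and q: "p - l \<in> tile j" and l: "l \<in> lat"
  shows "l = 0 \<and> i = j"
proof -
  obtain x y where xy: "p = (x, y)" by force
  obtain m n where mn: "l = pt m n" using l by (rule latE)
  have q': "(x - (of_int m * s2 - of_int n * s1), y - (of_int m * u1 + of_int n * u2)) \<in> tile j"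
    using q by (simp add: xy mn pt_def)
  let ?X = "of_int m * s2 - of_int n * s1" and ?Y = "of_int m * u1 + of_int n * u2"
  have p1: "0 < x \<and> x < s1 \<and> 0 < y \<and> y < u1" if "i = 1"
    using p that by (simp add: xy interior_tile_iff)
  have p2: "- s2 < x \<and> x < 0 \<and> 0 < y \<and> y < u2" if "i \<noteq> 1"
    using p that by (simp add: xy interior_tile_iff)
  have q1: "0 \<le> x - ?X \<and> x - ?X \<le> s1 \<and> 0 \<le> y - ?Y \<and> y - ?Y \<le> u1" if "j = 1"
    using q' that unfolding tile_iff by simp
  have q2: "- s2 \<le> x - ?X \<and> x - ?X \<le> 0 \<and> 0 \<le> y - ?Y \<and> y - ?Y \<le> u2" if "j \<noteq> 1"
    using q' that unfolding tile_iff by simp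
  have x: "- s2 < x" "x < s1" "0 < y"
    using p1 p2 pos by linarith+
  have xX: "- s2 \<le> x - ?X" "x - ?X \<le> s1" "0 \<le> y - ?Y"
    using q1 q2 pos by linarith+
  have strip: "\<bar>?X\<bar> < s1 + s2"
    using x xX by linarith
  consider "m = 0" "n = 0" | "0 < m + n" "0 \<le> m" "0 \<le> n" | "m + n < 0" "m \<le> 0" "n \<le> 0"
  proof -
    have a: "0 \<le> m \<and> 0 \<le> n" if "0 \<le> m + n" using strip_mono[OF strip that] by simp
    have "\<bar>of_int (- m) * s2 - of_int (- n) * s1\<bar> < s1 + s2" using strip by simp
    from strip_mono[OF this] have b: "m \<le> 0 \<and> n \<le> 0" if "m + n \<le> 0" using that by simp
    show ?thesis using that a b by linarith
  qed
  then show ?thesis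
  proof cases
    case 1
    have "i = 1 \<longleftrightarrow> j = 1" using 1 p1 p2 q1 q2 by force
    then have "i = j" using exhaust_2 by metis
    with 1 mn show ?thesis by (simp add: pt_zero)
  next
    case 2
    have m1: "s2 \<le> of_int m * s2" "u1 \<le> of_int m * u1" if "m \<noteq> 0"
      using that 2 pos by simp_all
    have n1: "s1 \<le> of_int n * s1" "u2 \<le> of_int n * u2" if "n \<noteq> 0"
      using that 2 pos by simp_all
    have nn: "0 \<le> of_int m * u1" "0 \<le> of_int n * u2"
      using 2 pos by simp_all
    have False
    proof (cases "i = 1")
      case True
      show False
      proof (cases "m = 0")
        case True
        then have "n \<noteq> 0" "real_of_int m * s2 = 0" using 2 by simp_all
        then show False using n1 p1[OF \<open>i = 1\<close>] xX by linarith
      next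
        case False
        then show False using m1 nn p1[OF \<open>i = 1\<close>] xX by linarith
      qed
    next
      case i: False
      show False
      proof (cases "n = 0")
        case True
        then have "m \<noteq> 0" "real_of_int n * s1 = 0" using 2 by simp_all
        then show False using m1 p2[OF i] xX by linarith
      next
        case False
        then show False using n1 nn p2[OF i] xX by linarith
      qed
    qed
    then show ?thesis ..
  next
    case 3
    have le: "real_of_int k * c \<le> - c" if "k < 0" "0 < c" for k c
    proof -
      have "real_of_int k \<le> - 1" using that by linarith
      then show ?thesis using mult_right_mono[of "real_of_int k" "- 1" c] that by simp
    qed
    have m1: "of_int m * s2 \<le> - s2" "of_int m * u1 \<le> - u1" if "m \<noteq> 0"
      using that 3 pos le by simp_all
    have n1: "of_int n * s1 \<le> - s1" "of_int n * u2 \<le> - u2" if "n \<noteq> 0"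
      using that 3 pos le by simp_all
    have nn: "of_int m * u1 \<le> 0" "of_int n * u2 \<le> 0"
      using 3 pos by (simp_all add: mult_nonpos_nonneg)
    have False
    proof (cases "j = 1")
      case True
      show False
      proof (cases "m = 0")
        case True
        then have "n \<noteq> 0" "real_of_int m * s2 = 0" using 3 by simp_all
        then show False using n1 q1[OF \<open>j = 1\<close>] x by linarith
      next
        case False
        then show False using m1 nn q1[OF \<open>j = 1\<close>] x by linarith
      qed
    next
      case j: False
      show False
      proof (cases "n = 0")
        case True
        then have "m \<noteq> 0" "real_of_int n * s1 = 0" using 3 by simp_all
        then show False using m1 q2[OF j] x by linarith
      next
        case False
        then show False using n1 nn q2[OF j] x by linarith
      qed
    qed
    then show ?thesis ..
  qed
qed

text \<open>
  For the abscissa \<open>x\<close> of \<open>p\<close>, the lattice points \<open>l\<close> with \<open>x\<close> in the column above \<open>l\<close> form a chain, in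
  which consecutive heights differ by the height of the tile that \<open>l\<close> puts over \<open>x\<close>. So the tile
  that contains \<open>p\<close> belongs to the last point of the chain below \<open>p\<close>.
\<close>

lemma half_open_tile_cover:
  obtains l i where "l \<in> lat" "left i \<le> fst (p - l)" "fst (p - l) < right i"
    "0 \<le> snd (p - l)" "snd (p - l) < tile_height i"
proof -
  obtain x y where xy: "p = (x, y)" by force
  have "\<forall>n. \<exists>i j. i + j = n \<and> - s2 \<le> x - fst (pt i j) \<and> x - fst (pt i j) < s1"
    by (metis strip_point)
  then obtain f g where fg: "\<And>n. f n + g n = (n::int)"
    "\<And>n. - s2 \<le> x - fst (pt (f n) (g n))" "\<And>n. x - fst (pt (f n) (g n)) < s1"
    by metis
  \<comment> \<open>\<open>f n\<close> and \<open>g n\<close> are the coordinates of the \<open>n\<close>-th point of the chain, \<open>h n\<close> is its height.\<close>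
  define h where "h n = snd (pt (f n) (g n))" for n
  define c where "c = min u1 u2"
  have c: "0 < c" "c \<le> u1" "c \<le> u2" using pos by (auto simp: c_def)
  have mono: "f m \<le> f n \<and> g m \<le> g n" if "m \<le> n" for m n
  proof -
    have "\<bar>of_int (f n - f m) * s2 - of_int (g n - g m) * s1\<bar> < s1 + s2"
      using fg(2,3)[of n] fg(2,3)[of m] by (simp add: pt_def algebra_simps)
    moreover have "0 \<le> (f n - f m) + (g n - g m)"
      using that fg(1)[of n] fg(1)[of m] by linarith
    ultimately show ?thesis using strip_mono[of "f n - f m" "g n - g m"] by auto
  qed
  have growth: "of_int (n - m) * c \<le> h n - h m" if "m \<le> n" for m n
  proof -
    have "n - m = (f n - f m) + (g n - g m)" using fg(1)[of n] fg(1)[of m] by linarith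
    then have "of_int (n - m) * c = of_int ((f n - f m) + (g n - g m)) * c" by simp
    also have "\<dots> = of_int (f n - f m) * c + of_int (g n - g m) * c"
      by (simp add: algebra_simps)
    also have "\<dots> \<le> of_int (f n - f m) * u1 + of_int (g n - g m) * u2"
      using mono[OF that] c by (intro add_mono mult_left_mono) auto
    also have "\<dots> = h n - h m" by (simp add: h_def pt_def algebra_simps)
    finally show ?thesis .
  qed
  \<comment> \<open>The heights grow at least by \<open>c\<close> per step, so \<open>- N\<close> is below and \<open>N\<close> above the point.\<close>
  define N where "N = \<lceil>\<bar>y - h 0\<bar> / c\<rceil> + 1"
  have "\<bar>y - h 0\<bar> / c < of_int N" unfolding N_def by linarith
  then have Nc: "\<bar>y - h 0\<bar> < of_int N * c" using c by (simp add: field_simps)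
  then have N: "0 \<le> N" using c by (smt (verit) mult_nonpos_nonneg of_int_le_0_iff)
  have lo: "h (- N) \<le> y" using growth[of "- N" 0] N Nc by simp
  have hi: "y < h (- N + int (nat (2 * N)))" using growth[of 0 N] N Nc by simp
  define k where "k = (LEAST k. y < h (- N + int k))"
  have k: "y < h (- N + int k)" unfolding k_def using hi by (rule LeastI)
  have "k \<noteq> 0" using k lo by (cases k) auto
  then obtain k' where k': "k = Suc k'" by (cases k) auto
  define n where "n = - N + int k'"
  have below: "h n \<le> y"
    using not_less_Least[of k' "\<lambda>k. y < h (- N + int k)"] k' by (simp add: k_def n_def not_less)
  have above: "y < h (n + 1)" using k k' by (simp add: n_def algebra_simps)
  have step: "(f (n + 1) = f n + 1 \<and> g (n + 1) = g n) \<or> (f (n + 1) = f n \<and> g (n + 1) = g n + 1)"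
    using mono[of n "n + 1"] fg(1)[of n] fg(1)[of "n + 1"] by linarith
  show thesis
  proof (cases "0 \<le> x - fst (pt (f n) (g n))")
    case True
    have "f (n + 1) = f n + 1 \<and> g (n + 1) = g n \<or> h (n + 1) \<le> h n + u1"
      using step fg(3)[of "n + 1"] True pos by (auto simp: pt_def algebra_simps)
    then have "y - h n < u1" using above by (auto simp: h_def pt_def algebra_simps)
    then show thesis
      using that[of "pt (f n) (g n)" 1] True fg(3)[of n] below
      by (simp add: xy h_def left_def right_def tile_height_def)
  next
    case False
    have "f (n + 1) = f n \<and> g (n + 1) = g n + 1 \<or> h (n + 1) \<le> h n + u2"
      using step fg(2)[of "n + 1"] False pos by (auto simp: pt_def algebra_simps)
    then have "y - h n < u2" using above by (auto simp: h_def pt_def algebra_simps)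
    then show thesis
      using that[of "pt (f n) (g n)" 2] False fg(2)[of n] below
      by (simp add: xy h_def left_def right_def tile_height_def)
  qed
qed

lemma tile_cover:
  obtains l i where "l \<in> lat" "p - l \<in> tile i"
proof -
  obtain l i where l: "l \<in> lat" "left i \<le> fst (p - l)" "fst (p - l) < right i"
    "0 \<le> snd (p - l)" "snd (p - l) < tile_height i"
    by (rule half_open_tile_cover)
  then have "p - l \<in> tile i" by (simp add: tile_Times mem_Times_iff)
  with l(1) show thesis by (rule that)
qed

end

section \<open>Hyperbolic diagonal automorphisms of the lattice\<close>

definition diag_map :: "real \<Rightarrow> real \<Rightarrow> real \<times> real \<Rightarrow> real \<times> real" where
  "diag_map \<alpha> \<beta> p = (\<alpha> * fst p, \<beta> * snd p)"

lemma diag_map_Pair [simp]: "diag_map \<alpha> \<beta> (x, y) = (\<alpha> * x, \<beta> * y)"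
  by (simp add: diag_map_def)

lemma linear_diag_map: "linear (diag_map \<alpha> \<beta>)"
  by (rule linearI) (auto simp: diag_map_def algebra_simps)

lemmas diag_map_diff = linear_diff[OF linear_diag_map]
  and diag_map_add = linear_add[OF linear_diag_map]

lemma diag_map_comp: "diag_map \<alpha> \<beta> (diag_map \<gamma> \<delta> p) = diag_map (\<alpha> * \<gamma>) (\<beta> * \<delta>) p"
  by (simp add: diag_map_def)

lemma diag_map_1 [simp]: "diag_map 1 1 p = p"
  by (simp add: diag_map_def)

text \<open>
  The geometry of Berg partitions uses only that a diagonal map preserves the lattice. It is kept
  apart from the matrix of that map, because the matrix of a given partition is known only after its
  connectivity has been computed.
\<close>

locale diagonal_automorphism = tile_pair +
  fixes lam mu :: real
  assumes lam_pos: "0 < lam" and mu_nonzero: "mu \<noteq> 0"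
    and phi_lat_iff: "diag_map mu lam p \<in> lat \<longleftrightarrow> p \<in> lat"
begin

abbreviation phi :: "real \<times> real \<Rightarrow> real \<times> real" where
  "phi \<equiv> diag_map mu lam"

definition toral_map :: "(real \<times> real) set \<Rightarrow> (real \<times> real) set" where
  "toral_map = torus_map lat phi"

lemma phi_lat: "p \<in> lat \<Longrightarrow> phi p \<in> lat"
  by (simp add: phi_lat_iff)

lemma lat_phiE:
  assumes "p \<in> lat" obtains q where "q \<in> lat" "p = phi q"
proof
  show eq: "p = phi (diag_map (1 / mu) (1 / lam) p)"
    using lam_pos mu_nonzero by (simp add: diag_map_comp)
  show "diag_map (1 / mu) (1 / lam) p \<in> lat"
    using assms phi_lat_iff eq by metis
qed

end

text \<open>
  A bi-partition in whose basis \<open>(s2, u1), (- s1, u2)\<close> the diagonal map has the matrix with rows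
  \<open>(a, b)\<close> and \<open>(c, d)\<close>. The assumptions \<open>row_x\<close> and \<open>row_y\<close> are the two Cartesian coordinates of the
  matrix equations. The proof interprets this locale in the given basis and again in the basis of
  each Berg partition.
\<close>

locale toral_bipartition = tile_pair s1 s2 u1 u2
  for s1 s2 u1 u2 :: real +
  fixes lam mu :: real and a b c d :: int
  assumes nonneg: "0 \<le> a" "0 \<le> b" "0 \<le> c" "0 \<le> d"
    and unimodular: "\<bar>a * d - b * c\<bar> = 1"
    and lam: "1 < lam"
    and lam_mu: "lam * mu = of_int (a * d - b * c)"
    and row_y: "lam * u1 = of_int a * u1 + of_int c * u2" "lam * u2 = of_int b * u1 + of_int d * u2"
    and row_x: "mu * s2 = of_int a * s2 - of_int c * s1" "mu * s1 = of_int d * s1 - of_int b * s2"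
begin

lemma abs_mu: "\<bar>mu\<bar> * lam = 1"
proof -
  have "\<bar>lam * mu\<bar> = of_int \<bar>a * d - b * c\<bar>" using lam_mu by simp
  then show ?thesis using unimodular lam by (simp add: abs_mult mult.commute)
qed

lemma mu: "mu \<noteq> 0" "\<bar>mu\<bar> < 1"
proof -
  show "mu \<noteq> 0" using abs_mu by auto
  show "\<bar>mu\<bar> < 1"
  proof (rule ccontr)
    assume "\<not> \<bar>mu\<bar> < 1"
    then have "1 * lam \<le> \<bar>mu\<bar> * lam" using lam by (intro mult_right_mono) auto
    with abs_mu lam show False by simp
  qed
qed

lemma diag_map_pt: "diag_map mu lam (pt i j) = pt (a * i + b * j) (c * i + d * j)"
proof -
  have "mu * (of_int i * s2 - of_int j * s1) = of_int i * (mu * s2) - of_int j * (mu * s1)"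
    "lam * (of_int i * u1 + of_int j * u2) = of_int i * (lam * u1) + of_int j * (lam * u2)"
    by (simp_all add: algebra_simps)
  then show ?thesis unfolding row_x row_y by (simp add: pt_def algebra_simps)
qed

sublocale diagonal_automorphism s1 s2 u1 u2 lam mu
proof
  show "0 < lam" using lam by simp
  show "mu \<noteq> 0" by (fact mu)
  fix p
  show "diag_map mu lam p \<in> lat \<longleftrightarrow> p \<in> lat"
  proof
    assume "p \<in> lat"
    then show "diag_map mu lam p \<in> lat" by (auto elim!: latE simp: diag_map_pt)
  next
    assume "diag_map mu lam p \<in> lat"
    then obtain k l where kl: "diag_map mu lam p = pt k l" by (rule latE)
    \<comment> \<open>The inverse matrix is the adjugate times the determinant, which is its own inverse.\<close>
    define D where "D = a * d - b * c"
    have DD: "D * D = 1" using unimodular by (auto simp: D_def[symmetric] abs_if split: if_splits)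
    have "a * (D * (d * k - b * l)) + b * (D * (a * l - c * k)) = (D * D) * k"
      "c * (D * (d * k - b * l)) + d * (D * (a * l - c * k)) = (D * D) * l"
      by (simp_all add: D_def algebra_simps)
    then have "diag_map mu lam (pt (D * (d * k - b * l)) (D * (a * l - c * k))) = diag_map mu lam p"
      by (simp add: diag_map_pt kl DD)
    then have "p = pt (D * (d * k - b * l)) (D * (a * l - c * k))"
      using mu lam by (simp add: diag_map_def prod_eq_iff)
    then show "p \<in> lat" by simp
  qed
qed

text \<open>
  The lattice is discrete: the coordinates of the shrunk points in the lattice basis are integers
  that tend to \<open>0\<close>.
\<close>

lemma lat_shrinking:
  assumes k: "k \<noteq> 0" "\<bar>k\<bar> < 1" and powers: "\<And>n. k ^ n *\<^sub>R p \<in> lat"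
  shows "p = 0"
proof -
  obtain i j where p: "p = pt i j" using powers[of 0] by (auto elim: latE)
  define M where "M = \<bar>real_of_int i\<bar> + \<bar>real_of_int j\<bar> + 1"
  have M: "0 < M" "\<bar>real_of_int i\<bar> < M" "\<bar>real_of_int j\<bar> < M" by (simp_all add: M_def)
  obtain n where n: "\<bar>k\<bar> ^ n < 1 / M" using real_arch_pow_inv[of "1 / M" "\<bar>k\<bar>"] M k by auto
  obtain i' j' where ij': "k ^ n *\<^sub>R p = pt i' j'" using powers[of n] by (auto elim: latE)
  have "(k ^ n * of_int i - of_int i') * s2 - (k ^ n * of_int j - of_int j') * s1 = 0"
    "(k ^ n * of_int i - of_int i') * u1 + (k ^ n * of_int j - of_int j') * u2 = 0"
    using ij' by (simp_all add: p pt_def algebra_simps)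
  from basis_independent[OF this]
  have eq: "of_int i' = k ^ n * of_int i" "of_int j' = k ^ n * of_int j" by simp_all
  have small: "\<bar>k ^ n * x\<bar> < 1" if "\<bar>x\<bar> < M" for x
  proof -
    have "\<bar>k ^ n * x\<bar> = \<bar>k\<bar> ^ n * \<bar>x\<bar>" by (simp add: abs_mult power_abs)
    also have "\<dots> \<le> \<bar>k\<bar> ^ n * M" using that by (intro mult_left_mono) auto
    also have "\<dots> < 1" using n M by (simp add: field_simps)
    finally show ?thesis .
  qed
  have "\<bar>real_of_int i'\<bar> < 1" "\<bar>real_of_int j'\<bar> < 1"
    unfolding eq using small M by blast+
  then have "i' = 0" "j' = 0" by linarith+
  with eq k show ?thesis by (simp add: p pt_zero)
qed

text \<open>
  The inverse of \<open>phi\<close> preserves the lattice and shrinks the vertical axis.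
\<close>

lemma lat_vertical:
  assumes "p \<in> lat" "fst p = 0" shows "p = 0"
proof (rule lat_shrinking[of "1 / lam"])
  fix n show "(1 / lam) ^ n *\<^sub>R p \<in> lat"
  proof (induction n)
    case (Suc n)
    then obtain q where q: "q \<in> lat" "(1 / lam) ^ n *\<^sub>R p = phi q" by (rule lat_phiE)
    have "q = (1 / lam) ^ Suc n *\<^sub>R p"
      using q(2) assms(2) lam mu(1) by (cases p; cases q) (auto simp: field_simps)
    with q(1) show ?case by simp
  qed (use assms in simp)
qed (use lam in auto)

text \<open>
  Here \<open>phi\<close> itself shrinks the axis.
\<close>

lemma lat_horizontal:
  assumes "p \<in> lat" "snd p = 0" shows "p = 0"
proof (rule lat_shrinking[of mu])
  fix n show "mu ^ n *\<^sub>R p \<in> lat"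
  proof (induction n)
    case (Suc n)
    have "phi (mu ^ n *\<^sub>R p) = mu ^ Suc n *\<^sub>R p"
      using assms(2) by (cases p) (auto simp: field_simps)
    with phi_lat[OF Suc] show ?case by simp
  qed (use assms in simp)
qed (use mu in auto)

text \<open>
  If the matrix were triangular, its eigenvalue \<open>lam\<close> would be an integer dividing the determinant,
  which is \<open>1\<close> or \<open>- 1\<close>.
\<close>

lemma off_diagonal: "1 \<le> b" "1 \<le> c"
proof -
  have no: False if "lam = of_int x" "x * y = 1 \<or> x * y = - 1" for x y
    using that lam zmult_eq_1_iff[of x y] zmult_eq_1_iff[of x "- y"] by auto
  have "c \<noteq> 0"
  proof
    assume c0: "c = 0"
    then have "lam = of_int a" using row_y(1) pos by simp
    moreover have "a * d = 1 \<or> a * d = - 1" using unimodular c0 by auto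
    ultimately show False by (rule no)
  qed
  moreover have "b \<noteq> 0"
  proof
    assume b0: "b = 0"
    then have "lam = of_int d" using row_y(2) pos by simp
    moreover have "d * a = 1 \<or> d * a = - 1" using unimodular b0 by (auto simp: mult.commute)
    ultimately show False by (rule no)
  qed
  ultimately show "1 \<le> b" "1 \<le> c" using nonneg by linarith+
qed

lemma trace: "lam + mu = of_int (a + d)"
proof -
  have "(lam - a) * u1 = c * u2" "(lam - d) * u2 = b * u1"
    using row_y by (simp_all add: algebra_simps)
  then have "((lam - a) * u1) * ((lam - d) * u2) = (c * u2) * (b * u1)" by simp
  then have "((lam - a) * (lam - d) - b * c) * (u1 * u2) = 0" by (simp add: algebra_simps)
  then have "(lam - a) * (lam - d) - b * c = 0" using pos by simp
  then have "lam * (lam + mu - (a + d)) = 0" using lam_mu by (simp add: algebra_simps)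
  then show ?thesis using lam by simp
qed

text \<open>
  The vector \<open>(s1, s2)\<close> is an eigenvector for the other eigenvalue, because its coordinates annihilate
  the left eigenvector \<open>(s2, - s1)\<close> of \<open>mu\<close>.
\<close>

lemma column:
  "lam * s1 = of_int a * s1 + of_int b * s2" "lam * s2 = of_int c * s1 + of_int d * s2"
proof -
  have l: "lam = of_int (a + d) - mu" using trace by simp
  show "lam * s1 = of_int a * s1 + of_int b * s2" "lam * s2 = of_int c * s1 + of_int d * s2"
    unfolding l using row_x by (simp_all add: algebra_simps)
qed

text \<open>
  The off-diagonal entries of the matrix are positive, so \<open>s1 \<le> lam * s2\<close> and \<open>s2 \<le> lam * s1\<close>. This
  keeps the top lattice point of the window inside the strip.
\<close>

lemma widths_balanced: "\<bar>mu\<bar> * s1 \<le> s2" "\<bar>mu\<bar> * s2 \<le> s1"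
proof -
  have "1 * s1 \<le> of_int c * s1" "0 \<le> of_int d * s2" "1 * s2 \<le> of_int b * s2" "0 \<le> of_int a * s1"
    using off_diagonal nonneg pos by (auto intro!: mult_right_mono)
  then have *: "s1 \<le> lam * s2" "s2 \<le> lam * s1" using column by linarith+
  have "\<bar>mu\<bar> * s1 \<le> \<bar>mu\<bar> * (lam * s2)" "\<bar>mu\<bar> * s2 \<le> \<bar>mu\<bar> * (lam * s1)"
    using * by (simp_all add: mult_left_mono)
  then show "\<bar>mu\<bar> * s1 \<le> s2" "\<bar>mu\<bar> * s2 \<le> s1"
    using abs_mu by (simp_all add: mult.assoc[symmetric])
qed

section \<open>Lattice points in the window\<close>

text \<open>
  The possible offsets of the image of a spine relative to the spine: the segment
  \<open>x + mu * {- s2..s1}\<close> lies in \<open>{- s2..s1}\<close>, and \<open>y + {0..u1 + u2}\<close> lies in \<open>{0..lam * (u1 + u2)}\<close>.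
  The end points are listed one by one since the sign of \<open>mu\<close> is not fixed.
\<close>

definition window :: "(real \<times> real) set" where
  "window = {(x, y). - s2 \<le> x - mu * s2 \<and> x - mu * s2 \<le> s1 \<and> - s2 \<le> x + mu * s1 \<and> x + mu * s1 \<le> s1
     \<and> 0 \<le> y \<and> y + (u1 + u2) \<le> lam * (u1 + u2)}"

abbreviation top_i :: int where "top_i \<equiv> a + b - 1"
abbreviation top_j :: int where "top_j \<equiv> c + d - 1"

text \<open>
  The top lattice point of the window is \<open>phi (e + f) - (e + f)\<close>, the reflection of \<open>0\<close> in the centre
  of the window.
\<close>

lemma pt_top: "pt top_i top_j = ((1 - mu) * (s1 - s2), (lam - 1) * (u1 + u2))"
proof -
  have "pt top_i top_j = phi (pt 1 1) - pt 1 1" by (simp add: diag_map_pt pt_diff)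
  then show ?thesis by (simp add: pt_def algebra_simps)
qed

lemma window_reflect:
  assumes "pt i j \<in> window" shows "pt (top_i - i) (top_j - j) \<in> window"
proof -
  have "pt (top_i - i) (top_j - j) = pt top_i top_j - pt i j" by (simp add: pt_diff)
  then show ?thesis using assms unfolding pt_top by (auto simp: window_def pt_def algebra_simps)
qed

lemma mu_times_less:
  assumes "0 < r" shows "mu * r < r" "- r < mu * r" "mu * r \<noteq> 0"
proof -
  have "\<bar>mu * r\<bar> < 1 * r" unfolding abs_mult using assms mu by simp
  then show "mu * r < r" "- r < mu * r" by linarith+
  show "mu * r \<noteq> 0" using assms mu by simp
qed

lemma mu_times_sign: "0 \<le> mu * s1 \<and> 0 \<le> mu * s2 \<or> mu * s1 \<le> 0 \<and> mu * s2 \<le> 0"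
  using pos by (cases "0 \<le> mu") (auto simp: mult_nonpos_nonneg)

lemma window_strip:
  assumes "p \<in> window" shows "- s2 < fst p" "fst p < s1"
proof -
  have "- s2 \<le> fst p - mu * s2" "fst p - mu * s2 \<le> s1" "- s2 \<le> fst p + mu * s1" "fst p + mu * s1 \<le> s1"
    using assms by (auto simp: window_def)
  then show "- s2 < fst p" "fst p < s1"
    using mu_times_sign mu_times_less(3)[OF pos(1)] mu_times_less(3)[OF pos(2)] by linarith+
qed

text \<open>
  The window is narrower than \<open>s1 + s2\<close>, so its points lie on one chain.
\<close>

lemma window_unique:
  assumes "pt i j \<in> window" "pt k l \<in> window" "i + j = k + l"
  shows "i = k \<and> j = l"
proof -
  have "\<bar>of_int (i - k) * s2 - of_int (j - l) * s1\<bar> < s1 + s2"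
    using window_strip[OF assms(1)] window_strip[OF assms(2)] by (simp add: pt_def algebra_simps)
  from strip_mono[OF this] strip_mono[of "k - i" "l - j"] this assms(3)
  show ?thesis by (auto simp: algebra_simps)
qed

lemma window_index_nonneg:
  assumes "pt i j \<in> window" shows "0 \<le> i + j"
proof (rule ccontr)
  assume neg: "\<not> 0 \<le> i + j"
  have "\<bar>of_int (- i) * s2 - of_int (- j) * s1\<bar> < s1 + s2"
    using window_strip[OF assms] pos by (simp add: pt_def abs_less_iff)
  from strip_mono[OF this] neg have ij: "i \<le> 0" "j \<le> 0" by auto
  have "of_int i * u1 \<le> 0" "of_int j * u2 \<le> 0" using ij pos by (simp_all add: mult_nonpos_nonneg)
  moreover have "of_int i * u1 < 0 \<or> of_int j * u2 < 0"
    using ij neg pos by (auto simp: mult_less_0_iff)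
  ultimately show False using assms by (auto simp: window_def pt_def)
qed

text \<open>
  A point of negative index lies on the chain below \<open>0\<close>, hence below the window. The upper bound is
  the mirror image of this.
\<close>

lemma window_index:
  assumes "pt i j \<in> window" shows "0 \<le> i + j" "i + j \<le> a + b + c + d - 2"
  using window_index_nonneg[OF assms] window_index_nonneg[OF window_reflect[OF assms]] by auto

text \<open>
  Such a point has \<open>i\<close> or \<open>j\<close> positive to have positive height, not both to have height below
  \<open>u1 + u2\<close>, and then its abscissa is at least \<open>s2\<close> or at most \<open>- s1\<close>.
\<close>

lemma no_lat_point:
  assumes "p \<in> lat" "- s1 < fst p" "fst p < s2" "0 < snd p" "snd p < u1 + u2"
  shows False
proof -
  obtain i j where p: "p = pt i j" using assms(1) by (rule latE)
  have x: "- s1 < of_int i * s2 - of_int j * s1" "of_int i * s2 - of_int j * s1 < s2"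
    and y: "0 < of_int i * u1 + of_int j * u2" "of_int i * u1 + of_int j * u2 < u1 + u2"
    using assms by (simp_all add: p pt_def)
  have ge: "r \<le> real_of_int k * r" if "1 \<le> k" "0 < r" for k r
    using that by simp
  have le: "real_of_int k * r \<le> 0" if "k \<le> 0" "0 < r" for k r
    using that by (simp add: mult_nonpos_nonneg)
  consider "1 \<le> i" "1 \<le> j" | "i \<le> 0" "j \<le> 0" | "1 \<le> i" "j \<le> 0" | "i \<le> 0" "1 \<le> j" by linarith
  then show False
  proof cases
    case 1
    then show False using ge[of i u1] ge[of j u2] pos y by linarith
  next
    case 2
    then show False using le[of i u1] le[of j u2] pos y by linarith
  next
    case 3
    then show False using ge[of i s2] le[of j s1] pos x by linarith
  next
    case 4
    then show False using le[of i s2] ge[of j s1] pos x by linarith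
  qed
qed

lemma top_strip: "- s2 \<le> fst (pt top_i top_j)" "fst (pt top_i top_j) < s1"
proof -
  have "\<bar>mu * s1\<bar> \<le> s2" "\<bar>mu * s2\<bar> \<le> s1"
    using widths_balanced pos by (simp_all add: abs_mult)
  moreover have "fst (pt top_i top_j) = s1 - s2 - mu * s1 + mu * s2"
    unfolding pt_top by (simp add: algebra_simps)
  ultimately show "- s2 \<le> fst (pt top_i top_j)" "fst (pt top_i top_j) < s1"
    using mu_times_sign mu_times_less[OF pos(1)] mu_times_less[OF pos(2)] pos by linarith+
qed

text \<open>
  The point of index \<open>n\<close> on the chain through \<open>0\<close> and the top point has the right height. If it is
  outside the window, it lies so close to the left or right border of the strip that the preimage
  under \<open>phi\<close> of its translate by \<open>e\<close> or \<open>f\<close> falls into the rectangle of \<open>no_lat_point\<close>.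
\<close>

lemma window_ex:
  assumes n: "0 \<le> n" "n \<le> a + b + c + d - 2"
  obtains i j where "i + j = n" "pt i j \<in> window"
proof -
  obtain i' j' where ij': "i' + j' = - n" "- s2 \<le> 0 - fst (pt i' j')" "0 - fst (pt i' j') < s1"
    by (rule strip_point[of "- n" 0])
  define i j where "i = - i'" and "j = - j'"
  have ij: "i + j = n" using ij'(1) by (simp add: i_def j_def)
  have x: "- s2 \<le> fst (pt i j)" "fst (pt i j) < s1"
    using ij' by (simp_all add: pt_def i_def j_def)
  have "\<bar>of_int i * s2 - of_int j * s1\<bar> < s1 + s2"
    using x pos by (simp add: pt_def)
  from strip_mono[OF this] n ij have ge: "0 \<le> i" "0 \<le> j" by auto
  have "\<bar>of_int (top_i - i) * s2 - of_int (top_j - j) * s1\<bar> < s1 + s2"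
    using x top_strip by (simp add: pt_def algebra_simps)
  from strip_mono[OF this] n ij have le: "i \<le> top_i" "j \<le> top_j" by auto
  define X where "X = fst (pt i j)"
  define Y where "Y = snd (pt i j)"
  have XY: "pt i j = (X, Y)" by (simp add: X_def Y_def)
  have Y0: "0 \<le> Y" using ge pos by (simp add: Y_def pt_def)
  have "of_int i * u1 \<le> of_int top_i * u1" "of_int j * u2 \<le> of_int top_j * u2"
    using le pos by (simp_all del: of_int_add of_int_diff)
  then have "Y \<le> snd (pt top_i top_j)" unfolding Y_def pt_def by simp
  then have Y1: "Y + (u1 + u2) \<le> lam * (u1 + u2)" unfolding pt_top by (simp add: algebra_simps)
  \<comment> \<open>For either sign of \<open>mu\<close>, one of the inequalities holds because the point lies in the strip. If the
    other one fails, \<open>r\<close> contradicts \<open>no_lat_point\<close>.\<close>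
  have left: "- s2 \<le> X - mu * s2 \<and> - s2 \<le> X + mu * s1"
  proof (rule ccontr)
    assume bad: "\<not> ?thesis"
    have "pt (i + 1) j \<in> lat" by simp
    then obtain r where r: "r \<in> lat" "pt (i + 1) j = phi r" by (rule lat_phiE)
    have "pt (i + 1) j = (X + s2, Y + u1)" using XY by (simp add: pt_def algebra_simps)
    then have rx: "mu * fst r = X + s2" and ry: "lam * snd r = Y + u1"
      using r(2) by (simp_all add: diag_map_def)
    have "0 < snd r" using ry Y0 pos lam by (smt (verit) mult_nonneg_nonpos)
    moreover have "lam * snd r < lam * (u1 + u2)" using ry Y1 pos by linarith
    then have "snd r < u1 + u2" using lam by simp
    moreover have "- s1 < fst r \<and> fst r < s2"
    proof (cases "mu > 0")
      case True
      have "0 \<le> mu * s1" using True pos by simp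
      then have "mu * fst r < mu * s2" "0 \<le> mu * fst r" using rx bad x(1) by (auto simp: X_def)
      then show ?thesis using True pos by (auto simp: zero_le_mult_iff)
    next
      case False
      then have m: "mu < 0" using mu(1) by simp
      have "mu * s2 \<le> 0" using m pos by (simp add: mult_nonpos_nonneg)
      then have "mu * fst r < mu * (- s1)" "0 \<le> mu * fst r" using rx bad x(1) by (auto simp: X_def)
      then show ?thesis using m pos mult_less_cancel_left_neg[OF m, of "fst r" "- s1"]
        by (auto simp: zero_le_mult_iff)
    qed
    ultimately show False using no_lat_point[OF r(1)] by blast
  qed
  have right: "X - mu * s2 \<le> s1 \<and> X + mu * s1 \<le> s1"
  proof (rule ccontr)
    assume bad: "\<not> ?thesis"
    have "pt i (j + 1) \<in> lat" by simp
    then obtain r where r: "r \<in> lat" "pt i (j + 1) = phi r" by (rule lat_phiE)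
    have "pt i (j + 1) = (X - s1, Y + u2)" using XY by (simp add: pt_def algebra_simps)
    then have rx: "mu * fst r = X - s1" and ry: "lam * snd r = Y + u2"
      using r(2) by (simp_all add: diag_map_def)
    have "0 < snd r" using ry Y0 pos lam by (smt (verit) mult_nonneg_nonpos)
    moreover have "lam * snd r < lam * (u1 + u2)" using ry Y1 pos by linarith
    then have "snd r < u1 + u2" using lam by simp
    moreover have "- s1 < fst r \<and> fst r < s2"
    proof (cases "mu > 0")
      case True
      have "0 \<le> mu * s2" using True pos by simp
      then have "mu * (- s1) < mu * fst r" "mu * fst r < 0" using rx bad x(2) by (auto simp: X_def)
      then show ?thesis using True pos mult_less_cancel_left_pos[OF True, of "- s1" "fst r"]
        by (auto simp: mult_less_0_iff)
    next
      case False
      then have m: "mu < 0" using mu(1) by simp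
      have "mu * s1 \<le> 0" using m pos by (simp add: mult_nonpos_nonneg)
      then have "mu * s2 < mu * fst r" "mu * fst r < 0" using rx bad x(2) by (auto simp: X_def)
      then show ?thesis using m pos mult_less_cancel_left_neg[OF m, of s2 "fst r"]
        by (auto simp: mult_less_0_iff)
    qed
    ultimately show False using no_lat_point[OF r(1)] by blast
  qed
  show thesis using left right Y0 Y1 ij by (intro that[of i j]) (auto simp: window_def XY)
qed

end

section \<open>The Berg condition on the spines\<close>

context tile_pair
begin

lemma tproj_eq_iff: "tproj lat x = tproj lat y \<longleftrightarrow> x - y \<in> lat"
  unfolding lat_def by (subst Equiv_Relations.proj_iff[OF equiv_lat_rel]) (auto simp: lat_rel_def)

lemma tproj_mem_image: "tproj lat x \<in> tproj lat ` S \<longleftrightarrow> (\<exists>y\<in>S. x - y \<in> lat)"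
  by (auto simp: image_iff tproj_eq_iff)

lemma tproj_image_subset: "tproj lat ` A \<subseteq> tproj lat ` B \<longleftrightarrow> (\<forall>p\<in>A. \<exists>q\<in>B. p - q \<in> lat)"
  by (simp add: image_subset_iff tproj_mem_image)

text \<open>
  \<open>P\<close> is a translate of the two tiles by its corner.
\<close>

definition has_shape :: "bipart \<Rightarrow> bool" where
  "has_shape P \<longleftrightarrow> width P $ 1 = s1 \<and> width P $ 2 = s2 \<and> height P $ 1 = u1 \<and> height P $ 2 = u2"

lemma bipartition_lat: "has_shape P \<Longrightarrow> bipartition lat P"
  using pos lattice_basis_lat by (auto simp: bipartition_def has_shape_def forall_2)

lemma rect_iff: "has_shape P \<Longrightarrow> p \<in> rect P i \<longleftrightarrow> p - corner P \<in> tile i"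
  by (cases p; cases "corner P") (auto simp: rect_def tile_def has_shape_def)

lemma interior_rect_iff:
  assumes "has_shape P" shows "p \<in> interior (rect P i) \<longleftrightarrow> p - corner P \<in> interior (tile i)"
proof -
  have "rect P i = (+) (corner P) ` tile i"
    using rect_iff[OF assms] by (force simp: image_iff)
  then have "interior (rect P i) = (+) (corner P) ` interior (tile i)"
    by (simp add: interior_translation)
  then show ?thesis by (force simp: image_iff)
qed

lemma horizontal_spine_iff:
  "has_shape P \<Longrightarrow> p \<in> horizontal_spine P \<longleftrightarrow> (\<exists>x. - s2 \<le> x \<and> x \<le> s1 \<and> p = corner P + (x, 0))"
  by (cases p; cases "corner P")
    (auto simp: horizontal_spine_def has_shape_def intro!: exI[of _ "fst p - fst (corner P)"])

lemma vertical_spine_iff: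
  "has_shape P \<Longrightarrow> p \<in> vertical_spine P \<longleftrightarrow> (\<exists>y. 0 \<le> y \<and> y \<le> u1 + u2 \<and> p = corner P + (0, y))"
  by (cases p; cases "corner P")
    (auto simp: vertical_spine_def has_shape_def intro!: exI[of _ "snd p - snd (corner P)"])

end

context diagonal_automorphism
begin

lemma toral_map_tproj: "toral_map (tproj lat x) = tproj lat (phi x)"
  unfolding toral_map_def lat_def
  by (rule torus_map_tproj[OF linear_diag_map]) (use phi_lat in \<open>auto simp: lat_def\<close>)

lemma toral_map_image: "toral_map ` tproj lat ` S = tproj lat ` phi ` S"
  by (simp add: image_image toral_map_tproj)

end

context toral_bipartition
begin

text \<open>
  The image of the spine and the translates of the spine are horizontal segments, and lattice
  translates are at different heights. So one translate contains the whole image, and the condition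
  compares end points.
\<close>

lemma horizontal_spine_invariant_iff:
  assumes P: "has_shape P"
  shows "toral_map ` tproj lat ` horizontal_spine P \<subseteq> tproj lat ` horizontal_spine P \<longleftrightarrow>
    (\<exists>x. - s2 \<le> x - mu * s2 \<and> x - mu * s2 \<le> s1 \<and> - s2 \<le> x + mu * s1 \<and> x + mu * s1 \<le> s1 \<and>
      phi (corner P) - corner P - (x, 0) \<in> lat)" (is "?lhs \<longleftrightarrow> ?rhs")
proof -
  define g where "g = phi (corner P) - corner P"
  have lhs: "?lhs \<longleftrightarrow> (\<forall>x. - s2 \<le> x \<and> x \<le> s1 \<longrightarrow> (\<exists>x'. - s2 \<le> x' \<and> x' \<le> s1 \<and> g + (mu * x - x', 0) \<in> lat))"
  proof -
    have eq: "phi (corner P + (x, 0)) - (corner P + (x', 0)) = g + (mu * x - x', 0)" for x x'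
      by (cases "corner P") (simp add: diag_map_add g_def algebra_simps)
    have "?lhs \<longleftrightarrow> (\<forall>p\<in>horizontal_spine P. \<exists>q\<in>horizontal_spine P. phi p - q \<in> lat)"
      unfolding toral_map_image tproj_image_subset by simp
    also have "\<dots> \<longleftrightarrow> (\<forall>x. - s2 \<le> x \<and> x \<le> s1 \<longrightarrow> (\<exists>x'. - s2 \<le> x' \<and> x' \<le> s1 \<and>
        phi (corner P + (x, 0)) - (corner P + (x', 0)) \<in> lat))"
      unfolding Bex_def Ball_def horizontal_spine_iff[OF P] by blast
    finally show ?thesis unfolding eq .
  qed
  show ?thesis
  proof
    assume ?lhs
    then have L: "\<exists>x'. - s2 \<le> x' \<and> x' \<le> s1 \<and> g + (mu * x - x', 0) \<in> lat" if "- s2 \<le> x" "x \<le> s1" for x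
      unfolding lhs using that by blast
    obtain x0 where x0: "g + (mu * 0 - x0, 0) \<in> lat" using L[of 0] pos by auto
    have ends: "- s2 \<le> x0 + mu * x \<and> x0 + mu * x \<le> s1" if x: "- s2 \<le> x" "x \<le> s1" for x
    proof -
      obtain x' where x': "- s2 \<le> x'" "x' \<le> s1" "g + (mu * x - x', 0) \<in> lat" using L[OF x] by auto
      have "(g + (mu * x - x', 0)) - (g + (mu * 0 - x0, 0)) = (mu * x - x' + x0, 0)"
        by (cases g) simp
      with lat_diff[OF x'(3) x0] have "(mu * x - x' + x0, 0) \<in> lat" by simp
      from lat_horizontal[OF this] have "x' = x0 + mu * x" by (simp add: zero_prod_def)
      with x' show ?thesis by simp
    qed
    have "g - (x0, 0) \<in> lat" using x0 by (cases g) simp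
    then show ?rhs using ends[of "- s2"] ends[of s1] pos
      by (intro exI[of _ x0]) (simp add: g_def)
  next
    assume ?rhs
    then obtain x0 where x0: "- s2 \<le> x0 - mu * s2" "x0 - mu * s2 \<le> s1" "- s2 \<le> x0 + mu * s1"
      "x0 + mu * s1 \<le> s1" "g - (x0, 0) \<in> lat" by (auto simp: g_def)
    have "\<exists>x'. - s2 \<le> x' \<and> x' \<le> s1 \<and> g + (mu * x - x', 0) \<in> lat" if x: "- s2 \<le> x" "x \<le> s1" for x
    proof (intro exI conjI)
      have "mu * x \<le> mu * s1 \<and> - (mu * s2) \<le> mu * x \<or> mu * s1 \<le> mu * x \<and> mu * x \<le> - (mu * s2)"
      proof (cases "0 \<le> mu")
        case True
        then show ?thesis
          using mult_left_mono[of x s1 mu] mult_left_mono[of "- s2" x mu] x by simp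
      next
        case False
        then show ?thesis
          using mult_left_mono_neg[of x s1 mu] mult_left_mono_neg[of "- s2" x mu] x by simp
      qed
      then show "- s2 \<le> x0 + mu * x" "x0 + mu * x \<le> s1" using x0 by linarith+
      show "g + (mu * x - (x0 + mu * x), 0) \<in> lat" using x0(5) by (cases g) simp
    qed
    then show ?lhs unfolding lhs by blast
  qed
qed

text \<open>
  The same argument for the vertical spine, which has to be contained in one translate of its own
  image.
\<close>

lemma vertical_spine_invariant_iff:
  assumes P: "has_shape P"
  shows "tproj lat ` vertical_spine P \<subseteq> toral_map ` tproj lat ` vertical_spine P \<longleftrightarrow>
    (\<exists>y. 0 \<le> y \<and> y + (u1 + u2) \<le> lam * (u1 + u2) \<and> phi (corner P) - corner P + (0, y) \<in> lat)"
    (is "?lhs \<longleftrightarrow> ?rhs")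
proof -
  define g where "g = phi (corner P) - corner P"
  have lhs: "?lhs \<longleftrightarrow> (\<forall>y. 0 \<le> y \<and> y \<le> u1 + u2 \<longrightarrow>
      (\<exists>y'. 0 \<le> y' \<and> y' \<le> u1 + u2 \<and> g + (0, lam * y' - y) \<in> lat))"
  proof -
    have eq: "corner P + (0, y) - phi (corner P + (0, y')) = - (g + (0, lam * y' - y))" for y y'
      by (cases "corner P") (simp add: diag_map_add g_def algebra_simps)
    have "?lhs \<longleftrightarrow> (\<forall>p\<in>vertical_spine P. \<exists>q\<in>vertical_spine P. p - phi q \<in> lat)"
      unfolding toral_map_image tproj_image_subset by simp
    also have "\<dots> \<longleftrightarrow> (\<forall>y. 0 \<le> y \<and> y \<le> u1 + u2 \<longrightarrow> (\<exists>y'. 0 \<le> y' \<and> y' \<le> u1 + u2 \<and>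
        corner P + (0, y) - phi (corner P + (0, y')) \<in> lat))"
      unfolding Bex_def Ball_def vertical_spine_iff[OF P] by blast
    finally show ?thesis unfolding eq lat_uminus_iff .
  qed
  show ?thesis
  proof
    assume ?lhs
    then have L: "\<exists>y'. 0 \<le> y' \<and> y' \<le> u1 + u2 \<and> g + (0, lam * y' - y) \<in> lat" if "0 \<le> y" "y \<le> u1 + u2" for y
      unfolding lhs using that by blast
    obtain y0 where y0: "0 \<le> y0" "g + (0, lam * y0 - 0) \<in> lat" using L[of 0] pos by auto
    obtain y1 where y1: "y1 \<le> u1 + u2" "g + (0, lam * y1 - (u1 + u2)) \<in> lat"
      using L[of "u1 + u2"] pos by auto
    have "(g + (0, lam * y1 - (u1 + u2))) - (g + (0, lam * y0 - 0)) = (0, lam * y1 - (u1 + u2) - lam * y0)"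
      by (cases g) simp
    with lat_diff[OF y1(2) y0(2)] have "(0, lam * y1 - (u1 + u2) - lam * y0) \<in> lat" by simp
    from lat_vertical[OF this] have "lam * y0 + (u1 + u2) = lam * y1" by (simp add: zero_prod_def)
    moreover have "lam * y1 \<le> lam * (u1 + u2)" "0 \<le> lam * y0" using y1 y0 lam by simp_all
    ultimately show ?rhs using y0 by (intro exI[of _ "lam * y0"]) (simp add: g_def)
  next
    assume ?rhs
    then obtain y0 where y0: "0 \<le> y0" "y0 + (u1 + u2) \<le> lam * (u1 + u2)" "g + (0, y0) \<in> lat"
      by (auto simp: g_def)
    have "\<exists>y'. 0 \<le> y' \<and> y' \<le> u1 + u2 \<and> g + (0, lam * y' - y) \<in> lat" if y: "0 \<le> y" "y \<le> u1 + u2" for y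
    proof (intro exI conjI)
      have "y + y0 \<le> lam * (u1 + u2)" using y y0 by linarith
      then show "0 \<le> (y + y0) / lam" "(y + y0) / lam \<le> u1 + u2"
        using y y0 lam by (simp_all add: field_simps)
      show "g + (0, lam * ((y + y0) / lam) - y) \<in> lat" using y0(3) lam by simp
    qed
    then show ?lhs unfolding lhs by blast
  qed
qed

text \<open>
  The two spine conditions provide offsets \<open>x\<close> and \<open>y\<close> for which \<open>(x, 0)\<close> and \<open>(0, - y)\<close> are both
  congruent to \<open>phi z - z\<close> modulo the lattice. Hence \<open>q = (x, y)\<close> is a lattice point.
\<close>

definition spine_shift :: "real \<times> real \<Rightarrow> real \<times> real \<Rightarrow> bool" where
  "spine_shift z q \<longleftrightarrow> q \<in> lat \<and> q \<in> window \<and> phi z - z - (fst q, 0) \<in> lat"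

lemma berg_partition_iff:
  assumes P: "has_shape P"
  shows "berg_partition lat toral_map P \<longleftrightarrow> (\<exists>q. spine_shift (corner P) q)"
proof -
  let ?g = "phi (corner P) - corner P"
  have "?g - (x, 0) \<in> lat \<and> ?g + (0, y) \<in> lat \<longleftrightarrow> ?g - (x, 0) \<in> lat \<and> (x, y) \<in> lat" for x y
  proof -
    have "(x, y) = (?g + (0, y)) - (?g - (x, 0))" "?g + (0, y) = (?g - (x, 0)) + (x, y)" by simp_all
    then show ?thesis using lat_diff lat_add by metis
  qed
  then have "berg_partition lat toral_map P \<longleftrightarrow> (\<exists>x y. (x, y) \<in> window \<and> ?g - (x, 0) \<in> lat \<and> (x, y) \<in> lat)"
    unfolding berg_partition_def horizontal_spine_invariant_iff[OF P] vertical_spine_invariant_iff[OF P]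
    using bipartition_lat[OF P] by (auto simp: window_def)
  then show ?thesis by (auto simp: spine_shift_def)
qed

lemma spine_shift_unique:
  assumes "spine_shift z q" "spine_shift z r" shows "q = r"
proof -
  let ?g = "phi z - z"
  have "(fst r - fst q, 0) = (?g - (fst q, 0)) - (?g - (fst r, 0))" by simp
  then have "(fst r - fst q, 0) \<in> lat" using assms lat_diff by (metis spine_shift_def)
  from lat_horizontal[OF this] have "fst (q - r) = 0" by (simp add: zero_prod_def)
  with lat_vertical[of "q - r"] lat_diff assms show ?thesis by (simp add: spine_shift_def)
qed

end

section \<open>Tiles and spines modulo the lattice\<close>

text \<open>
  Each member of the partition is open and closed, since its complement is a union of members.
\<close>

lemma connected_components_of_open_partition:
  assumes cover: "\<Union>\<B> = topspace X" and conn: "\<And>B. B \<in> \<B> \<Longrightarrow> connectedin X B"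
    and opn: "\<And>B. B \<in> \<B> \<Longrightarrow> openin X B" and ne: "{} \<notin> \<B>" and disj: "disjoint \<B>"
  shows "connected_components_of X = \<B>"
proof -
  have component: "connected_component_of_set X x = B" if B: "B \<in> \<B>" "x \<in> B" for x B
  proof
    let ?C = "connected_component_of_set X x"
    show "B \<subseteq> ?C" using connected_component_of_maximal[OF conn[OF B(1)] B(2)] .
    let ?R = "\<Union>(\<B> - {B})"
    have sep: "separatedin X B ?R"
    proof (rule separatedin_open_sets[THEN iffD2])
      show "openin X B" "openin X ?R" using opn B by auto
      show "disjnt B ?R" using disj B(1) by (auto simp: disjnt_def disjoint_def)
    qed
    have "x \<in> topspace X" using cover B by auto
    then have "x \<in> ?C" by (simp add: connected_component_of_refl)
    moreover have "?C \<subseteq> B \<union> ?R"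
      using connectedin_subset_topspace[OF connectedin_connected_component_of] cover by fastforce
    moreover have "x \<notin> ?R" using disj B by (auto simp: disjoint_def)
    moreover have "?C \<subseteq> B \<or> ?C \<subseteq> ?R"
      if "?C \<subseteq> B \<union> ?R"
      using connectedin_subset_separated_union[OF connectedin_connected_component_of sep that] .
    ultimately show "?C \<subseteq> B" by (meson subsetD)
  qed
  show ?thesis
  proof
    show "connected_components_of X \<subseteq> \<B>"
      unfolding connected_components_of_def using component cover by fastforce
    show "\<B> \<subseteq> connected_components_of X"
    proof
      fix B assume B: "B \<in> \<B>"
      then obtain x where x: "x \<in> B" using ne by (metis ex_in_conv)
      then have "x \<in> topspace X" using cover B by auto
      then show "B \<in> connected_components_of X"
        unfolding connected_components_of_def using component[OF B x] by (intro image_eqI) auto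
    qed
  qed
qed

context tile_pair
begin

text \<open>
  The saturation of an open set is a union of translates.
\<close>

lemma open_tproj_image:
  assumes "open B" shows "openin (torus_topology lat) (tproj lat ` B)"
proof -
  have "tproj lat -` tproj lat ` B = (\<Union>l\<in>lat. (+) l ` B)"
  proof (intro set_eqI iffI)
    fix x assume "x \<in> tproj lat -` tproj lat ` B"
    then obtain y where "y \<in> B" "x - y \<in> lat" by (auto simp: tproj_eq_iff)
    then show "x \<in> (\<Union>l\<in>lat. (+) l ` B)" by (auto intro!: bexI[of _ "x - y"] image_eqI[of _ _ y])
  next
    fix x assume "x \<in> (\<Union>l\<in>lat. (+) l ` B)"
    then obtain l y where "l \<in> lat" "y \<in> B" "x = l + y" by auto
    then have "tproj lat x = tproj lat y" by (simp add: tproj_eq_iff)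
    with \<open>y \<in> B\<close> show "x \<in> tproj lat -` tproj lat ` B" by simp
  qed
  moreover have "open (\<Union>l\<in>lat. (+) l ` B)" using assms by (intro open_UN ballI open_translation)
  moreover have "tproj lat ` B \<subseteq> torus lat" by (metis image_mono subset_UNIV tproj_surj)
  ultimately show ?thesis by (simp add: openin_torus_topology)
qed

text \<open>
  Cramer's rule bounds the coordinates \<open>i\<close> and \<open>j\<close> of a point \<open>pt i j\<close>.
\<close>

lemma finite_lat_bounded:
  assumes "bounded S" shows "finite (lat \<inter> S)"
proof -
  obtain M where M: "\<And>p. p \<in> S \<Longrightarrow> norm p \<le> M" using assms by (auto simp: bounded_iff)
  \<comment> \<open>A common bound for both numerators in Cramer's rule.\<close>
  define K where "K = \<lceil>(u2 + s1 + u1 + s2) * M / (s2 * u2 + s1 * u1)\<rceil>"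
  have "lat \<inter> S \<subseteq> (\<lambda>(i, j). pt i j) ` ({- K..K} \<times> {- K..K})"
  proof
    fix p assume "p \<in> lat \<inter> S"
    then obtain i j where p: "p = pt i j" and n: "norm p \<le> M" using M lat_iff by blast
    have xy: "\<bar>fst p\<bar> \<le> M" "\<bar>snd p\<bar> \<le> M"
      using norm_fst_le[of "fst p" "snd p"] norm_snd_le[of "snd p" "fst p"] n by auto
    then have M0: "0 \<le> M" by linarith
    have prod: "\<bar>r * x\<bar> \<le> r * M" if "0 < r" "\<bar>x\<bar> \<le> M" for r x
      using that by (simp add: abs_mult)
    have "of_int i * (s2 * u2 + s1 * u1) = u2 * fst p + s1 * snd p"
      "of_int j * (s2 * u2 + s1 * u1) = s2 * snd p - u1 * fst p"
      by (simp_all add: p pt_def algebra_simps)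
    then have "\<bar>of_int i * (s2 * u2 + s1 * u1)\<bar> \<le> (u2 + s1 + u1 + s2) * M"
      "\<bar>of_int j * (s2 * u2 + s1 * u1)\<bar> \<le> (u2 + s1 + u1 + s2) * M"
      using prod[OF pos(1) xy(1)] prod[OF pos(1) xy(2)] prod[OF pos(2) xy(1)] prod[OF pos(2) xy(2)]
        prod[OF pos(3) xy(1)] prod[OF pos(3) xy(2)] prod[OF pos(4) xy(1)] prod[OF pos(4) xy(2)]
      unfolding distrib_right by (simp_all only: abs_le_iff) linarith+
    then have "\<bar>real_of_int i\<bar> \<le> (u2 + s1 + u1 + s2) * M / (s2 * u2 + s1 * u1)"
      "\<bar>real_of_int j\<bar> \<le> (u2 + s1 + u1 + s2) * M / (s2 * u2 + s1 * u1)"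
      using det_pos by (simp_all add: abs_mult pos_le_divide_eq)
    then have "\<bar>i\<bar> \<le> K" "\<bar>j\<bar> \<le> K" unfolding K_def by linarith+
    then show "p \<in> (\<lambda>(i, j). pt i j) ` ({- K..K} \<times> {- K..K})"
      by (auto simp: p intro!: image_eqI[of _ _ "(i, j)"])
  qed
  then show ?thesis by (rule finite_subset) simp
qed

lemma closure_interior_tile: "closure (interior (tile i)) = tile i"
  unfolding interior_tile_Times closure_Times using left_right[of i] tile_height_pos[of i] by (simp add: tile_Times)

text \<open>
  The horizontal spine consists of the bottom sides of the two tiles.
\<close>

lemma interior_avoids_horizontal_spine:
  assumes "p \<in> interior (tile i)" "p - (x, 0) \<in> lat" "- s2 \<le> x" "x \<le> s1"
  shows False
proof -
  have "\<exists>j. (x, 0) \<in> tile j"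
    using assms(3,4) pos by (cases "0 \<le> x") (auto simp: tile_iff intro: exI[of _ 1] exI[of _ 2])
  then obtain j where "(x, 0) \<in> tile j" ..
  then have "p - (x, 0) = 0" using interior_tile_disjoint[OF assms(1), of "p - (x, 0)" j] assms(2) by simp
  then show False using assms(1) by (auto simp: interior_tile_Times)
qed

text \<open>
  The vertical spine consists of the left side of tile \<open>1\<close> and, above it, the left side of tile \<open>2\<close>
  shifted by \<open>e\<close>.
\<close>

lemma interior_avoids_vertical_spine:
  assumes p: "p \<in> interior (tile i)" and l: "p - (0, y) \<in> lat" and y: "0 \<le> y" "y \<le> u1 + u2"
  shows False
proof (cases "y \<le> u1")
  case True
  then have "(0, y) \<in> tile 1" using pos y by (simp add: tile_iff)
  then have "p - (0, y) = 0" "i = 1" using interior_tile_disjoint[OF p, of "p - (0, y)" 1] l by simp_all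
  then show False using p by (auto simp: interior_tile_Times left_def)
next
  case False
  have l': "p - (- s2, y - u1) \<in> lat"
  proof -
    have "p - (- s2, y - u1) = (p - (0, y)) + pt 1 0" by (cases p) (simp add: pt_def)
    then show ?thesis using lat_add[OF l pt_in_lat] by metis
  qed
  have "(- s2, y - u1) \<in> tile 2" using False y pos by (simp add: tile_iff)
  then have "p - (- s2, y - u1) = 0" "i = 2"
    using interior_tile_disjoint[OF p, of "p - (- s2, y - u1)" 2] l' by simp_all
  then show False using p by (auto simp: interior_tile_Times left_def)
qed

text \<open>
  The top side of tile \<open>1\<close> lies on the spine shifted by \<open>e\<close>, and that of tile \<open>2\<close> on the spine
  shifted by \<open>f\<close>.
\<close>

lemma horizontal_side:
  assumes "(x, y) \<in> tile i" "y = 0 \<or> y = tile_height i"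
  obtains x' where "- s2 \<le> x'" "x' \<le> s1" "(x - x', y) \<in> lat"
proof -
  have x: "- s2 \<le> x" "x \<le> s1" "i = 1 \<Longrightarrow> 0 \<le> x" "i \<noteq> 1 \<Longrightarrow> x \<le> 0"
    using assms(1) pos by (auto simp: tile_iff split: if_splits)
  show thesis
  proof (cases "y = 0")
    case True
    then show thesis using that[of x] x by (simp flip: zero_prod_def)
  next
    case False
    show thesis
    proof (cases "i = 1")
      case True
      have "(x - (x - s2), y) = pt 1 0" using False True assms(2) by (simp add: pt_def tile_height_def)
      then have "(x - (x - s2), y) \<in> lat" by (simp only: pt_in_lat)
      then show thesis using that[of "x - s2"] x True pos by simp
    next
      case i: False
      have "(x - (x + s1), y) = pt 0 1" using False i assms(2) by (simp add: pt_def tile_height_def)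
      then have "(x - (x + s1), y) \<in> lat" by (simp only: pt_in_lat)
      then show thesis using that[of "x + s1"] x i pos by simp
    qed
  qed
qed

text \<open>
  The right side of tile \<open>1\<close> lies on the spine shifted by \<open>- f\<close>, and the left side of tile \<open>2\<close> on
  the spine shifted by \<open>- e\<close>.
\<close>

lemma vertical_side:
  assumes "(x, y) \<in> tile i" "x = left i \<or> x = right i"
  obtains y' where "0 \<le> y'" "y' \<le> u1 + u2" "(x, y - y') \<in> lat"
proof -
  have y: "0 \<le> y" "i = 1 \<Longrightarrow> y \<le> u1" "i \<noteq> 1 \<Longrightarrow> y \<le> u2"
    using assms(1) by (auto simp: tile_iff split: if_splits)
  show thesis
  proof (cases "x = 0")
    case True
    then show thesis using that[of y] y pos by (cases "i = 1") (auto simp flip: zero_prod_def)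
  next
    case False
    show thesis
    proof (cases "i = 1")
      case True
      have "(x, y - (y + u2)) = pt 0 (-1)" using False True assms(2) by (auto simp: pt_def left_def right_def)
      then have "(x, y - (y + u2)) \<in> lat" by (simp only: pt_in_lat)
      then show thesis using that[of "y + u2"] y True pos by simp
    next
      case i: False
      have "(x, y - (y + u1)) = pt (-1) 0" using False i assms(2) by (auto simp: pt_def left_def right_def)
      then have "(x, y - (y + u1)) \<in> lat" by (simp only: pt_in_lat)
      then show thesis using that[of "y + u1"] y i pos by simp
    qed
  qed
qed

end

section \<open>Components of the connectivity matrix\<close>

lemma mem_translation: "(q::'a::ab_group_add) \<in> (+) a ` S \<longleftrightarrow> q - a \<in> S"
  by (auto simp: image_iff intro: bexI[of _ "q - a"])

locale berg_bipartition = diagonal_automorphism +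
  fixes P :: bipart
  assumes shape: "has_shape P" and berg: "berg_partition lat toral_map P"
begin

text \<open>
  All sets below are described relative to the corner of \<open>P\<close>. In these coordinates the lift of the
  automorphism is \<open>t \<mapsto> drift + phi t\<close>.
\<close>

definition drift :: "real \<times> real" where
  "drift = phi (corner P) - corner P"

definition moved :: "2 \<Rightarrow> (real \<times> real) set" where
  "moved i = (\<lambda>t. drift + phi t) ` interior (tile i)"

text \<open>
  The lattice translates of tile \<open>j\<close> whose interior meets the image of the interior of tile \<open>i\<close>.
\<close>

definition crossings :: "2 \<Rightarrow> 2 \<Rightarrow> (real \<times> real) set" where
  "crossings i j = {l \<in> lat. \<exists>m\<in>moved i. m - l \<in> interior (tile j)}"

definition moved_left :: "2 \<Rightarrow> real" where
  "moved_left i = fst drift + min (mu * left i) (mu * right i)"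
definition moved_right :: "2 \<Rightarrow> real" where
  "moved_right i = fst drift + max (mu * left i) (mu * right i)"

lemma moved_left_right: "moved_left i < moved_right i"
proof -
  have "mu * left i \<noteq> mu * right i" using left_right[of i] mu_nonzero by simp
  then show ?thesis unfolding moved_left_def moved_right_def by linarith
qed

lemma moved_x_iff:
  "moved_left i < fst drift + mu * x \<and> fst drift + mu * x < moved_right i \<longleftrightarrow> left i < x \<and> x < right i"
proof (cases "0 < mu")
  case True
  then have "mu * left i < mu * right i" using left_right by simp
  then show ?thesis using True by (auto simp: moved_left_def moved_right_def)
next
  case False
  then have m: "mu < 0" using mu_nonzero by simp
  then have "mu * right i < mu * left i" using left_right by simp
  then show ?thesis using m by (auto simp: moved_left_def moved_right_def)
qed

lemma moved_Times:
  "moved i = {moved_left i<..<moved_right i} \<times> {snd drift<..<snd drift + lam * tile_height i}"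
proof (intro set_eqI iffI)
  fix m assume "m \<in> moved i"
  then obtain x y where "left i < x" "x < right i" "0 < y" "y < tile_height i" "m = drift + (mu * x, lam * y)"
    by (auto simp: moved_def interior_tile_Times)
  then show "m \<in> {moved_left i<..<moved_right i} \<times> {snd drift<..<snd drift + lam * tile_height i}"
    using moved_x_iff[of i x] lam_pos by (cases drift) auto
next
  fix m assume m: "m \<in> {moved_left i<..<moved_right i} \<times> {snd drift<..<snd drift + lam * tile_height i}"
  define t where "t = ((fst m - fst drift) / mu, (snd m - snd drift) / lam)"
  have m_t: "m = drift + phi t" using mu_nonzero lam_pos by (cases m; cases drift) (simp add: t_def)
  have "left i < fst t" "fst t < right i" 
    using m moved_x_iff[of i "fst t"] mu_nonzero by (auto simp: t_def)
  moreover have "0 < snd t" "snd t < tile_height i" using m lam_pos by (auto simp: t_def field_simps)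
  ultimately have "t \<in> interior (tile i)" by (simp add: interior_tile_Times mem_Times_iff)
  with m_t show "m \<in> moved i" unfolding moved_def by blast
qed

lemma open_moved: "open (moved i)"
  unfolding moved_Times by (intro open_Times) auto

lemma convex_moved: "convex (moved i)"
  unfolding moved_Times by (intro convex_Times) auto

lemma phi_image_interior_rect: "phi ` interior (rect P i) = (+) (corner P) ` moved i"
proof -
  have "interior (rect P i) = (+) (corner P) ` interior (tile i)"
    by (force simp: interior_rect_iff[OF shape] image_iff)
  then show ?thesis by (simp add: image_image moved_def diag_map_add drift_def algebra_simps)
qed

text \<open>
  The map \<open>phi\<close> carries the tiling to a tiling by the same lattice.
\<close>

lemma moved_disjoint:
  assumes "m \<in> moved i" "m - l \<in> moved j" "l \<in> lat"
  shows "l = 0"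
proof -
  obtain t t' where t: "t \<in> interior (tile i)" "m = drift + phi t"
    and t': "t' \<in> interior (tile j)" "m - l = drift + phi t'"
    using assms by (auto simp: moved_def)
  have l: "l = phi (t - t')" using t(2) t'(2) by (simp add: diag_map_diff algebra_simps)
  then have "t - t' \<in> lat" using assms(3) by (simp add: phi_lat_iff)
  then have "t - t' = 0" using interior_tile_disjoint[OF t(1), of "t - t'" j] t'(1) interior_subset by auto
  then show ?thesis using l by (simp add: diag_map_def zero_prod_def)
qed

text \<open>
  Every translate that is crossed contributes one piece, an open rectangle. The pieces stay disjoint
  in the torus, because translates of the image are disjoint and the projection is injective on an
  open tile. So they are the components, even before their shape is known.
\<close>

lemma connectivity_crossings: "connectivity_matrix lat toral_map P $ i $ j = int (card (crossings i j))"
proof -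
  let ?X = "toral_map ` tproj lat ` interior (rect P i) \<inter> tproj lat ` interior (rect P j)"
  define piece where "piece l = (+) (corner P) ` (interior (tile j) \<inter> (+) (- l) ` moved i)" for l
  have piece_iff: "q \<in> piece l \<longleftrightarrow> q - corner P \<in> interior (tile j) \<and> q - corner P + l \<in> moved i" for q l
    unfolding piece_def mem_translation Int_iff by simp
  define \<B> where "\<B> = (\<lambda>l. tproj lat ` piece l) ` crossings i j"
  have "open (piece l)" for l
    unfolding piece_def by (intro open_translation open_Int open_moved open_interior)
  then have opn: "openin (torus_topology lat) B" if "B \<in> \<B>" for B
    using that open_tproj_image by (auto simp: \<B>_def)
  have "convex (piece l)" for l
    unfolding piece_def interior_tile_Times
    by (intro convex_translation convex_Int convex_moved convex_Times) auto
  then have conn: "connectedin (torus_topology lat) B" if "B \<in> \<B>" for B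
    using that connectedin_continuous_map_image[OF quotient_imp_continuous_map[OF quotient_map_tproj]]
    by (auto simp: \<B>_def convex_connected)
  have overlap: "l = l'" if "q \<in> piece l" "q' \<in> piece l'" "tproj lat q = tproj lat q'"
    "l \<in> crossings i j" "l' \<in> crossings i j" for q q' l l'
  proof -
    have q: "q - corner P \<in> interior (tile j)" "q - corner P + l \<in> moved i"
      "q' - corner P \<in> interior (tile j)" "q' - corner P + l' \<in> moved i"
      using that by (simp_all add: piece_iff)
    have d: "q - q' \<in> lat" using that by (simp add: tproj_eq_iff)
    have "q' - corner P = (q - corner P) - (q - q')" by simp
    then have "(q - corner P) - (q - q') \<in> tile j" using q(3) interior_subset by auto
    then have "q = q'" using interior_tile_disjoint[OF q(1) _ d] by auto
    have "l - l' \<in> lat" using that lat_diff by (simp add: crossings_def)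
    moreover have "(q - corner P + l) - (l - l') \<in> moved i" using q(4) \<open>q = q'\<close> by simp
    ultimately have "l - l' = 0" using moved_disjoint[OF q(2)] by blast
    then show "l = l'" by simp
  qed
  have ne: "piece l \<noteq> {}" if l: "l \<in> crossings i j" for l
  proof -
    obtain m where "m \<in> moved i" "m - l \<in> interior (tile j)" using l unfolding crossings_def by blast
    then have "corner P + (m - l) \<in> piece l" by (simp add: piece_iff)
    then show ?thesis by auto
  qed
  have disj: "disjoint \<B>"
    unfolding disjoint_def
  proof (intro ballI impI)
    fix A B assume "A \<in> \<B>" "B \<in> \<B>" "A \<noteq> B"
    then obtain l l' where l: "l \<in> crossings i j" "l' \<in> crossings i j"
      and AB: "A = tproj lat ` piece l" "B = tproj lat ` piece l'" "l \<noteq> l'"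
      unfolding \<B>_def by blast
    then show "A \<inter> B = {}" using overlap[OF _ _ _ l] by blast
  qed
  have cover: "\<Union>\<B> = ?X"
  proof (intro set_eqI iffI)
    fix x assume "x \<in> \<Union>\<B>"
    then obtain l q where l: "l \<in> crossings i j" "q \<in> piece l" "x = tproj lat q" by (auto simp: \<B>_def)
    have "q + l \<in> phi ` interior (rect P i)"
      unfolding phi_image_interior_rect using l(2)
      by (auto simp: piece_iff image_iff algebra_simps intro!: bexI[of _ "q - corner P + l"])
    moreover have "x = tproj lat (q + l)" using l by (simp add: tproj_eq_iff crossings_def)
    moreover have "q \<in> interior (rect P j)" using l(2) by (simp add: piece_iff interior_rect_iff[OF shape])
    ultimately show "x \<in> ?X" using l(3) unfolding toral_map_image by blast
  next
    fix x assume "x \<in> ?X"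
    then obtain m q where m: "m \<in> moved i" "x = tproj lat (corner P + m)"
      and q: "q \<in> interior (rect P j)" "x = tproj lat q"
      unfolding toral_map_image phi_image_interior_rect by auto
    define l where "l = corner P + m - q"
    have l: "l \<in> lat" using m q by (simp add: l_def flip: tproj_eq_iff)
    have q': "q - corner P \<in> interior (tile j)" using q(1) by (simp add: interior_rect_iff[OF shape])
    have ml: "m - l = q - corner P" "q - corner P + l = m" by (simp_all add: l_def algebra_simps)
    have "m - l \<in> interior (tile j)" using q' by (simp only: ml(1))
    with l m(1) have "l \<in> crossings i j" unfolding crossings_def by blast
    moreover have "q \<in> piece l" using q' m(1) ml by (simp add: piece_iff)
    ultimately show "x \<in> \<Union>\<B>" using q(2) by (auto simp: \<B>_def)
  qed
  have "?X \<subseteq> topspace (torus_topology lat)"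
    unfolding cover[symmetric] by (rule Union_least) (rule openin_subset[OF opn])
  then have top: "topspace (subtopology (torus_topology lat) ?X) = \<Union>\<B>"
    using cover by (simp only: topspace_subtopology) blast
  have "connected_components_of (subtopology (torus_topology lat) ?X) = \<B>"
  proof (rule connected_components_of_open_partition)
    show "\<Union>\<B> = topspace (subtopology (torus_topology lat) ?X)" using top by simp
    show "connectedin (subtopology (torus_topology lat) ?X) B" if "B \<in> \<B>" for B
      unfolding connectedin_subtopology cover[symmetric] using conn[OF that] that by blast
    show "openin (subtopology (torus_topology lat) ?X) B" if "B \<in> \<B>" for B
    proof -
      have "B \<inter> ?X = B" unfolding cover[symmetric] using that by blast
      then show ?thesis using openin_subtopology_Int[OF opn[OF that], of ?X] by (simp only:)
    qed
    show "{} \<notin> \<B>" using ne by (auto simp: \<B>_def)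
  qed (fact disj)
  moreover have "inj_on (\<lambda>l. tproj lat ` piece l) (crossings i j)"
  proof (rule inj_onI)
    fix l l' assume l: "l \<in> crossings i j" "l' \<in> crossings i j" "tproj lat ` piece l = tproj lat ` piece l'"
    obtain q where q: "q \<in> piece l" using ne[OF l(1)] by blast
    then obtain q' where q': "q' \<in> piece l'" "tproj lat q = tproj lat q'" using l(3) by blast
    show "l = l'" by (rule overlap[OF q q' l(1,2)])
  qed
  ultimately show ?thesis
    by (simp add: connectivity_matrix_def \<B>_def card_image)
qed

lemma vertical_spine_covered:
  assumes "0 \<le> y" "y \<le> u1 + u2"
  obtains y' where "0 \<le> y'" "y' \<le> u1 + u2" "(0, y) - drift - phi (0, y') \<in> lat"
proof -
  have "corner P + (0, y) \<in> vertical_spine P" using assms by (auto simp: vertical_spine_iff[OF shape])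
  then have "\<exists>q\<in>vertical_spine P. corner P + (0, y) - phi q \<in> lat"
    using berg unfolding berg_partition_def toral_map_image tproj_image_subset by simp
  then obtain y' where y': "0 \<le> y'" "y' \<le> u1 + u2" "corner P + (0, y) - phi (corner P + (0, y')) \<in> lat"
    using vertical_spine_iff[OF shape] by metis
  moreover have "corner P + (0, y) - phi (corner P + (0, y')) = (0, y) - drift - phi (0, y')"
    by (simp only: diag_map_add drift_def) (simp add: algebra_simps)
  ultimately show thesis using that by metis
qed

lemma horizontal_spine_mapped:
  assumes "- s2 \<le> x" "x \<le> s1"
  obtains x' where "- s2 \<le> x'" "x' \<le> s1" "drift + phi (x, 0) - (x', 0) \<in> lat"
proof -
  have "corner P + (x, 0) \<in> horizontal_spine P" using assms by (auto simp: horizontal_spine_iff[OF shape])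
  then have "\<exists>q\<in>horizontal_spine P. phi (corner P + (x, 0)) - q \<in> lat"
    using berg unfolding berg_partition_def toral_map_image tproj_image_subset by blast
  then obtain x' where x': "- s2 \<le> x'" "x' \<le> s1" "phi (corner P + (x, 0)) - (corner P + (x', 0)) \<in> lat"
    using horizontal_spine_iff[OF shape] by metis
  moreover have "phi (corner P + (x, 0)) - (corner P + (x', 0)) = drift + phi (x, 0) - (x', 0)"
    by (simp only: diag_map_add drift_def) (simp add: algebra_simps)
  ultimately show thesis using that by metis
qed

text \<open>
  The Berg condition puts the vertical sides of the tiling into the image of the vertical spine,
  and the preimage of such a point would be a point of the spine in an open tile.
\<close>

lemma moved_avoids_vertical_side:
  assumes m: "m \<in> moved i" and l: "l \<in> lat" and side: "m - l \<in> tile j" "fst (m - l) = left j \<or> fst (m - l) = right j"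
  shows False
proof -
  obtain y where y: "0 \<le> y" "y \<le> u1 + u2" "(fst (m - l), snd (m - l) - y) \<in> lat"
    by (rule vertical_side[of "fst (m - l)" "snd (m - l)" j]) (use side in \<open>simp_all only: prod.collapse\<close>)
  obtain y' where y': "0 \<le> y'" "y' \<le> u1 + u2" "(0, y) - drift - phi (0, y') \<in> lat"
    using vertical_spine_covered[OF y(1,2)] .
  obtain t where t: "t \<in> interior (tile i)" "m = drift + phi t" using m by (auto simp: moved_def)
  have "phi (t - (0, y')) = ((fst (m - l), snd (m - l) - y) + l) + ((0, y) - drift - phi (0, y'))"
    unfolding diag_map_diff t(2) by (cases l; cases drift) (simp add: diag_map_def)
  then have "phi (t - (0, y')) \<in> lat" using lat_add[OF lat_add[OF y(3) l] y'(3)] by simp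
  then show False using interior_avoids_vertical_spine[OF t(1) _ y'(1,2)] phi_lat_iff by blast
qed

text \<open>
  The image of a horizontal side lies on the horizontal spine modulo the lattice, outside all open
  tiles.
\<close>

lemma moved_horizontal_side_avoids:
  assumes t: "t \<in> tile i" "snd t = 0 \<or> snd t = tile_height i" and l: "l \<in> lat"
  shows "drift + phi t - l \<notin> interior (tile j)"
proof
  assume int: "drift + phi t - l \<in> interior (tile j)"
  obtain x where x: "- s2 \<le> x" "x \<le> s1" "(fst t - x, snd t) \<in> lat"
    by (rule horizontal_side[of "fst t" "snd t" i]) (use t in simp_all)
  obtain x' where x': "- s2 \<le> x'" "x' \<le> s1" "drift + phi (x, 0) - (x', 0) \<in> lat"
    using horizontal_spine_mapped[OF x(1,2)] .
  have "(fst t - x, snd t) = t - (x, 0)" by (cases t) simp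
  then have "drift + phi t - l - (x', 0) = (phi (fst t - x, snd t) + (drift + phi (x, 0) - (x', 0))) - l"
    by (simp only: diag_map_diff) (simp add: algebra_simps)
  then have "drift + phi t - l - (x', 0) \<in> lat"
    using lat_diff[OF lat_add[OF phi_lat[OF x(3)] x'(3)] l] by (simp only:)
  then show False using interior_avoids_horizontal_spine[OF int _ x'(1,2)] by blast
qed

text \<open>
  The Markov property. If the left border of the translated tile were strictly inside the image,
  then a point of that border at the height of a common interior point would contradict
  \<open>moved_avoids_vertical_side\<close>. The other three borders are treated alike.
\<close>

lemma crossing_shape:
  assumes l: "l \<in> crossings i j"
  shows "left j + fst l \<le> moved_left i" "moved_right i \<le> right j + fst l"
    "snd drift \<le> snd l" "snd l + tile_height j \<le> snd drift + lam * tile_height i"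
proof -
  have lat: "l \<in> lat" using l by (simp add: crossings_def)
  obtain x y where m: "(x, y) \<in> moved i" "(x, y) - l \<in> interior (tile j)"
    using l by (auto simp: crossings_def)
  have x: "moved_left i < x" "x < moved_right i" "left j + fst l < x" "x < right j + fst l"
    and y: "snd drift < y" "y < snd drift + lam * tile_height i" "snd l < y" "y < snd l + tile_height j"
    using m by (auto simp: moved_Times interior_tile_Times fst_diff snd_diff mem_Times_iff)
  have vert: False if "moved_left i < x'" "x' < moved_right i" "x' - fst l = left j \<or> x' - fst l = right j" for x'
  proof (rule moved_avoids_vertical_side[of "(x', y)" i l j])
    show "(x', y) \<in> moved i" using that y by (simp add: moved_Times)
    show "(x', y) - l \<in> tile j" using that y left_right[of j] by (auto simp: tile_Times mem_Times_iff)
    show "fst ((x', y) - l) = left j \<or> fst ((x', y) - l) = right j" using that by simp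
  qed (fact lat)
  show "left j + fst l \<le> moved_left i" using vert[of "left j + fst l"] x by fastforce
  show "moved_right i \<le> right j + fst l" using vert[of "right j + fst l"] x by fastforce
  have horz: False if "snd l < y'" "y' < snd l + tile_height j" "y' = snd drift + lam * r" "r = 0 \<or> r = tile_height i" for y' r
  proof -
    define t where "t = ((x - fst drift) / mu, r)"
    have dt: "drift + phi t = (x, y')" using mu_nonzero that by (cases drift) (simp add: t_def)
    have "left i < fst t \<and> fst t < right i"
      using moved_x_iff[of i "fst t"] x mu_nonzero by (simp add: t_def)
    then have "t \<in> tile i" using that tile_height_pos[of i] by (auto simp: tile_Times mem_Times_iff t_def)
    moreover have "(x, y') - l \<in> interior (tile j)"
      using that x by (auto simp: interior_tile_Times mem_Times_iff)
    moreover have "snd t = 0 \<or> snd t = tile_height i" using that by (simp add: t_def)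
    ultimately show False using moved_horizontal_side_avoids[of t i l j] lat dt by simp
  qed
  show "snd drift \<le> snd l" using horz[of "snd drift" 0] y by fastforce
  show "snd l + tile_height j \<le> snd drift + lam * tile_height i"
    using horz[of "snd drift + lam * tile_height i" "tile_height i"] y by fastforce
qed

lemma finite_crossings: "finite (crossings i j)"
proof -
  let ?D = "(\<lambda>(m, t). m - t) ` (moved i \<times> interior (tile j))"
  have "l \<in> ?D" if "m \<in> moved i" "m - l \<in> interior (tile j)" for l m
    using that by (intro image_eqI[of _ _ "(m, m - l)"]) simp_all
  then have "crossings i j \<subseteq> lat \<inter> ?D" unfolding crossings_def by blast
  moreover have "bounded ?D"
  proof (rule bounded_minus)
    show "bounded (moved i)" "bounded (interior (tile j))"
      unfolding moved_Times interior_tile_Times by (intro bounded_Times; simp)+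
  qed
  ultimately show ?thesis using finite_lat_bounded finite_subset by blast
qed

lemma crossings_cover:
  assumes m: "m \<in> moved i"
  obtains j l where "l \<in> crossings i j" "m - l \<in> tile j"
proof -
  obtain l j where l: "l \<in> lat" "m - l \<in> tile j" by (rule tile_cover)
  have "m - l \<in> (+) (- l) ` moved i" using m by force
  moreover have "m - l \<in> closure (interior (tile j))" using l(2) by (simp add: closure_interior_tile)
  ultimately have "(+) (- l) ` moved i \<inter> interior (tile j) \<noteq> {}"
    using open_Int_closure_eq_empty[OF open_translation[OF open_moved]] by blast
  then obtain m' where "m' \<in> moved i" "m' - l \<in> interior (tile j)" by auto
  then have "l \<in> crossings i j" using l(1) by (auto simp: crossings_def)
  then show thesis using l(2) that by blast
qed

text \<open>
  By \<open>crossing_shape\<close>, the intersection of the image of tile \<open>i\<close> with the translate of tile \<open>j\<close> by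
  \<open>l\<close> has the width of the former and the height of the latter.
\<close>

definition slab :: "2 \<Rightarrow> 2 \<times> (real \<times> real) \<Rightarrow> (real \<times> real) set" where
  "slab i = (\<lambda>(j, l). cbox (moved_left i, snd l) (moved_right i, snd l + tile_height j))"

lemma interior_slab_subset:
  assumes "l \<in> crossings i j" "p \<in> interior (slab i (j, l))"
  shows "p - l \<in> interior (tile j)"
proof -
  have "moved_left i < fst p" "fst p < moved_right i" "snd l < snd p" "snd p < snd l + tile_height j"
    using assms(2) by (cases p; auto simp: slab_def box_def Basis_prod_def)+
  then show ?thesis using crossing_shape[OF assms(1)]
    by (cases p; cases l) (auto simp: interior_tile_Times)
qed

lemma slab_overlap:
  assumes "l \<in> crossings i j" "l' \<in> crossings i j'" "interior (slab i (j, l)) \<inter> interior (slab i (j', l')) \<noteq> {}"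
  shows "j = j' \<and> l = l'"
proof -
  obtain p where p: "p - l \<in> interior (tile j)" "p - l' \<in> interior (tile j')"
    using assms interior_slab_subset by blast
  have "l' - l \<in> lat" using assms lat_diff by (simp add: crossings_def)
  moreover have "(p - l) - (l' - l) \<in> tile j'" using p(2) interior_subset by auto
  ultimately show ?thesis using interior_tile_disjoint[OF p(1)] by fastforce
qed

lemma interior_slab_nonempty: "interior (slab i x) \<noteq> {}"
  using moved_left_right[of i] tile_height_pos[of "fst x"]
  by (cases x) (auto simp: slab_def box_ne_empty Basis_prod_def)

lemma content_slab: "measure lborel (slab i (j, l)) = (moved_right i - moved_left i) * tile_height j"
  unfolding slab_def using moved_left_right[of i] tile_height_pos[of j] by (simp add: content_Pair)

lemma slabs_division:
  "slab i ` (SIGMA j:UNIV. crossings i j) division_of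
     cbox (moved_left i, snd drift) (moved_right i, snd drift + lam * tile_height i)" (is "?d division_of ?M")
proof (rule division_ofI)
  show fin: "finite ?d" using finite_crossings by (intro finite_imageI finite_SigmaI) auto
  show sub: "K \<subseteq> ?M" if K_in: "K \<in> ?d" for K
  proof -
    obtain j l where l: "l \<in> crossings i j" and K: "K = slab i (j, l)" using K_in by blast
    show "K \<subseteq> ?M" using crossing_shape(3,4)[OF l] by (auto simp: K slab_def)
  qed
  show "K \<noteq> {}" if "K \<in> ?d" for K
    using that interior_slab_nonempty interior_subset by fastforce
  show "\<exists>a b. K = cbox a b" if "K \<in> ?d" for K using that by (auto simp: slab_def)
  show "interior K1 \<inter> interior K2 = {}" if K: "K1 \<in> ?d" "K2 \<in> ?d" "K1 \<noteq> K2" for K1 K2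
  proof -
    obtain j l j' l' where l: "l \<in> crossings i j" "l' \<in> crossings i j'"
      and "K1 = slab i (j, l)" "K2 = slab i (j', l')"
      using K by blast
    with K(3) show ?thesis using slab_overlap[OF l] by blast
  qed
  show "\<Union>?d = ?M"
  proof
    show "\<Union>?d \<subseteq> ?M" using sub by blast
    \<comment> \<open>The union is closed, so it suffices to cover the interior.\<close>
    have "moved i \<subseteq> \<Union>?d"
    proof
      fix m assume m: "m \<in> moved i"
      then obtain j l where l: "l \<in> crossings i j" "m - l \<in> tile j" by (rule crossings_cover)
      have "m \<in> slab i (j, l)"
        using m l(2) by (cases m; cases l) (auto simp: slab_def moved_Times tile_Times)
      then show "m \<in> \<Union>?d" using l(1) by blast
    qed
    moreover have "closed (\<Union>?d)"
      using fin by (intro closed_Union) (auto simp: slab_def)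
    ultimately have "closure (moved i) \<subseteq> \<Union>?d" by (rule closure_minimal)
    moreover have "closure (moved i) = ?M"
      unfolding moved_Times closure_Times using moved_left_right[of i] tile_height_pos[of i] lam_pos by auto
    ultimately show "?M \<subseteq> \<Union>?d" by simp
  qed
qed

text \<open>
  The slabs of the crossings decompose the image of tile \<open>i\<close>. They all have its width, so its area
  divided by its width is the sum of their heights.
\<close>

lemma height_balance: "lam * tile_height i = (\<Sum>j\<in>UNIV. of_int (connectivity_matrix lat toral_map P $ i $ j) * tile_height j)"
proof -
  let ?S = "SIGMA j:UNIV. crossings i j" and ?w = "moved_right i - moved_left i"
  have "inj_on (slab i) ?S"
    using slab_overlap interior_slab_nonempty by (fastforce intro!: inj_onI)
  then have "sum (measure lborel) (slab i ` ?S) = (\<Sum>x\<in>?S. measure lborel (slab i x))"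
    by (simp add: sum.reindex)
  also have "\<dots> = (\<Sum>j\<in>UNIV. \<Sum>l\<in>crossings i j. measure lborel (slab i (j, l)))"
    by (subst sum.Sigma) (auto simp: finite_crossings)
  also have "\<dots> = ?w * (\<Sum>j\<in>UNIV. of_int (connectivity_matrix lat toral_map P $ i $ j) * tile_height j)"
    by (simp add: content_slab connectivity_crossings sum_distrib_left mult_ac)
  also have "sum (measure lborel) (slab i ` ?S) = ?w * (lam * tile_height i)"
    using additive_content_division[OF slabs_division[of i]] moved_left_right[of i] tile_height_pos[of i] lam_pos
    by (simp add: content_Pair)
  finally show ?thesis using moved_left_right[of i] by simp
qed

end

section \<open>Affine maps between two tilings\<close>

lemma finite_positive_lower_bound:
  fixes S :: "real set"
  assumes "finite S" "\<And>x. x \<in> S \<Longrightarrow> 0 < x"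
  obtains r where "0 < r" "\<forall>x\<in>S. r < x"
proof
  let ?m = "Min (insert 1 S)"
  have m: "0 < ?m" using assms by simp
  then show "0 < ?m / 2" by simp
  show "\<forall>x\<in>S. ?m / 2 < x"
  proof
    fix x assume "x \<in> S"
    then have "?m \<le> x" using assms by (intro Min_le) auto
    with m show "?m / 2 < x" by linarith
  qed
qed

text \<open>
  The segment of length \<open>\<bar>A\<bar> * r\<close> that starts at its smaller end point is the image of \<open>{0..r}\<close> under
  multiplication by \<open>A\<close>, whatever the sign of \<open>A\<close>.
\<close>

lemma segment_preimage:
  fixes A r x :: real
  assumes "A \<noteq> 0" "0 < r" "0 \<le> x" "x \<le> \<bar>A\<bar> * r"
  shows "0 \<le> (min 0 (A * r) + x) / A \<and> (min 0 (A * r) + x) / A \<le> r"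
proof (cases "0 < A")
  case True
  then show ?thesis using assms by (simp add: min_def pos_divide_le_eq mult.commute)
next
  case False
  then have A: "A < 0" using assms(1) by linarith
  then have "A * r < 0" using assms(2) by (simp add: mult_neg_pos)
  moreover have "x \<le> - (A * r)" using assms(4) A by simp
  ultimately show ?thesis
    using A assms(3) by (simp add: min_def neg_divide_le_eq divide_nonpos_neg mult.commute)
qed

context tile_pair
begin

text \<open>
  A translation that carries each class of tiles into itself is a lattice vector. Modulo the lattice,
  the image of the corner lies in a half-open tile. Its neighbourhood to the upper right is covered
  by an image of tile \<open>1\<close> and the one to the upper left by an image of tile \<open>2\<close>, so that it is on the
  left side of tile \<open>1\<close>. If it were above the corner, then the image of tile \<open>1\<close> would reach into the
  tile above the left end of the top side of tile \<open>1\<close>, and that is a translate of tile \<open>2\<close>.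
\<close>

lemma tile_translation_lat:
  assumes trans: "\<And>i p. p \<in> tile i \<Longrightarrow> \<exists>q\<in>tile i. p + t - q \<in> lat"
  shows "t \<in> lat"
proof -
  obtain l i where l: "l \<in> lat" "left i \<le> fst (t - l)" "fst (t - l) < right i"
    "0 \<le> snd (t - l)" "snd (t - l) < tile_height i"
    by (rule half_open_tile_cover)
  define x where "x = fst (t - l)"
  define y where "y = snd (t - l)"
  have xy: "t = l + (x, y)" by (simp add: x_def y_def prod_eq_iff)
  have bounds: "left i \<le> x" "x < right i" "0 \<le> y" "y < tile_height i"
    using l by (simp_all add: x_def y_def)
  have hits: "j = k" if p: "p \<in> tile j" and int: "p + (x, y) - l' \<in> interior (tile k)" and l': "l' \<in> lat" for j k p l'
  proof -
    obtain q where q: "q \<in> tile j" "p + t - q \<in> lat" using trans[OF p] by blast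
    define v where "v = (p + t - q) - (l + l')"
    have "v \<in> lat" unfolding v_def using lat_diff[OF q(2) lat_add[OF l(1) l']] .
    moreover have "p + (x, y) - l' - v = q" by (simp add: v_def xy)
    ultimately show "j = k" using interior_tile_disjoint[OF int, of v j] q(1) by simp
  qed
  \<comment> \<open>The step \<open>r\<close> is smaller than every positive length with which it will be compared.\<close>
  let ?gaps = "{right i - x, tile_height i - y, s1, s2, u1, u2} \<union> {x, y} \<inter> {0<..}"
  have "finite ?gaps" by simp
  moreover have "0 < g" if "g \<in> ?gaps" for g using that bounds pos by fastforce
  ultimately obtain r where r0: "0 < r" and gaps: "\<forall>g\<in>?gaps. r < g"
    by (rule finite_positive_lower_bound)
  have r: "0 < r" "r < right i - x" "r < tile_height i - y" "r < s1" "r < s2" "r < u1" "r < u2"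
    using r0 by (simp_all add: gaps)
  have rxy: "0 < x \<Longrightarrow> r < x" "0 < y \<Longrightarrow> r < y"
    by (simp_all add: gaps)
  have "(r, r) \<in> tile 1" using r by (simp add: tile_iff)
  moreover have "(r, r) + (x, y) - 0 \<in> interior (tile i)" using r bounds by (simp add: interior_tile_Times)
  ultimately have "1 = i" by (rule hits) simp
  then have i: "i = 1" by simp
  have x0: "x = 0"
  proof (rule ccontr)
    assume "x \<noteq> 0"
    then have "0 < x" "r < x" using bounds i rxy by (simp_all add: left_def)
    then have "(- r, r) + (x, y) - 0 \<in> interior (tile 1)"
      using r bounds i by (simp add: interior_tile_Times left_def right_def tile_height_def)
    moreover have "(- r, r) \<in> tile 2" using r by (simp add: tile_iff)
    ultimately have "(2::2) = 1" using hits lat_zero by metis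
    then show False by simp
  qed
  have y0: "y = 0"
  proof (rule ccontr)
    assume "y \<noteq> 0"
    then have y: "0 < y" "r < y" using bounds rxy by simp_all
    have "(r, u1 - y + r) + (x, y) - pt 1 0 \<in> interior (tile 2)"
      using r by (simp add: x0 pt_def interior_tile_iff)
    moreover have "(r, u1 - y + r) \<in> tile 1" using r y bounds i by (simp add: tile_iff tile_height_def)
    ultimately have "(1::2) = 2" using hits pt_in_lat by metis
    then show False by simp
  qed
  show ?thesis using l(1) by (simp add: xy x0 y0 flip: zero_prod_def)
qed

end

context toral_bipartition
begin

text \<open>
  Applying \<open>phi\<close> or its inverse changes the proportions of a rectangle without changing whether all
  its translates contain lattice points.
\<close>

lemma lat_dense_step:
  assumes "\<And>p. \<exists>l\<in>lat. \<bar>fst (p - l)\<bar> \<le> A \<and> \<bar>snd (p - l)\<bar> \<le> B"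
  shows "\<exists>l\<in>lat. \<bar>fst (p - l)\<bar> \<le> A * lam \<and> \<bar>snd (p - l)\<bar> \<le> B / lam"
    and "\<exists>l\<in>lat. \<bar>fst (p - l)\<bar> \<le> A / lam \<and> \<bar>snd (p - l)\<bar> \<le> B * lam"
proof -
  have mu_lam: "\<bar>mu\<bar> = 1 / lam" using abs_mu lam by (simp add: field_simps)
  obtain l where l: "l \<in> lat" "\<bar>fst (phi p - l)\<bar> \<le> A" "\<bar>snd (phi p - l)\<bar> \<le> B" using assms by blast
  obtain l' where l': "l' \<in> lat" "l = phi l'" using l(1) by (rule lat_phiE)
  have "phi p - l = phi (p - l')" by (simp add: l'(2) diag_map_diff)
  then have "\<bar>mu\<bar> * \<bar>fst (p - l')\<bar> \<le> A" "lam * \<bar>snd (p - l')\<bar> \<le> B"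
    using l(2,3) lam by (simp_all add: diag_map_def abs_mult)
  then have "\<bar>fst (p - l')\<bar> \<le> A * lam" "\<bar>snd (p - l')\<bar> \<le> B / lam"
    using lam unfolding mu_lam by (simp_all add: field_simps)
  then show "\<exists>l\<in>lat. \<bar>fst (p - l)\<bar> \<le> A * lam \<and> \<bar>snd (p - l)\<bar> \<le> B / lam" using l'(1) by blast
  define p' where "p' = diag_map (1 / mu) (1 / lam) p"
  have p': "phi p' = p" using mu lam by (simp add: p'_def diag_map_comp)
  obtain l where l: "l \<in> lat" "\<bar>fst (p' - l)\<bar> \<le> A" "\<bar>snd (p' - l)\<bar> \<le> B" using assms by blast
  have "p - phi l = phi (p' - l)" by (simp add: p' diag_map_diff)
  then have "\<bar>fst (p - phi l)\<bar> = \<bar>mu\<bar> * \<bar>fst (p' - l)\<bar>" "\<bar>snd (p - phi l)\<bar> = lam * \<bar>snd (p' - l)\<bar>"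
    using lam by (simp_all add: diag_map_def abs_mult)
  then have "\<bar>fst (p - phi l)\<bar> \<le> A / lam \<and> \<bar>snd (p - phi l)\<bar> \<le> B * lam"
    using l lam unfolding mu_lam by (simp add: field_simps)
  then show "\<exists>l\<in>lat. \<bar>fst (p - l)\<bar> \<le> A / lam \<and> \<bar>snd (p - l)\<bar> \<le> B * lam"
    using phi_lat[OF l(1)] by blast
qed

lemma lat_dense:
  assumes "0 < \<epsilon>"
  obtains K where "\<And>p. \<exists>l\<in>lat. \<bar>fst (p - l)\<bar> \<le> K \<and> \<bar>snd (p - l)\<bar> \<le> \<epsilon>"
    "\<And>p. \<exists>l\<in>lat. \<bar>fst (p - l)\<bar> \<le> \<epsilon> \<and> \<bar>snd (p - l)\<bar> \<le> K"
proof -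
  define W where "W = s1 + s2 + u1 + u2"
  have W: "0 < W" "s1 \<le> W" "s2 \<le> W" "u1 \<le> W" "u2 \<le> W" using pos by (simp_all add: W_def)
  have base: "\<exists>l\<in>lat. \<bar>fst (p - l)\<bar> \<le> W \<and> \<bar>snd (p - l)\<bar> \<le> W" for p
  proof -
    obtain l i where "l \<in> lat" "p - l \<in> tile i" by (rule tile_cover)
    then show ?thesis using W pos
      by (intro bexI[of _ l]) (auto simp: tile_Times mem_Times_iff left_def right_def tile_height_def split: if_splits)
  qed
  have wide: "\<exists>l\<in>lat. \<bar>fst (p - l)\<bar> \<le> W * lam ^ n \<and> \<bar>snd (p - l)\<bar> \<le> W / lam ^ n" for n p
  proof (induction n arbitrary: p)
    case (Suc n)
    from lat_dense_step(1)[OF Suc] show ?case by (simp add: mult_ac)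
  qed (use base in simp)
  have high: "\<exists>l\<in>lat. \<bar>fst (p - l)\<bar> \<le> W / lam ^ n \<and> \<bar>snd (p - l)\<bar> \<le> W * lam ^ n" for n p
  proof (induction n arbitrary: p)
    case (Suc n)
    from lat_dense_step(2)[OF Suc] show ?case by (simp add: mult_ac)
  qed (use base in simp)
  obtain n where n: "W / \<epsilon> < lam ^ n" using real_arch_pow[OF lam] by blast
  then have small: "W / lam ^ n \<le> \<epsilon>" using assms lam by (simp add: field_simps)
  show thesis
  proof (rule that[of "W * lam ^ n"])
    show "\<exists>l\<in>lat. \<bar>fst (p - l)\<bar> \<le> W * lam ^ n \<and> \<bar>snd (p - l)\<bar> \<le> \<epsilon>" for p
      using wide[of p n] small by (meson order_trans)
    show "\<exists>l\<in>lat. \<bar>fst (p - l)\<bar> \<le> \<epsilon> \<and> \<bar>snd (p - l)\<bar> \<le> W * lam ^ n" for p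
      using high[of p n] small by (meson order_trans)
  qed
qed

text \<open>
  Long and thin rectangles contain lattice points, so a long segment comes close to a translate of
  any given point, for instance of the centre of tile \<open>2\<close>.
\<close>

lemma long_segments_meet_tile:
  obtains K where "0 < K" "\<And>p. \<exists>x l. 0 \<le> x \<and> x \<le> K \<and> l \<in> lat \<and> p + (x, 0) - l \<in> interior (tile 2)"
    "\<And>p. \<exists>y l. 0 \<le> y \<and> y \<le> K \<and> l \<in> lat \<and> p + (0, y) - l \<in> interior (tile 2)"
proof -
  define \<epsilon> where "\<epsilon> = min s2 u2 / 4"
  have e: "0 < \<epsilon>" "4 * \<epsilon> \<le> s2" "4 * \<epsilon> \<le> u2" using pos by (auto simp: \<epsilon>_def)
  obtain K where K: "\<And>p. \<exists>l\<in>lat. \<bar>fst (p - l)\<bar> \<le> K \<and> \<bar>snd (p - l)\<bar> \<le> \<epsilon>"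
    "\<And>p. \<exists>l\<in>lat. \<bar>fst (p - l)\<bar> \<le> \<epsilon> \<and> \<bar>snd (p - l)\<bar> \<le> K"
    by (rule lat_dense[OF e(1)]) blast
  have K0: "0 \<le> K" using K(1)[of 0] by auto
  show thesis
  proof (rule that[of "2 * K + s2 + u2"])
    show "0 < 2 * K + s2 + u2" using K0 pos by simp
    fix p
    show "\<exists>x l. 0 \<le> x \<and> x \<le> 2 * K + s2 + u2 \<and> l \<in> lat \<and> p + (x, 0) - l \<in> interior (tile 2)"
    proof -
      \<comment> \<open>The shift by \<open>- u2 / 2\<close> centres the point in the tile vertically, the one by \<open>K + s2\<close> makes the
        length \<open>x\<close> positive.\<close>
      obtain l where l: "l \<in> lat" "\<bar>fst (p + (K + s2, - (u2 / 2)) - l)\<bar> \<le> K"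
        "\<bar>snd (p + (K + s2, - (u2 / 2)) - l)\<bar> \<le> \<epsilon>" using K(1) by blast
      define x where "x = fst l - fst p - s2 / 2"
      have "0 \<le> x" "x \<le> 2 * K + s2 + u2" using l(2) pos by (simp_all add: x_def abs_le_iff)
      moreover have "p + (x, 0) - l \<in> interior (tile 2)"
        using l(3) e pos
        by (simp add: interior_tile_Times mem_Times_iff left_def right_def tile_height_def x_def abs_le_iff)
      ultimately show ?thesis using l(1) by blast
    qed
    show "\<exists>y l. 0 \<le> y \<and> y \<le> 2 * K + s2 + u2 \<and> l \<in> lat \<and> p + (0, y) - l \<in> interior (tile 2)"
    proof -
      obtain l where l: "l \<in> lat" "\<bar>fst (p + (s2 / 2, K) - l)\<bar> \<le> \<epsilon>"
        "\<bar>snd (p + (s2 / 2, K) - l)\<bar> \<le> K" using K(2) by blast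
      define y where "y = snd l - snd p + u2 / 2"
      have "0 \<le> y" "y \<le> 2 * K + s2 + u2" using l(3) pos by (simp_all add: y_def abs_le_iff)
      moreover have "p + (0, y) - l \<in> interior (tile 2)"
        using l(2) e pos
        by (simp add: interior_tile_Times mem_Times_iff left_def right_def tile_height_def y_def abs_le_iff)
      ultimately show ?thesis using l(1) by blast
    qed
  qed
qed

text \<open>
  If the map expanded one direction, its iterates would carry a side of tile \<open>1\<close> to arbitrarily long
  segments covered by translates of tile \<open>1\<close>. But such segments meet the interior of a translate of
  tile \<open>2\<close>.
\<close>

lemma no_expansion:
  assumes lat: "\<And>l. l \<in> lat \<Longrightarrow> diag_map \<alpha> \<beta> l \<in> lat"
    and into: "\<And>p. p \<in> tile 1 \<Longrightarrow> \<exists>q\<in>tile 1. diag_map \<alpha> \<beta> p + t - q \<in> lat"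
  shows "\<bar>\<alpha>\<bar> \<le> 1" "\<bar>\<beta>\<bar> \<le> 1"
proof -
  have iterate: "\<exists>t. \<forall>p\<in>tile 1. \<exists>q\<in>tile 1. diag_map (\<alpha> ^ n) (\<beta> ^ n) p + t - q \<in> lat" for n
  proof (induction n)
    case 0
    have "\<forall>p\<in>tile 1. \<exists>q\<in>tile 1. diag_map (\<alpha> ^ 0) (\<beta> ^ 0) p + 0 - q \<in> lat" by force
    then show ?case by blast
  next
    case (Suc n)
    then obtain t' where t': "\<And>p. p \<in> tile 1 \<Longrightarrow> \<exists>q\<in>tile 1. diag_map (\<alpha> ^ n) (\<beta> ^ n) p + t' - q \<in> lat"
      by blast
    have "\<exists>q\<in>tile 1. diag_map (\<alpha> ^ Suc n) (\<beta> ^ Suc n) p + (diag_map \<alpha> \<beta> t' + t) - q \<in> lat"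
      if p: "p \<in> tile 1" for p
    proof -
      obtain q where q: "q \<in> tile 1" "diag_map (\<alpha> ^ n) (\<beta> ^ n) p + t' - q \<in> lat" using t'[OF p] by blast
      obtain r where r: "r \<in> tile 1" "diag_map \<alpha> \<beta> q + t - r \<in> lat" using into[OF q(1)] by blast
      have "diag_map (\<alpha> ^ Suc n) (\<beta> ^ Suc n) p + (diag_map \<alpha> \<beta> t' + t) - r =
          diag_map \<alpha> \<beta> (diag_map (\<alpha> ^ n) (\<beta> ^ n) p + t' - q) + (diag_map \<alpha> \<beta> q + t - r)"
        by (simp add: diag_map_diff diag_map_add diag_map_comp)
      with lat_add[OF lat[OF q(2)] r(2)]
      have "diag_map (\<alpha> ^ Suc n) (\<beta> ^ Suc n) p + (diag_map \<alpha> \<beta> t' + t) - r \<in> lat" by (simp only:)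
      with r(1) show ?thesis by blast
    qed
    then show ?case by blast
  qed
  obtain K where K: "0 < K" "\<And>p. \<exists>x l. 0 \<le> x \<and> x \<le> K \<and> l \<in> lat \<and> p + (x, 0) - l \<in> interior (tile 2)"
    "\<And>p. \<exists>y l. 0 \<le> y \<and> y \<le> K \<and> l \<in> lat \<and> p + (0, y) - l \<in> interior (tile 2)"
    by (rule long_segments_meet_tile) blast
  have clash: False if p: "p \<in> tile 1" and int: "diag_map (\<alpha> ^ n) (\<beta> ^ n) p + t' - l \<in> interior (tile 2)" and l: "l \<in> lat"
    and t': "\<forall>p\<in>tile 1. \<exists>q\<in>tile 1. diag_map (\<alpha> ^ n) (\<beta> ^ n) p + t' - q \<in> lat" for p n t' l
  proof -
    obtain q where q: "q \<in> tile 1" "diag_map (\<alpha> ^ n) (\<beta> ^ n) p + t' - q \<in> lat" using p t' by blast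
    let ?v = "diag_map (\<alpha> ^ n) (\<beta> ^ n) p + t' - q - l"
    have "diag_map (\<alpha> ^ n) (\<beta> ^ n) p + t' - l - ?v = q" by simp
    then have "(2::2) = 1"
      using interior_tile_disjoint[OF int, of ?v 1] q lat_diff[OF q(2) l] by simp
    then show False by simp
  qed
  show "\<bar>\<alpha>\<bar> \<le> 1"
  proof (rule ccontr)
    assume big: "\<not> \<bar>\<alpha>\<bar> \<le> 1"
    then obtain n where n: "K / s1 < \<bar>\<alpha>\<bar> ^ n" using real_arch_pow[of "\<bar>\<alpha>\<bar>"] by auto
    then have n': "K \<le> \<bar>\<alpha> ^ n\<bar> * s1" "\<alpha> ^ n \<noteq> 0"
      using pos K(1) big by (auto simp: field_simps power_abs)
    obtain t' where t': "\<forall>p\<in>tile 1. \<exists>q\<in>tile 1. diag_map (\<alpha> ^ n) (\<beta> ^ n) p + t' - q \<in> lat"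
      using iterate by blast
    \<comment> \<open>The left end point of the image of the bottom side, which is reversed if \<open>\<alpha> ^ n\<close> is negative.\<close>
    define m where "m = min 0 (\<alpha> ^ n * s1)"
    obtain x l where x: "0 \<le> x" "x \<le> K" "l \<in> lat" "(t' + (m, 0)) + (x, 0) - l \<in> interior (tile 2)"
      using K(2) by blast
    have "0 \<le> (m + x) / \<alpha> ^ n \<and> (m + x) / \<alpha> ^ n \<le> s1"
      unfolding m_def using x n' pos by (intro segment_preimage) auto
    then have "((m + x) / \<alpha> ^ n, 0) \<in> tile 1" using pos by (simp add: tile_iff)
    moreover have "diag_map (\<alpha> ^ n) (\<beta> ^ n) ((m + x) / \<alpha> ^ n, 0) + t' - l \<in> interior (tile 2)"
    proof -
      have "\<alpha> ^ n * ((m + x) / \<alpha> ^ n) = m + x"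
        using n'(2) by (metis nonzero_mult_div_cancel_left times_divide_eq_right)
      then show ?thesis using x(4) by (cases t') (simp only: diag_map_Pair, simp add: add_ac)
    qed
    ultimately show False using clash x(3) t' by blast
  qed
  show "\<bar>\<beta>\<bar> \<le> 1"
  proof (rule ccontr)
    assume big: "\<not> \<bar>\<beta>\<bar> \<le> 1"
    then obtain n where n: "K / u1 < \<bar>\<beta>\<bar> ^ n" using real_arch_pow[of "\<bar>\<beta>\<bar>"] by auto
    then have n': "K \<le> \<bar>\<beta> ^ n\<bar> * u1" "\<beta> ^ n \<noteq> 0"
      using pos K(1) big by (auto simp: field_simps power_abs)
    obtain t' where t': "\<forall>p\<in>tile 1. \<exists>q\<in>tile 1. diag_map (\<alpha> ^ n) (\<beta> ^ n) p + t' - q \<in> lat"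
      using iterate by blast
    define m where "m = min 0 (\<beta> ^ n * u1)"
    obtain x l where x: "0 \<le> x" "x \<le> K" "l \<in> lat" "(t' + (0, m)) + (0, x) - l \<in> interior (tile 2)"
      using K(3) by blast
    have "0 \<le> (m + x) / \<beta> ^ n \<and> (m + x) / \<beta> ^ n \<le> u1"
      unfolding m_def using x n' pos by (intro segment_preimage) auto
    then have "(0, (m + x) / \<beta> ^ n) \<in> tile 1" using pos by (simp add: tile_iff)
    moreover have "diag_map (\<alpha> ^ n) (\<beta> ^ n) (0, (m + x) / \<beta> ^ n) + t' - l \<in> interior (tile 2)"
    proof -
      have "\<beta> ^ n * ((m + x) / \<beta> ^ n) = m + x"
        using n'(2) by (metis nonzero_mult_div_cancel_left times_divide_eq_right)
      then show ?thesis using x(4) by (cases t') (simp only: diag_map_Pair, simp add: add_ac)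
    qed
    ultimately show False using clash x(3) t' by blast
  qed
qed

text \<open>
  Otherwise adding \<open>e\<close> to its image would give a lattice point on an axis.
\<close>

lemma signs_agree:
  assumes "\<bar>\<alpha>\<bar> = 1" "\<bar>\<beta>\<bar> = 1" and lat: "\<And>l. l \<in> lat \<Longrightarrow> diag_map \<alpha> \<beta> l \<in> lat"
  shows "\<alpha> = \<beta>"
proof (rule ccontr)
  assume "\<alpha> \<noteq> \<beta>"
  then consider "\<alpha> = 1" "\<beta> = - 1" | "\<alpha> = - 1" "\<beta> = 1" using assms by linarith
  then show False
  proof cases
    case 1
    have "diag_map \<alpha> \<beta> (pt 1 0) + pt 1 0 = (2 * s2, 0)" by (simp add: pt_def 1)
    then have "(2 * s2, 0) \<in> lat" using lat_add[OF lat] pt_in_lat by metis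
    from lat_horizontal[OF this] pos show False by (simp add: zero_prod_def)
  next
    case 2
    have "diag_map \<alpha> \<beta> (pt 1 0) + pt 1 0 = (0, 2 * u1)" by (simp add: pt_def 2)
    then have "(0, 2 * u1) \<in> lat" using lat_add[OF lat] pt_in_lat by metis
    from lat_vertical[OF this] pos show False by (simp add: zero_prod_def)
  qed
qed

lemma spine_shift_translate:
  assumes "spine_shift z q" "phi t - t \<in> lat"
  shows "spine_shift (z + t) q"
proof -
  have "phi (z + t) - (z + t) - (fst q, 0) = (phi z - z - (fst q, 0)) + (phi t - t)"
    by (simp add: diag_map_add)
  then have "phi (z + t) - (z + t) - (fst q, 0) \<in> lat"
    using assms lat_add[of "phi z - z - (fst q, 0)" "phi t - t"] unfolding spine_shift_def by (simp only:)
  then show ?thesis using assms by (simp add: spine_shift_def)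
qed

text \<open>
  The rectangles with corner \<open>z\<close> are carried by the point reflection \<open>x \<mapsto> t - x\<close> to the rectangles
  with corner \<open>t - z - (s1, u1)\<close>, modulo the lattice; see \<open>tile_reflect\<close>.
\<close>

lemma spine_shift_reflect:
  assumes "spine_shift z (pt i j)" "phi t - t \<in> lat"
  shows "spine_shift (t - z - (s1, u1)) (pt (top_i - i) (top_j - j))"
proof -
  let ?q = "pt (top_i - i) (top_j - j)"
  have fst_q: "fst ?q = (1 - mu) * (s1 - s2) - fst (pt i j)"
    using pt_top by (simp add: pt_diff[symmetric])
  have "phi (t - z - (s1, u1)) - (t - z - (s1, u1)) - (fst ?q, 0) =
      (phi t - t) - (phi z - z - (fst (pt i j), 0)) - (phi (pt 1 0) - pt 1 0)"
    unfolding fst_q by (cases z; cases t) (simp add: pt_def algebra_simps)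
  moreover have "phi (pt 1 0) - pt 1 0 \<in> lat" using lat_diff phi_lat pt_in_lat by blast
  moreover have "phi z - z - (fst (pt i j), 0) \<in> lat" using assms(1) by (simp add: spine_shift_def)
  ultimately have "phi (t - z - (s1, u1)) - (t - z - (s1, u1)) - (fst ?q, 0) \<in> lat"
    using assms(2) lat_diff by (simp only:)
  then show ?thesis using assms window_reflect by (simp add: spine_shift_def)
qed

text \<open>
  Tile \<open>1\<close> is reflected to its translate by \<open>- (s1, u1)\<close> and tile \<open>2\<close> to its translate by
  \<open>(s2, - u2)\<close>. These two vectors differ by the lattice vector \<open>e - f\<close>.
\<close>

lemma tile_reflect:
  assumes "p \<in> tile i"
  obtains q l where "q \<in> tile i" "l \<in> lat" "- p = q - (s1, u1) + l"
proof (cases "i = 1")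
  case True
  have "(s1, u1) - p \<in> tile i" using assms True by (cases p) (simp add: tile_iff)
  then show thesis using that[of "(s1, u1) - p" 0] by simp
next
  case False
  have "(- s2, u2) - p \<in> tile i" using assms False by (cases p) (simp add: tile_iff)
  moreover have "- p = ((- s2, u2) - p) - (s1, u1) + pt 1 (-1)" by (cases p) (simp add: pt_def)
  ultimately show thesis using that pt_in_lat by blast
qed

text \<open>
  Neither the linear part nor its inverse expands, so the signs remain. A translation must be the
  difference of the corners modulo the lattice, a point reflection their sum up to \<open>(s1, u1)\<close>, and
  \<open>t\<close>, being fixed by \<open>phi\<close> modulo the lattice, does not affect the lattice point \<open>q\<close> of the spines.
\<close>

lemma affine_image_classified:
  assumes nz: "\<alpha> \<noteq> 0" "\<beta> \<noteq> 0" and lat: "\<And>p. diag_map \<alpha> \<beta> p \<in> lat \<longleftrightarrow> p \<in> lat"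
    and t: "phi t - t \<in> lat"
    and into: "\<And>i p. p \<in> tile i \<Longrightarrow> \<exists>q\<in>tile i. diag_map \<alpha> \<beta> (z + p) + t - (z' + q) \<in> lat"
    and onto: "\<And>i q. q \<in> tile i \<Longrightarrow> \<exists>p\<in>tile i. diag_map \<alpha> \<beta> (z + p) + t - (z' + q) \<in> lat"
    and z: "spine_shift z (pt i j)" and z': "spine_shift z' (pt i' j')"
  shows "i' + j' = i + j \<or> i' + j' = a + b + c + d - 2 - (i + j)"
proof -
  have inv: "diag_map (1 / \<alpha>) (1 / \<beta>) (diag_map \<alpha> \<beta> p) = p" "diag_map \<alpha> \<beta> (diag_map (1 / \<alpha>) (1 / \<beta>) p) = p" for p
    using nz by (simp_all add: diag_map_comp)
  have le: "\<bar>\<alpha>\<bar> \<le> 1" "\<bar>\<beta>\<bar> \<le> 1"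
  proof -
    have "\<exists>q\<in>tile 1. diag_map \<alpha> \<beta> p + (diag_map \<alpha> \<beta> z + t - z') - q \<in> lat" if "p \<in> tile 1" for p
      using into[OF that] by (simp add: diag_map_add algebra_simps)
    from no_expansion[OF _ this] lat show "\<bar>\<alpha>\<bar> \<le> 1" "\<bar>\<beta>\<bar> \<le> 1" by blast+
  qed
  have ge: "\<bar>1 / \<alpha>\<bar> \<le> 1" "\<bar>1 / \<beta>\<bar> \<le> 1"
  proof -
    have lat': "diag_map (1 / \<alpha>) (1 / \<beta>) l \<in> lat" if "l \<in> lat" for l
      using that lat inv by metis
    have "\<exists>p\<in>tile 1. diag_map (1 / \<alpha>) (1 / \<beta>) q + (diag_map (1 / \<alpha>) (1 / \<beta>) (z' - t) - z) - p \<in> lat"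
      if q: "q \<in> tile 1" for q
    proof -
      obtain p where p: "p \<in> tile 1" "diag_map \<alpha> \<beta> (z + p) + t - (z' + q) \<in> lat" using onto[OF q] by blast
      have "diag_map (1 / \<alpha>) (1 / \<beta>) q + (diag_map (1 / \<alpha>) (1 / \<beta>) (z' - t) - z) - p =
          - diag_map (1 / \<alpha>) (1 / \<beta>) (diag_map \<alpha> \<beta> (z + p) + t - (z' + q))"
        by (simp only: diag_map_add diag_map_diff inv) simp
      moreover have "- diag_map (1 / \<alpha>) (1 / \<beta>) (diag_map \<alpha> \<beta> (z + p) + t - (z' + q)) \<in> lat"
        using lat'[OF p(2)] by (rule lat_uminus)
      ultimately have "diag_map (1 / \<alpha>) (1 / \<beta>) q + (diag_map (1 / \<alpha>) (1 / \<beta>) (z' - t) - z) - p \<in> lat"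
        by (simp only:)
      with p(1) show ?thesis by blast
    qed
    from no_expansion[OF lat' this] show "\<bar>1 / \<alpha>\<bar> \<le> 1" "\<bar>1 / \<beta>\<bar> \<le> 1" by blast+
  qed
  have one: "\<bar>\<alpha>\<bar> = 1" "\<bar>\<beta>\<bar> = 1"
  proof -
    have "1 \<le> \<bar>\<alpha>\<bar>" "1 \<le> \<bar>\<beta>\<bar>" using ge nz by (simp_all add: abs_divide divide_le_eq)
    with le show "\<bar>\<alpha>\<bar> = 1" "\<bar>\<beta>\<bar> = 1" by linarith+
  qed
  then have "\<alpha> = \<beta>" using signs_agree lat by blast
  then consider "\<alpha> = 1" "\<beta> = 1" | "\<alpha> = - 1" "\<beta> = - 1" using one by linarith
  then show ?thesis
  proof cases
    case 1
    define v where "v = z + t - z'"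
    have "v \<in> lat"
    proof (rule tile_translation_lat)
      fix k p assume "p \<in> tile k"
      from into[OF this] show "\<exists>q\<in>tile k. p + v - q \<in> lat" by (simp add: 1 v_def algebra_simps)
    qed
    then have "phi (t - v) - (t - v) \<in> lat"
      using lat_diff[OF t lat_diff[OF phi_lat]] by (simp add: diag_map_diff algebra_simps)
    from spine_shift_translate[OF z this] have "spine_shift z' (pt i j)" by (simp add: v_def)
    from spine_shift_unique[OF z' this] show ?thesis by (simp add: pt_inject)
  next
    case 2
    define v where "v = t - z - z' - (s1, u1)"
    have m: "diag_map \<alpha> \<beta> p = - p" for p by (simp add: 2 diag_map_def prod_eq_iff)
    have "v \<in> lat"
    proof (rule tile_translation_lat)
      fix k p assume p: "p \<in> tile k"
      then obtain r l where r: "r \<in> tile k" "l \<in> lat" "- p = r - (s1, u1) + l" by (rule tile_reflect)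
      obtain q where q: "q \<in> tile k" "diag_map \<alpha> \<beta> (z + r) + t - (z' + q) \<in> lat" using into[OF r(1)] by blast
      have "r = - p + (s1, u1) - l" using r(3) by (simp add: algebra_simps)
      then have "p + v - q = (diag_map \<alpha> \<beta> (z + r) + t - (z' + q)) - l"
        unfolding m v_def by (simp add: algebra_simps)
      with lat_diff[OF q(2) r(2)] have "p + v - q \<in> lat" by (simp only:)
      with q(1) show "\<exists>q\<in>tile k. p + v - q \<in> lat" by blast
    qed
    then have "phi (t - v) - (t - v) \<in> lat"
      using lat_diff[OF t lat_diff[OF phi_lat]] by (simp add: diag_map_diff algebra_simps)
    from spine_shift_reflect[OF z this] have "spine_shift z' (pt (top_i - i) (top_j - j))"
      by (simp add: v_def)
    from spine_shift_unique[OF z' this] show ?thesis by (simp add: pt_inject)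
  qed
qed

end

section \<open>Equivalence of Berg partitions\<close>

text \<open>
  The axes are the eigenspaces of \<open>diag_map \<gamma> \<delta>\<close>.
\<close>

lemma linear_commuting_with_diag_map:
  assumes A: "linear A" and comm: "\<And>x. diag_map \<gamma> \<delta> (A x) = A (diag_map \<gamma> \<delta> x)" and ne: "\<gamma> \<noteq> \<delta>"
  obtains \<alpha> \<beta> where "A = diag_map \<alpha> \<beta>"
proof
  have "diag_map \<gamma> \<delta> (A (1, 0)) = \<gamma> *\<^sub>R A (1, 0)"
    using comm[of "(1, 0)"] linear_scale[OF A, of \<gamma> "(1, 0)"] by simp
  then have x: "snd (A (1, 0)) = 0" using ne by (simp add: diag_map_def prod_eq_iff)
  have "diag_map \<gamma> \<delta> (A (0, 1)) = \<delta> *\<^sub>R A (0, 1)"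
    using comm[of "(0, 1)"] linear_scale[OF A, of \<delta> "(0, 1)"] by simp
  then have y: "fst (A (0, 1)) = 0" using ne by (simp add: diag_map_def prod_eq_iff)
  show "A = diag_map (fst (A (1, 0))) (snd (A (0, 1)))"
  proof
    fix p :: "real \<times> real"
    have "p = fst p *\<^sub>R (1, 0) + snd p *\<^sub>R (0, 1)" by (simp add: prod_eq_iff)
    then have "A p = fst p *\<^sub>R A (1, 0) + snd p *\<^sub>R A (0, 1)"
      by (metis linear_add[OF A] linear_scale[OF A])
    then show "A p = diag_map (fst (A (1, 0))) (snd (A (0, 1))) p"
      using x y by (simp add: diag_map_def prod_eq_iff)
  qed
qed

lemma card_quotient_eq_card_image:
  assumes "\<And>x y. x \<in> B \<Longrightarrow> y \<in> B \<Longrightarrow> R x y \<longleftrightarrow> f x = f y"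
  shows "card (B // {(x, y). x \<in> B \<and> y \<in> B \<and> R x y}) = card (f ` B)"
proof -
  have "{(x, y). x \<in> B \<and> y \<in> B \<and> R x y} `` {x} = {y \<in> B. f y = f x}" if "x \<in> B" for x
    using assms that by auto
  then have "B // {(x, y). x \<in> B \<and> y \<in> B \<and> R x y} = (\<lambda>v. {y \<in> B. f y = v}) ` f ` B"
    unfolding quotient_def image_image by (simp add: UNION_singleton_eq_range)
  moreover have "inj_on (\<lambda>v. {y \<in> B. f y = v}) (f ` B)"
    by (rule inj_onI) blast
  ultimately show ?thesis by (simp add: card_image)
qed

context tile_pair
begin

lemma torus_map_tproj_lat:
  assumes "\<And>x y. x - y \<in> lat \<Longrightarrow> \<Phi> x - \<Phi> y \<in> lat"
  shows "torus_map lat \<Phi> (tproj lat x) = tproj lat (\<Phi> x)"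
proof -
  have "y \<in> tproj lat x \<longleftrightarrow> x - y \<in> lat" for y
    by (simp add: Equiv_Relations.proj_def lat_rel_def)
  then have "x \<in> tproj lat x" "\<And>y. y \<in> tproj lat x \<Longrightarrow> tproj lat (\<Phi> y) = tproj lat (\<Phi> x)"
    using assms[of x] by (simp_all add: tproj_eq_iff) (metis assms lat_uminus_iff minus_diff_eq tproj_eq_iff)
  then show ?thesis unfolding torus_map_def by (intro UN_constant_eq ballI)
qed

lemma torusE:
  assumes "X \<in> torus lat" obtains x where "X = tproj lat x"
  using assms tproj_surj by blast

lemma tproj_in_torus: "tproj lat x \<in> torus lat"
  using tproj_surj by blast

end

context toral_bipartition
begin

text \<open>
  The rectangles of \<open>P\<close> are the images of the tiles with corner \<open>z\<close> under a diagonal automorphism of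
  the lattice. All Berg partitions with the same connectivity matrix have this form, with \<open>m\<close> and
  \<open>k\<close> depending on \<open>P\<close>.
\<close>

definition scaled_tiling :: "bipart \<Rightarrow> real \<Rightarrow> real \<Rightarrow> real \<times> real \<Rightarrow> bool" where
  "scaled_tiling P m k z \<longleftrightarrow> 0 < m \<and> 0 < k \<and> (\<forall>p. diag_map m k p \<in> lat \<longleftrightarrow> p \<in> lat) \<and>
     (\<forall>i. rect P i = (\<lambda>t. diag_map m k (z + t)) ` tile i)"

text \<open>
  The defect \<open>phi \<circ> A - A \<circ> phi\<close> of the linear part \<open>A\<close> has values in the lattice and is therefore
  \<open>0\<close>, so \<open>A\<close> is diagonal. Conjugating with the scalings of the two partitions gives a map between
  tilings of equal shape.
\<close>

lemma equivalent_imp_index: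
  assumes S: "scaled_tiling P m k z" and S': "scaled_tiling P' m' k' z'"
    and z: "spine_shift z (pt i j)" and z': "spine_shift z' (pt i' j')"
    and equiv: "berg_equivalent lat toral_map P P'"
  shows "i' + j' = i + j \<or> i' + j' = a + b + c + d - 2 - (i + j)"
proof -
  obtain U where aff: "torus_affine lat U" and bij: "bij_betw U (torus lat) (torus lat)"
    and commutes: "\<forall>X\<in>torus lat. toral_map (U X) = U (toral_map X)"
    and images: "\<forall>i. U ` tproj lat ` rect P i = tproj lat ` rect P' i"
    using equiv unfolding berg_equivalent_def by (elim exE conjE)
  note comm = bspec[OF commutes] and im = spec[OF images]
  obtain A t where A: "linear A" and U: "\<And>x. U (tproj lat x) = tproj lat (A x + t)"
    using aff unfolding torus_affine_def by blast
  have A_lat: "A l \<in> lat \<longleftrightarrow> l \<in> lat" for l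
  proof -
    have "U (tproj lat l) = U (tproj lat 0) \<longleftrightarrow> tproj lat l = tproj lat 0"
      by (rule inj_on_eq_iff[OF bij_betw_imp_inj_on[OF bij] tproj_in_torus tproj_in_torus])
    then show ?thesis by (simp add: U tproj_eq_iff linear_0[OF A])
  qed
  have comm': "phi (A x + t) - (A (phi x) + t) \<in> lat" for x
    using comm[OF tproj_in_torus[of x]] by (simp add: U toral_map_tproj tproj_eq_iff)
  have t: "phi t - t \<in> lat" using comm'[of 0] by (simp add: linear_0[OF A] linear_0[OF linear_diag_map])
  have defect: "phi (A x) - A (phi x) \<in> lat" for x
  proof -
    have "phi (A x) - A (phi x) = (phi (A x + t) - (A (phi x) + t)) - (phi t - t)"
      by (simp add: diag_map_add)
    then show ?thesis using lat_diff[OF comm' t] by (simp only:)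
  qed
  have "phi (A x) = A (phi x)" for x
  proof -
    have "(1 / 2) ^ n *\<^sub>R (phi (A x) - A (phi x)) \<in> lat" for n
      using defect[of "(1 / 2) ^ n *\<^sub>R x"]
      by (simp only: linear_scale[OF A] linear_scale[OF linear_diag_map] scaleR_diff_right)
    from lat_shrinking[OF _ _ this] show ?thesis by simp
  qed
  moreover have "mu \<noteq> lam" using mu lam by linarith
  ultimately obtain \<alpha> \<beta> where A_diag: "A = diag_map \<alpha> \<beta>"
    by (rule linear_commuting_with_diag_map[OF A])
  have nz: "\<alpha> \<noteq> 0" "\<beta> \<noteq> 0"
  proof -
    show "\<alpha> \<noteq> 0"
    proof
      assume "\<alpha> = 0"
      then have "A (1, 0) = 0" by (simp add: A_diag zero_prod_def)
      then have "(1, 0) \<in> lat" using A_lat[of "(1, 0)"] by simp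
      from lat_horizontal[OF this] show False by (simp add: zero_prod_def)
    qed
    show "\<beta> \<noteq> 0"
    proof
      assume "\<beta> = 0"
      then have "A (0, 1) = 0" by (simp add: A_diag zero_prod_def)
      then have "(0, 1) \<in> lat" using A_lat[of "(0, 1)"] by simp
      from lat_vertical[OF this] show False by (simp add: zero_prod_def)
    qed
  qed
  have mk: "0 < m" "0 < k" "0 < m'" "0 < k'"
    and Dlat: "\<And>p. diag_map m k p \<in> lat \<longleftrightarrow> p \<in> lat" "\<And>p. diag_map m' k' p \<in> lat \<longleftrightarrow> p \<in> lat"
    and R: "\<And>i. rect P i = (\<lambda>t. diag_map m k (z + t)) ` tile i"
    "\<And>i. rect P' i = (\<lambda>t. diag_map m' k' (z' + t)) ` tile i"
    using S S' unfolding scaled_tiling_def by blast+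
  define \<alpha>' where "\<alpha>' = \<alpha> * m / m'"
  define \<beta>' where "\<beta>' = \<beta> * k / k'"
  define t' where "t' = diag_map (1 / m') (1 / k') t"
  have conj: "diag_map m' k' (diag_map \<alpha>' \<beta>' p) = A (diag_map m k p)" for p
    using mk by (simp add: A_diag diag_map_comp \<alpha>'_def \<beta>'_def)
  have t'_eq: "diag_map m' k' t' = t" using mk by (simp add: t'_def diag_map_comp)
  have key: "diag_map m' k' (diag_map \<alpha>' \<beta>' (z + p) + t' - (z' + q)) =
      A (diag_map m k (z + p)) + t - diag_map m' k' (z' + q)" for p q
    by (simp only: diag_map_diff diag_map_add[of m' k' "diag_map \<alpha>' \<beta>' (z + p)"] conj t'_eq)
  have A_images: "tproj lat ` (\<lambda>x. A x + t) ` rect P i = tproj lat ` rect P' i" for i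
    using im[of i] by (simp add: image_image U)
  show ?thesis
  proof (rule affine_image_classified[of \<alpha>' \<beta>' t' z z'])
    show "\<alpha>' \<noteq> 0" "\<beta>' \<noteq> 0" using nz mk by (simp_all add: \<alpha>'_def \<beta>'_def)
    show "diag_map \<alpha>' \<beta>' p \<in> lat \<longleftrightarrow> p \<in> lat" for p
      using Dlat(2)[of "diag_map \<alpha>' \<beta>' p"] by (simp add: conj A_lat Dlat(1))
    have "diag_map m' k' (phi t' - t') = phi t - t"
      using mk by (simp add: t'_def diag_map_def prod_eq_iff algebra_simps)
    then show "phi t' - t' \<in> lat" using t Dlat(2)[of "phi t' - t'"] by simp
    show "\<exists>q\<in>tile i. diag_map \<alpha>' \<beta>' (z + p) + t' - (z' + q) \<in> lat" if p: "p \<in> tile i" for i p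
    proof -
      have "\<forall>p\<in>(\<lambda>x. A x + t) ` rect P i. \<exists>q\<in>rect P' i. p - q \<in> lat"
        unfolding tproj_image_subset[symmetric] A_images by simp
      then obtain q where "q \<in> tile i" "A (diag_map m k (z + p)) + t - diag_map m' k' (z' + q) \<in> lat"
        using p unfolding R by auto
      then show ?thesis using Dlat(2) key by metis
    qed
    show "\<exists>p\<in>tile i. diag_map \<alpha>' \<beta>' (z + p) + t' - (z' + q) \<in> lat" if q: "q \<in> tile i" for i q
    proof -
      have "\<forall>q\<in>rect P' i. \<exists>p\<in>(\<lambda>x. A x + t) ` rect P i. q - p \<in> lat"
        unfolding tproj_image_subset[symmetric] A_images by simp
      then obtain p where "p \<in> tile i" "diag_map m' k' (z' + q) - (A (diag_map m k (z + p)) + t) \<in> lat"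
        using q unfolding R by auto
      moreover have "diag_map m' k' (z' + q) - (A (diag_map m k (z + p)) + t) =
          - (A (diag_map m k (z + p)) + t - diag_map m' k' (z' + q))" by simp
      ultimately show ?thesis using Dlat(2) key lat_uminus_iff by metis
    qed
  qed (fact z, fact z')
qed

text \<open>
  The sign \<open>\<epsilon>\<close> distinguishes translations from point reflections. The factors \<open>m' / m\<close> and \<open>k' / k\<close>
  compensate the scalings of the two partitions.
\<close>

lemma equivalentI:
  assumes S: "scaled_tiling P m k z" and S': "scaled_tiling P' m' k' z'"
    and eps: "\<epsilon> = 1 \<or> \<epsilon> = - 1" and t: "phi t - t \<in> lat"
    and into: "\<And>i p. p \<in> tile i \<Longrightarrow> \<exists>q\<in>tile i. \<epsilon> *\<^sub>R (z + p) + t - (z' + q) \<in> lat"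
    and onto: "\<And>i q. q \<in> tile i \<Longrightarrow> \<exists>p\<in>tile i. \<epsilon> *\<^sub>R (z + p) + t - (z' + q) \<in> lat"
  shows "berg_equivalent lat toral_map P P'"
proof -
  have mk: "0 < m" "0 < k" "0 < m'" "0 < k'"
    and Dlat: "\<And>p. diag_map m k p \<in> lat \<longleftrightarrow> p \<in> lat" "\<And>p. diag_map m' k' p \<in> lat \<longleftrightarrow> p \<in> lat"
    and R: "\<And>i. rect P i = (\<lambda>t. diag_map m k (z + t)) ` tile i"
    "\<And>i. rect P' i = (\<lambda>t. diag_map m' k' (z' + t)) ` tile i"
    using S S' unfolding scaled_tiling_def by blast+
  define A where "A = diag_map (\<epsilon> * m' / m) (\<epsilon> * k' / k)"
  define w where "w = diag_map m' k' t"
  define U where "U = torus_map lat (\<lambda>x. A x + w)"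
  have A: "linear A" unfolding A_def by (rule linear_diag_map)
  have A_D: "A (diag_map m k p) = diag_map m' k' (\<epsilon> *\<^sub>R p)" for p
    using mk by (simp add: A_def diag_map_def)
  define A' where "A' = diag_map (\<epsilon> * m / m') (\<epsilon> * k / k')"
  have A_A': "A (A' p) = p" for p using mk eps by (auto simp: A_def A'_def diag_map_comp)
  have A_lat: "A p \<in> lat \<longleftrightarrow> p \<in> lat" for p
  proof -
    have "p = diag_map m k (diag_map (1 / m) (1 / k) p)" using mk by (simp add: diag_map_comp)
    then obtain p' where p': "p = diag_map m k p'" by blast
    show ?thesis using eps unfolding p' A_D Dlat by auto
  qed
  have U: "U (tproj lat x) = tproj lat (A x + w)" for x
    unfolding U_def by (rule torus_map_tproj_lat) (simp add: A_lat flip: linear_diff[OF A])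
  have "torus_affine lat U" unfolding torus_affine_def using A U by blast
  moreover have "bij_betw U (torus lat) (torus lat)"
    unfolding bij_betw_def
  proof
    show "inj_on U (torus lat)"
    proof (rule inj_onI)
      fix X Y assume XY: "X \<in> torus lat" "Y \<in> torus lat" "U X = U Y"
      then obtain x y where "X = tproj lat x" "Y = tproj lat y" by (metis torusE)
      with XY show "X = Y" by (simp add: U tproj_eq_iff A_lat flip: linear_diff[OF A])
    qed
    show "U ` torus lat = torus lat"
    proof
      show "U ` torus lat \<subseteq> torus lat"
        by (auto elim!: torusE simp: U tproj_in_torus)
      show "torus lat \<subseteq> U ` torus lat"
      proof
        fix X assume "X \<in> torus lat"
        then obtain x where "X = tproj lat x" by (rule torusE)
        then have "X = U (tproj lat (A' (x - w)))" by (simp add: U A_A')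
        then show "X \<in> U ` torus lat" using tproj_in_torus by blast
      qed
    qed
  qed
  moreover have "toral_map (U X) = U (toral_map X)" if X: "X \<in> torus lat" for X
  proof -
    obtain x where x: "X = tproj lat x" using X by (rule torusE)
    have "phi (A x + w) - (A (phi x) + w) = diag_map m' k' (phi t - t)"
      by (simp add: A_def w_def diag_map_def prod_eq_iff algebra_simps)
    then have "phi (A x + w) - (A (phi x) + w) \<in> lat" using t Dlat(2) by simp
    then show ?thesis by (simp add: x U toral_map_tproj tproj_eq_iff)
  qed
  moreover have "U ` tproj lat ` rect P i = tproj lat ` rect P' i" for i
  proof -
    have key: "A (diag_map m k (z + p)) + w - diag_map m' k' (z' + q) =
        diag_map m' k' (\<epsilon> *\<^sub>R (z + p) + t - (z' + q))" for p q
      unfolding A_D w_def by (simp only: diag_map_diff diag_map_add[of m' k' "\<epsilon> *\<^sub>R (z + p)"])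
    have "tproj lat ` (\<lambda>x. A x + w) ` rect P i = tproj lat ` rect P' i"
    proof
      show "tproj lat ` (\<lambda>x. A x + w) ` rect P i \<subseteq> tproj lat ` rect P' i"
        unfolding tproj_image_subset R using into[of _ i] by (auto simp: key Dlat(2))
      have "A (diag_map m k (z + p)) + w - diag_map m' k' (z' + q) \<in> lat \<longleftrightarrow>
          diag_map m' k' (z' + q) - (A (diag_map m k (z + p)) + w) \<in> lat" for p q
        using lat_uminus_iff[of "A (diag_map m k (z + p)) + w - diag_map m' k' (z' + q)"] by simp
      then show "tproj lat ` rect P' i \<subseteq> tproj lat ` (\<lambda>x. A x + w) ` rect P i"
        unfolding tproj_image_subset R using onto[of _ i] by (auto simp: key Dlat(2))
    qed
    then show ?thesis by (simp add: image_image U)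
  qed
  ultimately show ?thesis unfolding berg_equivalent_def by blast
qed

text \<open>
  Translations between partitions preserve this number, and point reflections replace \<open>n\<close> by
  \<open>a + b + c + d - 2 - n\<close>.
\<close>

definition berg_index :: "bipart \<Rightarrow> int \<Rightarrow> bool" where
  "berg_index P n \<longleftrightarrow> (\<exists>m k z i j. scaled_tiling P m k z \<and> spine_shift z (pt i j) \<and> n = i + j)"

lemma berg_index_range:
  assumes "berg_index P n" shows "0 \<le> n" "n \<le> a + b + c + d - 2"
  using assms window_index unfolding berg_index_def spine_shift_def by blast+

lemma equivalent_iff_index:
  assumes "berg_index P n" "berg_index P' n'"
  shows "berg_equivalent lat toral_map P P' \<longleftrightarrow> n' = n \<or> n' = a + b + c + d - 2 - n"
proof -
  obtain m k z i j where P: "scaled_tiling P m k z" "spine_shift z (pt i j)" "n = i + j"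
    using assms(1) unfolding berg_index_def by blast
  obtain m' k' z' i' j' where P': "scaled_tiling P' m' k' z'" "spine_shift z' (pt i' j')" "n' = i' + j'"
    using assms(2) unfolding berg_index_def by blast
  let ?g = "phi z - z - (fst (pt i j), 0)" and ?g' = "phi z' - z' - (fst (pt i' j'), 0)"
  have g: "?g \<in> lat" "?g' \<in> lat" and win: "pt i j \<in> window" "pt i' j' \<in> window"
    using P(2) P'(2) by (simp_all add: spine_shift_def)
  show ?thesis
  proof
    assume "berg_equivalent lat toral_map P P'"
    then show "n' = n \<or> n' = a + b + c + d - 2 - n"
      using equivalent_imp_index[OF P(1) P'(1) P(2) P'(2)] P(3) P'(3) by blast
  next
    assume "n' = n \<or> n' = a + b + c + d - 2 - n"
    then show "berg_equivalent lat toral_map P P'"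
    proof
      assume "n' = n"
      then have ij: "i' = i \<and> j' = j" using window_unique[OF win(2,1)] P(3) P'(3) by simp
      have "phi (z' - z) - (z' - z) = ?g' - ?g" by (simp add: ij diag_map_diff)
      then have "phi (z' - z) - (z' - z) \<in> lat" using lat_diff[OF g(2,1)] by (simp only:)
      moreover have "p = q \<Longrightarrow> 1 *\<^sub>R (z + p) + (z' - z) - (z' + q) \<in> lat" for p q by simp
      ultimately show ?thesis by (intro equivalentI[OF P(1) P'(1), of 1 "z' - z"]) blast+
    next
      assume "n' = a + b + c + d - 2 - n"
      then have ij: "i' = top_i - i \<and> j' = top_j - j"
        using window_unique[OF win(2) window_reflect[OF win(1)]] P(3) P'(3) by simp
      define t where "t = z + z' + (s1, u1)"
      have "fst (pt i j) + fst (pt i' j') = (1 - mu) * (s1 - s2)"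
        using pt_top by (simp add: ij pt_diff[symmetric])
      then have x: "fst (pt i' j') = (1 - mu) * (s1 - s2) - fst (pt i j)" by simp
      have "phi t - t = (?g + ?g') + (phi (pt 1 0) - pt 1 0)"
        unfolding t_def x by (cases z; cases z') (simp add: pt_def algebra_simps)
      moreover have "phi (pt 1 0) - pt 1 0 \<in> lat" using lat_diff phi_lat pt_in_lat by blast
      ultimately have "phi t - t \<in> lat" using lat_add g by (simp only:)
      moreover have refl: "- 1 *\<^sub>R (z + p) + t - (z' + q) \<in> lat"
        if "l \<in> lat" "- p = q - (s1, u1) + l" for p q l
      proof -
        have "- 1 *\<^sub>R (z + p) + t - (z' + q) = - p + (s1, u1) - q" by (simp add: t_def)
        also have "\<dots> = l" unfolding that(2) by simp
        finally show ?thesis using that(1) by simp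
      qed
      moreover have "\<exists>q\<in>tile k. - 1 *\<^sub>R (z + p) + t - (z' + q) \<in> lat" if "p \<in> tile k" for k p
        using tile_reflect[OF that] refl by metis
      moreover have "\<exists>p\<in>tile k. - 1 *\<^sub>R (z + p) + t - (z' + q) \<in> lat" if q: "q \<in> tile k" for k q
      proof -
        obtain p l where p: "p \<in> tile k" "l \<in> lat" "- q = p - (s1, u1) + l" by (rule tile_reflect[OF q])
        have "- p = q - (s1, u1) + l" using p(3) by (simp add: algebra_simps)
        then show ?thesis using refl[OF p(2)] p(1) by blast
      qed
      ultimately show ?thesis by (intro equivalentI[OF P(1) P'(1), of "- 1" t]) simp_all
    qed
  qed
qed

section \<open>The number of classes\<close>

definition transposed :: "int^2^2" where
  "transposed = (\<chi> i j. if i = 1 then (if j = 1 then a else c) else (if j = 1 then b else d))"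

lemma transposed_simps [simp]:
  "transposed $ 1 $ 1 = a" "transposed $ 1 $ 2 = c" "transposed $ 2 $ 1 = b" "transposed $ 2 $ 2 = d"
  by (simp_all add: transposed_def)

text \<open>
  A relation between \<open>u1\<close> and \<open>u2\<close> is a lattice point on the horizontal axis.
\<close>

lemma heights_independent:
  assumes "of_int i * u1 + of_int j * u2 = 0" shows "i = 0" "j = 0"
proof -
  have "pt i j = 0"
    by (rule lat_horizontal[OF pt_in_lat]) (use assms in \<open>simp add: pt_def\<close>)
  then show "i = 0" "j = 0" by (simp_all add: pt_eq_zero)
qed

text \<open>
  Both matrices are integral and send the vector of heights to its multiple by \<open>lam\<close>. The heights
  are rationally independent, so their rows agree.
\<close>

lemma connectivity_determined:
  assumes shape: "has_shape P" and berg: "berg_partition lat toral_map P"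
  shows "connectivity_matrix lat toral_map P = transposed"
proof -
  interpret berg_bipartition s1 s2 u1 u2 lam mu P by unfold_locales (fact shape, fact berg)
  let ?C = "connectivity_matrix lat toral_map P"
  have "of_int (?C $ 1 $ 1 - a) * u1 + of_int (?C $ 1 $ 2 - c) * u2 = 0"
    "of_int (?C $ 2 $ 1 - b) * u1 + of_int (?C $ 2 $ 2 - d) * u2 = 0"
    using height_balance[of 1] height_balance[of 2] row_y
    by (simp_all add: UNIV_2 tile_height_def algebra_simps)
  from this[THEN heights_independent(1)] this[THEN heights_independent(2)]
  show ?thesis by (simp add: vec_eq_iff forall_2)
qed

text \<open>
  The partition \<open>P\<close> has its own widths and heights. By \<open>height_balance\<close> the heights satisfy the
  eigenvector equation of the matrix. Expressing the images of the basis of \<open>P\<close> in that basis, the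
  second coordinates then force the coefficients to be \<open>a\<close>, \<open>b\<close>, \<open>c\<close>, \<open>d\<close>, and the first coordinates
  give the equations for the widths. So \<open>P\<close> is described by the same locale with proportional
  parameters, and the analysis of the spines applies to it.
\<close>

lemma berg_index_exists:
  assumes berg: "berg_partition lat toral_map P" and conn: "connectivity_matrix lat toral_map P = transposed"
  obtains n where "berg_index P n"
proof -
  define s1' where "s1' = width P $ 1"
  define s2' where "s2' = width P $ 2"
  define u1' where "u1' = height P $ 1"
  define u2' where "u2' = height P $ 2"
  have bip: "bipartition lat P" using berg by (simp add: berg_partition_def)
  interpret Q: tile_pair s1' s2' u1' u2'
    by unfold_locales (use bip in \<open>simp_all add: bipartition_def s1'_def s2'_def u1'_def u2'_def\<close>)
  have Q_lat: "Q.lat = lat"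
    unfolding Q.lat_def
    using bip by (simp add: bipartition_def lattice_basis_def s1'_def s2'_def u1'_def u2'_def)
  have Q_shape: "Q.has_shape P"
    unfolding Q.has_shape_def by (simp add: s1'_def s2'_def u1'_def u2'_def)
  interpret Q: diagonal_automorphism s1' s2' u1' u2' lam mu
    by unfold_locales (use lam_pos mu_nonzero phi_lat_iff Q_lat in simp_all)
  have Q_T: "Q.toral_map = toral_map" by (simp add: Q.toral_map_def toral_map_def Q_lat)
  interpret Q: berg_bipartition s1' s2' u1' u2' lam mu P
    by unfold_locales (use Q_shape berg Q_T Q_lat in simp_all)
  have row_y': "lam * u1' = of_int a * u1' + of_int c * u2'" "lam * u2' = of_int b * u1' + of_int d * u2'"
    using Q.height_balance[of 1] Q.height_balance[of 2] conn
    by (simp_all add: Q_T Q_lat UNIV_2 Q.tile_height_def)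
  \<comment> \<open>Two lattice points of the same height are equal.\<close>
  have coordinates: "x = of_int i * s2' - of_int j * s1'"
    if "phi q = (x, of_int i * u1' + of_int j * u2')" "q \<in> lat" for q x i j
  proof -
    have "phi q - Q.pt i j \<in> lat" using Q.lat_diff[OF _ Q.pt_in_lat] phi_lat that(2) Q_lat by simp
    moreover have "snd (phi q - Q.pt i j) = 0" unfolding that(1) by (simp add: Q.pt_def)
    ultimately have "phi q - Q.pt i j = 0" by (rule lat_horizontal)
    then show ?thesis unfolding that(1) by (simp add: Q.pt_def prod_eq_iff)
  qed
  have row_x': "mu * s2' = of_int a * s2' - of_int c * s1'" "mu * s1' = of_int d * s1' - of_int b * s2'"
  proof -
    have "(s2', u1') \<in> lat" "(- s1', u2') \<in> lat"
      using Q.pt_in_lat[of 1 0] Q.pt_in_lat[of 0 1] Q_lat by (simp_all add: Q.pt_def)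
    then show "mu * s2' = of_int a * s2' - of_int c * s1'" "mu * s1' = of_int d * s1' - of_int b * s2'"
      using coordinates[of "(s2', u1')" "mu * s2'" a c] coordinates[of "(- s1', u2')" "- (mu * s1')" b d] row_y'
      by simp_all
  qed
  \<comment> \<open>From here on, the spines of \<open>P\<close> can be analysed in the basis of \<open>P\<close>.\<close>
  interpret Q: toral_bipartition s1' s2' u1' u2' lam mu a b c d
    by unfold_locales (use nonneg unimodular lam lam_mu row_y' row_x' in simp_all)
  obtain q where q: "Q.spine_shift (corner P) q"
    using Q.berg_partition_iff[OF Q_shape] berg Q_T Q_lat by auto
  then obtain i j where ij: "q = Q.pt i j" unfolding Q.spine_shift_def by (metis Q.latE)
  define m where "m = s2' / s2"
  define k where "k = u1' / u1"
  have mk: "0 < m" "0 < k" using pos Q.pos by (simp_all add: m_def k_def)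
  have c: "real_of_int c \<noteq> 0" using off_diagonal by simp
  \<comment> \<open>The eigenvector equations determine the ratios \<open>s1 / s2\<close> and \<open>u2 / u1\<close>, because \<open>c\<close> is not \<open>0\<close>.\<close>
  have dims: "s2' = m * s2" "s1' = m * s1" "u1' = k * u1" "u2' = k * u2"
  proof -
    show "s2' = m * s2" "u1' = k * u1" using pos by (simp_all add: m_def k_def)
    have "of_int c * s1' = (of_int a - mu) * s2'" "of_int c * s1 = (of_int a - mu) * s2"
      using row_x(1) row_x'(1) by (simp_all add: algebra_simps)
    then have "of_int c * s1' = of_int c * (m * s1)" unfolding \<open>s2' = m * s2\<close> by (simp add: mult.left_commute)
    then show "s1' = m * s1" using c by simp
    have "of_int c * u2' = (lam - of_int a) * u1'" "of_int c * u2 = (lam - of_int a) * u1"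
      using row_y(1) row_y'(1) by (simp_all add: algebra_simps)
    then have "of_int c * u2' = of_int c * (k * u2)" unfolding \<open>u1' = k * u1\<close> by (simp add: mult.left_commute)
    then show "u2' = k * u2" using c by simp
  qed
  have pt': "Q.pt i j = diag_map m k (pt i j)" for i j
    unfolding Q.pt_def by (simp add: pt_def dims algebra_simps)
  have inj: "diag_map m k p = diag_map m k p' \<longleftrightarrow> p = p'" for p p'
    using mk by (simp add: diag_map_def prod_eq_iff)
  have lat_iff': "diag_map m k p \<in> lat \<longleftrightarrow> p \<in> lat" for p
  proof -
    have "diag_map m k p \<in> Q.lat \<longleftrightarrow> (\<exists>i j. diag_map m k p = diag_map m k (pt i j))"
      by (simp only: Q.lat_iff pt')
    then show ?thesis by (simp only: Q_lat inj lat_iff)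
  qed
  define z where "z = diag_map (1 / m) (1 / k) (corner P)"
  have corner: "corner P = diag_map m k z" using mk by (simp add: z_def diag_map_comp)
  have tile': "t \<in> Q.tile i \<longleftrightarrow> diag_map (1 / m) (1 / k) t \<in> tile i" for t i
  proof -
    obtain x y where "t = (x, y)" by force
    then show ?thesis using mk by (simp only: Q.tile_iff) (simp add: tile_iff dims field_simps)
  qed
  have "rect P i = (\<lambda>t. diag_map m k (z + t)) ` tile i" for i
  proof (intro set_eqI iffI)
    fix p assume "p \<in> rect P i"
    then have "diag_map (1 / m) (1 / k) (p - corner P) \<in> tile i"
      by (simp add: Q.rect_iff[OF Q_shape] tile')
    moreover have "p = diag_map m k (z + diag_map (1 / m) (1 / k) (p - corner P))"
      using mk by (simp add: diag_map_add diag_map_comp corner)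
    ultimately show "p \<in> (\<lambda>t. diag_map m k (z + t)) ` tile i" by blast
  next
    fix p assume "p \<in> (\<lambda>t. diag_map m k (z + t)) ` tile i"
    then obtain t where "t \<in> tile i" "p = diag_map m k (z + t)" by blast
    then show "p \<in> rect P i"
      using mk by (simp add: Q.rect_iff[OF Q_shape] tile' diag_map_add diag_map_comp corner)
  qed
  then have "scaled_tiling P m k z" using mk lat_iff' by (simp only: scaled_tiling_def simp_thms)
  moreover have "spine_shift z (pt i j)"
  proof -
    obtain x y where xy: "pt i j = (x, y)" by force
    have "Q.pt i j \<in> Q.window" "phi (corner P) - corner P - (fst (Q.pt i j), 0) \<in> lat"
      using q unfolding ij Q.spine_shift_def Q_lat by simp_all
    then have win: "- (m * s2) \<le> m * x - mu * (m * s2)" "m * x - mu * (m * s2) \<le> m * s1"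
      "- (m * s2) \<le> m * x + mu * (m * s1)" "m * x + mu * (m * s1) \<le> m * s1"
      "0 \<le> k * y" "k * y + (k * u1 + k * u2) \<le> lam * (k * u1 + k * u2)"
      and sh: "phi (diag_map m k z) - diag_map m k z - (m * x, 0) \<in> lat"
      unfolding Q.window_def pt' xy corner by (simp_all add: dims)
    have "0 \<le> m * (x - mu * s2 + s2)" "m * (x - mu * s2) \<le> m * s1"
      "0 \<le> m * (x + mu * s1 + s2)" "m * (x + mu * s1) \<le> m * s1"
      "0 \<le> k * y" "k * (y + (u1 + u2)) \<le> k * (lam * (u1 + u2))"
      using win by (simp_all add: algebra_simps)
    then have "(x, y) \<in> window" using mk unfolding window_def by (simp add: zero_le_mult_iff)
    moreover have "phi (diag_map m k z) - diag_map m k z - (m * x, 0) = diag_map m k (phi z - z - (x, 0))"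
      by (simp add: diag_map_def prod_eq_iff algebra_simps)
    then have "phi z - z - (x, 0) \<in> lat" using sh lat_iff' by (simp only:)
    ultimately show ?thesis using pt_in_lat[of i j] by (simp add: spine_shift_def xy)
  qed
  ultimately have "berg_index P (i + j)" unfolding berg_index_def by blast
  then show thesis by (rule that)
qed

text \<open>
  The corner \<open>z\<close> is chosen such that \<open>phi z - z\<close> is exactly the horizontal offset.
\<close>

lemma berg_with_index:
  assumes n: "0 \<le> n" "n \<le> a + b + c + d - 2"
  obtains P where "berg_partition lat toral_map P" "connectivity_matrix lat toral_map P = transposed" "berg_index P n"
proof -
  obtain i j where ij: "i + j = n" "pt i j \<in> window" using window_ex[OF n] .
  define z :: "real \<times> real" where "z = (fst (pt i j) / (mu - 1), 0)"
  define P where "P = \<lparr>corner = z, width = (\<chi> i. if i = 1 then s1 else s2) :: real^2,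
    height = (\<chi> i. if i = 1 then u1 else u2) :: real^2\<rparr>"
  have shape: "has_shape P" by (simp add: has_shape_def P_def)
  have corner: "corner P = z" by (simp add: P_def)
  have "mu \<noteq> 1" using mu by auto
  then have "(mu - 1) * (fst (pt i j) / (mu - 1)) = fst (pt i j)" by simp
  then have "mu * (fst (pt i j) / (mu - 1)) - fst (pt i j) / (mu - 1) = fst (pt i j)"
    unfolding left_diff_distrib by (simp only: mult_1_left)
  then have "phi z - z - (fst (pt i j), 0) = 0" by (simp add: z_def zero_prod_def)
  then have shift: "spine_shift z (pt i j)" using ij(2) by (simp add: spine_shift_def)
  then have berg: "berg_partition lat toral_map P" using berg_partition_iff[OF shape] corner by metis
  have "rect P i = (\<lambda>t. diag_map 1 1 (z + t)) ` tile i" for i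
    using rect_iff[OF shape] corner by (force simp: image_iff)
  then have "scaled_tiling P 1 1 z" by (simp add: scaled_tiling_def)
  with shift ij(1) have "berg_index P n" unfolding berg_index_def by blast
  then show thesis using that berg connectivity_determined[OF shape berg] by blast
qed

theorem card_berg_classes: "card (berg_classes lat toral_map transposed) = nat ((a + b + c + d) div 2)"
proof -
  define B where "B = {P. berg_partition lat toral_map P \<and> connectivity_matrix lat toral_map P = transposed}"
  define N where "N = a + b + c + d - 2"
  define ix where "ix P = (SOME n. berg_index P n)" for P
  define \<nu> where "\<nu> P = min (ix P) (N - ix P)" for P
  have ix: "berg_index P (ix P)" if "P \<in> B" for P
    using that berg_index_exists[of P] someI_ex[of "berg_index P"] unfolding B_def ix_def by blast
  have N: "0 \<le> N" using off_diagonal nonneg by (simp add: N_def)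
  have range: "0 \<le> ix P" "ix P \<le> N" if "P \<in> B" for P
    using berg_index_range[OF ix[OF that]] by (simp_all add: N_def)
  have equiv: "berg_equivalent lat toral_map P P' \<longleftrightarrow> \<nu> P = \<nu> P'" if "P \<in> B" "P' \<in> B" for P P'
    using equivalent_iff_index[OF ix[OF that(1)] ix[OF that(2)]] unfolding \<nu>_def N_def by linarith
  have "\<nu> ` B = {0..N div 2}"
  proof
    show "\<nu> ` B \<subseteq> {0..N div 2}" using range by (auto simp: \<nu>_def)
    show "{0..N div 2} \<subseteq> \<nu> ` B"
    proof
      fix n assume n: "n \<in> {0..N div 2}"
      then have "0 \<le> n" "n \<le> a + b + c + d - 2" "2 * n \<le> N" using N by (auto simp: N_def)
      then obtain P where P: "P \<in> B" "berg_index P n" using berg_with_index[of n] unfolding B_def by blast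
      have "ix P = n \<or> ix P = N - n"
        using equivalent_iff_index[OF P(2) ix[OF P(1)]] equivalent_iff_index[OF ix[OF P(1)] ix[OF P(1)]]
          equiv[OF P(1) P(1)] unfolding N_def by blast
      then have "\<nu> P = n" using \<open>2 * n \<le> N\<close> by (auto simp: \<nu>_def)
      then show "n \<in> \<nu> ` B" using P(1) by blast
    qed
  qed
  moreover have "card (B // {(P, P'). P \<in> B \<and> P' \<in> B \<and> berg_equivalent lat toral_map P P'}) = card (\<nu> ` B)"
    by (rule card_quotient_eq_card_image) (rule equiv)
  ultimately show ?thesis
    unfolding berg_classes_def Let_def B_def[symmetric] by (simp add: N_def)
qed

end

lemma linear_in_basis_eq_diag_map:
  assumes pos: "0 < s1" "0 < s2" "0 < u1" "0 < u2"
    and row_y: "lam * u1 = of_int (F$1$1) * u1 + of_int (F$2$1) * u2"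
      "lam * u2 = of_int (F$1$2) * u1 + of_int (F$2$2) * u2"
    and row_x: "mu * s2 = of_int (F$1$1) * s2 - of_int (F$2$1) * s1"
      "mu * s1 = of_int (F$2$2) * s1 - of_int (F$1$2) * s2"
  shows "linear_in_basis (s2, u1) (- s1, u2) F = diag_map mu lam"
proof -
  interpret tile_pair s1 s2 u1 u2 by unfold_locales (fact pos)+
  let ?e = "(s2, u1)" and ?f = "(- s1, u2)"
  have ne: "?e \<noteq> ?f" using pos by simp
  have comb: "p = ((u2 * fst p + s1 * snd p) / (s2 * u2 + s1 * u1)) *\<^sub>R ?e
      + ((s2 * snd p - u1 * fst p) / (s2 * u2 + s1 * u1)) *\<^sub>R ?f" for p
  proof -
    let ?D = "s2 * u2 + s1 * u1"
    have "(u2 * fst p + s1 * snd p) * s2 - (s2 * snd p - u1 * fst p) * s1 = fst p * ?D"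
      "(u2 * fst p + s1 * snd p) * u1 + (s2 * snd p - u1 * fst p) * u2 = snd p * ?D"
      by (simp_all add: algebra_simps)
    then have "(u2 * fst p + s1 * snd p) / ?D * s2 - (s2 * snd p - u1 * fst p) / ?D * s1 = fst p"
      "(u2 * fst p + s1 * snd p) / ?D * u1 + (s2 * snd p - u1 * fst p) / ?D * u2 = snd p"
      using det_pos
      by (simp_all only: times_divide_eq_left diff_divide_distrib[symmetric] add_divide_distrib[symmetric]) simp_all
    then show ?thesis by (simp add: prod_eq_iff)
  qed
  have indep: "independent {?e, ?f}"
  proof -
    have "\<not> dependent {?e, ?f}"
    proof
      assume "dependent {?e, ?f}"
      then obtain g where g: "(\<Sum>v\<in>{?e, ?f}. g v *\<^sub>R v) = 0" "g ?e \<noteq> 0 \<or> g ?f \<noteq> 0"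
        by (subst (asm) dependent_finite) auto
      then have "g ?e * s2 - g ?f * s1 = 0" "g ?e * u1 + g ?f * u2 = 0"
        using ne by (simp_all add: zero_prod_def)
      from basis_independent[OF this] g(2) show False by simp
    qed
    then show ?thesis .
  qed
  let ?\<Phi> = "linear_in_basis ?e ?f F"
  have on_basis: "?\<Phi> ?e = diag_map mu lam ?e" "?\<Phi> ?f = diag_map mu lam ?f"
    using row_x row_y by (simp_all add: linear_in_basis(2,3)[OF indep ne])
  show ?thesis
  proof
    fix p
    obtain x y where p: "p = x *\<^sub>R ?e + y *\<^sub>R ?f" using comb by blast
    show "?\<Phi> p = diag_map mu lam p"
      unfolding p linear_add[OF linear_in_basis(1)[OF indep ne]] linear_scale[OF linear_in_basis(1)[OF indep ne]]
        linear_add[OF linear_diag_map] linear_scale[OF linear_diag_map] on_basis ..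
  qed
qed

lemma invertible_int_det:
  fixes F :: "int^2^2"
  assumes "invertible F" shows "\<bar>F$1$1 * F$2$2 - F$1$2 * F$2$1\<bar> = 1"
proof -
  obtain G where "F ** G = mat 1" using assms unfolding invertible_def by blast
  then have "det F * det G = 1" by (metis det_I det_mul)
  then have "\<bar>det F\<bar> = 1" by (auto simp: zmult_eq_1_iff)
  then show ?thesis by (simp add: det_2)
qed

text \<open>
  Hyperbolicity speaks of complex eigenvectors, so the real one is read as a complex one.
\<close>

lemma hyperbolic_eigenvalue_ne_1:
  fixes F :: "int^2^2" and s :: "real^2"
  assumes hyp: "hyperbolic F" and eig: "eigenpair (map_matrix real_of_int F) r s"
  shows "r \<noteq> 1"
proof
  assume r: "r = 1"
  define v :: "complex^2" where "v = (\<chi> i. complex_of_real (s $ i))"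
  have s: "s \<noteq> 0" "map_matrix real_of_int F *v s = r *s s" using eig by (simp_all add: eigenpair_def)
  have "v \<noteq> 0" using s(1) by (auto simp: v_def vec_eq_iff)
  moreover have "map_matrix complex_of_int F *v v = 1 *s v"
  proof -
    have "(map_matrix complex_of_int F *v v) $ i = complex_of_real ((map_matrix real_of_int F *v s) $ i)" for i
      by (simp add: matrix_vector_mult_def map_matrix_def v_def)
    then show ?thesis by (simp add: vec_eq_iff s(2) r v_def)
  qed
  ultimately have "eigenpair (map_matrix complex_of_int F) 1 v" by (simp add: eigenpair_def)
  then show False using hyp unfolding hyperbolic_def by fastforce
qed

theorem theorem1:
  fixes F :: "int^2^2" and s u :: "real^2" and \<sigma> :: int
    and e0 f0 :: "real \<times> real" and L :: "(real \<times> real) set"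
    and \<F> :: "(real \<times> real) set \<Rightarrow> (real \<times> real) set"
  assumes "invertible F" and "hyperbolic F" and "\<forall>i j. 0 \<le> F $ i $ j"
    and "\<sigma> = (\<Sum>i\<in>UNIV. \<Sum>j\<in>UNIV. F $ i $ j)"
    and "column_eigenvector F s" and "\<forall>i. 0 < s $ i"
    and "row_eigenvector F u" and "\<forall>i. 0 < u $ i"
    and "e0 = (s $ 2, u $ 1)" and "f0 = (- s $ 1, u $ 2)"
    and "L = int_span e0 f0"
    and "\<F> = torus_map L (linear_in_basis e0 f0 F)"
  shows "int (card (berg_classes L \<F> (transpose F))) = \<lfloor>real_of_int \<sigma> / 2\<rfloor>"
proof -
  let ?a = "F$1$1" and ?b = "F$1$2" and ?c = "F$2$1" and ?d = "F$2$2"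
  have pos: "0 < s$1" "0 < s$2" "0 < u$1" "0 < u$2" using assms(6,8) by simp_all
  have nonneg: "0 \<le> ?a" "0 \<le> ?b" "0 \<le> ?c" "0 \<le> ?d" using assms(3) by simp_all
  have det: "\<bar>?a * ?d - ?b * ?c\<bar> = 1" using invertible_int_det[OF assms(1)] .
  obtain lam where eig: "eigenpair (map_matrix real_of_int F) lam s"
    using assms(5) unfolding column_eigenvector_def by blast
  have col: "lam * s$1 = ?a * s$1 + ?b * s$2" "lam * s$2 = ?c * s$1 + ?d * s$2"
    using eig by (simp_all add: eigenpair_def vec_eq_iff forall_2 matrix_vector_mult_def map_matrix_def sum_2)
  obtain r where "u v* map_matrix real_of_int F = r *s u"
    using assms(7) unfolding row_eigenvector_def by blast
  then have row: "r * u$1 = ?a * u$1 + ?c * u$2" "r * u$2 = ?b * u$1 + ?d * u$2"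
    by (simp_all add: vec_eq_iff forall_2 vector_matrix_mult_def map_matrix_def sum_2 mult.commute)
  have "r * (u$1 * s$1 + u$2 * s$2) = (r * u$1) * s$1 + (r * u$2) * s$2" by (simp add: algebra_simps)
  also have "\<dots> = u$1 * (lam * s$1) + u$2 * (lam * s$2)" unfolding row col by (simp add: algebra_simps)
  also have "\<dots> = lam * (u$1 * s$1 + u$2 * s$2)" by (simp add: algebra_simps)
  finally have "r = lam" using pos by (simp add: add_pos_pos less_imp_neq[symmetric])
  note row = row[unfolded this]
  have "\<not> (?a = 0 \<and> ?c = 0)" "\<not> (?b = 0 \<and> ?d = 0)" using det by auto
  then have "1 \<le> ?a + ?c" "1 \<le> ?b + ?d" using nonneg by linarith+
  then have "1 * s$1 + 1 * s$2 \<le> of_int (?a + ?c) * s$1 + of_int (?b + ?d) * s$2"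
    using pos by (intro add_mono mult_right_mono) simp_all
  moreover have "lam * (s$1 + s$2) = of_int (?a + ?c) * s$1 + of_int (?b + ?d) * s$2"
    using col by (simp add: algebra_simps)
  ultimately have "1 * (s$1 + s$2) \<le> lam * (s$1 + s$2)" by (simp only: distrib_left)
  then have "1 \<le> lam" using pos by (simp add: add_pos_pos)
  then have lam: "1 < lam" using hyperbolic_eigenvalue_ne_1[OF assms(2) eig] by linarith
  define mu where "mu = of_int (?a * ?d - ?b * ?c) / lam"
  have lam_mu: "lam * mu = of_int (?a * ?d - ?b * ?c)" using lam by (simp add: mu_def)
  have row_x: "mu * s$2 = ?a * s$2 - ?c * s$1" "mu * s$1 = ?d * s$1 - ?b * s$2"
  proof -
    have "lam * (?a * s$2 - ?c * s$1) = ?a * (lam * s$2) - ?c * (lam * s$1)"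
      "lam * (?d * s$1 - ?b * s$2) = ?d * (lam * s$1) - ?b * (lam * s$2)" by (simp_all add: algebra_simps)
    then have "lam * (?a * s$2 - ?c * s$1) = (lam * mu) * s$2" "lam * (?d * s$1 - ?b * s$2) = (lam * mu) * s$1"
      unfolding col lam_mu by (simp_all add: algebra_simps)
    then have "lam * (?a * s$2 - ?c * s$1) = lam * (mu * s$2)" "lam * (?d * s$1 - ?b * s$2) = lam * (mu * s$1)"
      by (simp_all only: mult.assoc)
    then show "mu * s$2 = ?a * s$2 - ?c * s$1" "mu * s$1 = ?d * s$1 - ?b * s$2" using lam by simp_all
  qed
  interpret toral_bipartition "s$1" "s$2" "u$1" "u$2" lam mu ?a ?b ?c ?d
    by unfold_locales (fact pos nonneg det lam lam_mu row row_x)+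
  have L: "L = lat" by (simp add: assms(9-11) lat_def)
  have F: "\<F> = toral_map"
    using linear_in_basis_eq_diag_map[OF pos row row_x] by (simp add: assms(9,10,12) L toral_map_def)
  have tr: "transpose F = transposed" by (simp add: vec_eq_iff forall_2 transpose_def)
  have \<sigma>: "\<sigma> = ?a + ?b + ?c + ?d" by (simp add: assms(4) sum_2)
  have "int (card (berg_classes L \<F> (transpose F))) = \<sigma> div 2"
    using nonneg by (simp add: L F tr card_berg_classes \<sigma>)
  also have "\<dots> = \<lfloor>real_of_int \<sigma> / 2\<rfloor>" using floor_divide_of_int_eq[of \<sigma> 2, where 'a = real] by simp
  finally show ?thesis .
qed

end
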